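(* Let $(\bar{\boldsymbol\Psi},\bar\phi,\bar\epsilon)$, with $\bar{\boldsymbol\Psi}=\{\bar\psi_1,\dots,\bar\psi_N\}$ and $\bar\epsilon=\{\bar\epsilon_1,\dots,\bar\epsilon_N\}$, be a solution of the continuous Kohn-Sham eigenvalue problem on $\Omega$ for a system of $2N$ electrons, as in the context. Then there exist a constant $C>0$ and a neighborhood of $(\bar{\boldsymbol\Psi},\bar\phi)$ in $H^1(\Omega)^N\times H^1(\Omega)$, both independent of the finite-element space $X_h$, such that for every solution $(\bar{\boldsymbol\Psi}^h,\bar\phi^h,\bar\epsilon^h)$ of the discrete finite-element problem with $(\bar{\boldsymbol\Psi}^h,\bar\phi^h)$ in this neighborhood, the energies $E_h=E(\bar{\boldsymbol\Psi}^h,\bar\phi^h)$ and $E=E(\bar{\boldsymbol\Psi},\bar\phi)$ satisfy $$|E_h-E|\le C\Bigl(\sum_{i=1}^N\|\bar\psi_i-\bar\psi_i^h\|_{1,\Omega}^2+|\bar\phi-\bar\phi^h|_{1,\Omega}^2+\sum_{i=1}^N\|\bar\psi_i-\bar\psi_i^h\|_{0,\Omega}\,\|\bar\phi-\bar\phi^h\|_{1,\Omega}\Bigr).$$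
   Context: Norms. $\|\cdot\|_{0,\Omega}$ is the $L^2(\Omega)$ norm, $|\cdot|_{1,\Omega}$ the $H^1(\Omega)$ semi-norm ($|u|_{1,\Omega}=\|\nabla u\|_{0,\Omega}$), and $\|\cdot\|_{1,\Omega}$ the $H^1(\Omega)$ norm. Setting. $\Omega\subset\mathbb R^3$ is a bounded domain (a large enough box or ball for non-periodic problems, or a supercell for periodic problems), and $\mathbb X=H^1_0(\Omega)$ (non-periodic) or $\mathbb X=H^1_{per}(\Omega)$ (periodic). All wavefunctions are real-valued. The nuclear charge distribution $b$ on $\Omega$ is a fixed bounded smooth function. Density. The system has $2N$ electrons (each of $N$ spatial orbitals is doubly occupied). For $\boldsymbol\Psi=\{\psi_1,\dots,\psi_N\}\in\mathbb X^N$, $\rho(\boldsymbol\Psi)=2\sum_{i=1}^N\psi_i^2$. Exchange-correlation. $F(\rho)=\varepsilon_{xc}(\rho)\rho$ with $\varepsilon_{xc}=\varepsilon_x+\varepsilon_c$ (local density approximation), where $\varepsilon_x(\rho)=-\frac34(3/\pi)^{1/3}\rho^{1/3}$ and, with $r_s=(3/(4\pi\rho))^{1/3}$, $\varepsilon_c(\rho)=\gamma/(1+\beta_1\sqrt{r_s}+\beta_2r_s)$ for $r_s\ge1$ and $\varepsilon_c(\rho)=A\log r_s+B+Cr_s\log r_s+Dr_s$ for $r_s<1$. Here $\gamma,A,B,C,D\in\mathbb R$ and $\beta_1,\beta_2>0$ are fixed constants (the Ceperley-Alder parametrization; this $C$ is unrelated to the constant in the claim), and $F$ is treated as twice continuously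 differentiable on $(0,\infty)$. $F'$ denotes the derivative with respect to $\rho$. Energy functional. For $\boldsymbol\Psi\in\mathbb X^N$ and $\phi\in\mathbb X$, $$E(\boldsymbol\Psi,\phi)=2\sum_{i=1}^N\int_\Omega\tfrac12|\nabla\psi_i|^2\,d\mathbf r+\int_\Omega F(\rho(\boldsymbol\Psi))\,d\mathbf r-\frac1{8\pi}\int_\Omega|\nabla\phi|^2\,d\mathbf r+\int_\Omega(\rho(\boldsymbol\Psi)+b)\phi\,d\mathbf r.$$ Continuous problem. $(\bar{\boldsymbol\Psi},\bar\phi,\bar\epsilon)\in\mathbb X^N\times\mathbb X\times\mathbb R^N$ is a solution if $\int_\Omega\bar\psi_i\bar\psi_j\,d\mathbf r=\delta_{ij}$ and, for all $v\in\mathbb X$ and $i=1,\dots,N$, $$\tfrac12\int_\Omega\nabla\bar\psi_i\cdot\nabla v\,d\mathbf r+\int_\Omega F'(\rho(\bar{\boldsymbol\Psi}))\bar\psi_i v\,d\mathbf r+\int_\Omega\bar\phi\,\bar\psi_i v\,d\mathbf r=\bar\epsilon_i\int_\Omega\bar\psi_i v\,d\mathbf r,\qquad \frac1{4\pi}\int_\Omega\nabla\bar\phi\cdot\nabla v\,d\mathbf r=\int_\Omega(\rho(\bar{\boldsymbol\Psi})+b)v\,d\mathbf r.$$ Discrete problem. $X_h\subset\mathbb X$ is a finite-dimensional (finite-element) subspace; $(\bar{\boldsymbol\Psi}^h,\bar\phi^h,\bar\epsilon^h)\in X_h^N\times X_h\times\mathbb R^N$ is a solution if $\int_\Omega\bar\psi^h_i\bar\psi^h_j\,d\mathbf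 r=\delta_{ij}$ and the same equations hold with $(\bar{\boldsymbol\Psi},\bar\phi,\bar\epsilon)$ replaced by $(\bar{\boldsymbol\Psi}^h,\bar\phi^h,\bar\epsilon^h)$, for all test functions $v\in X_h$. *)

theory Defs
  imports "HOL-Analysis.Analysis"
begin

section \<open>Smooth functions\<close>

text \<open>Only meant for open \<open>S\<close>; the elements of \<open>Basis\<close> are the coordinate directions, so the
  iterated \<open>frechet_derivative\<close>s are the partial derivatives (the ordinary one on \<open>real\<close>).\<close>

primrec Ck_on :: "nat \<Rightarrow> ('a::euclidean_space) set \<Rightarrow> ('a \<Rightarrow> real) \<Rightarrow> bool" where
  "Ck_on 0 S f \<longleftrightarrow> continuous_on S f"
| "Ck_on (Suc k) S f \<longleftrightarrow>
     f differentiable_on S \<and> (\<forall>i\<in>Basis. Ck_on k S (\<lambda>x. frechet_derivative f (at x) i))"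

definition smooth_on :: "('a::euclidean_space) set \<Rightarrow> ('a \<Rightarrow> real) \<Rightarrow> bool" where
  "smooth_on S f \<longleftrightarrow> (\<forall>k. Ck_on k S f)"

definition test_functions :: "('a::euclidean_space) set \<Rightarrow> ('a \<Rightarrow> real) set" where
  "test_functions \<Omega> = {\<eta>. smooth_on UNIV \<eta> \<and>
     compact (closure {x. \<eta> x \<noteq> 0}) \<and> closure {x. \<eta> x \<noteq> 0} \<subseteq> \<Omega>}"


section \<open>Sobolev spaces\<close>

text \<open>Elements of \<open>L\<^sup>2(\<Omega>)\<close> and \<open>H\<^sup>1(\<Omega>)\<close> are represented by total functions that are Borel measurable
  on \<open>\<Omega>\<close>; their values outside \<open>\<Omega>\<close> are irrelevant, and nothing below depends on the choice of a
  representative within an almost-everywhere class on \<open>\<Omega>\<close>.\<close>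

definition square_integrable :: "('a::euclidean_space) set \<Rightarrow> ('a \<Rightarrow> 'b::euclidean_space) \<Rightarrow> bool" where
  "square_integrable \<Omega> f \<longleftrightarrow>
     set_borel_measurable lborel \<Omega> f \<and> set_integrable lborel \<Omega> (\<lambda>x. (norm (f x))\<^sup>2)"

definition L2_norm :: "('a::euclidean_space) set \<Rightarrow> ('a \<Rightarrow> 'b::euclidean_space) \<Rightarrow> real" where
  "L2_norm \<Omega> f = sqrt (LINT x:\<Omega>|lborel. (norm (f x))\<^sup>2)"

definition has_weak_gradient ::
  "('a::euclidean_space) set \<Rightarrow> ('a \<Rightarrow> real) \<Rightarrow> ('a \<Rightarrow> 'a) \<Rightarrow> bool" where
  "has_weak_gradient \<Omega> u g \<longleftrightarrow> (\<forall>\<eta>\<in>test_functions \<Omega>. \<forall>i\<in>Basis.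
     (LINT x:\<Omega>|lborel. u x * frechet_derivative \<eta> (at x) i) =
     - (LINT x:\<Omega>|lborel. (g x \<bullet> i) * \<eta> x))"

definition H1 :: "('a::euclidean_space) set \<Rightarrow> ('a \<Rightarrow> real) set" where
  "H1 \<Omega> = {u. square_integrable \<Omega> u \<and> (\<exists>g. square_integrable \<Omega> g \<and> has_weak_gradient \<Omega> u g)}"

text \<open>For \<open>u \<in> H1 \<Omega>\<close> with \<open>\<Omega>\<close> open, the weak gradient is unique up to null subsets of \<open>\<Omega>\<close>.\<close>

definition wgrad :: "('a::euclidean_space) set \<Rightarrow> ('a \<Rightarrow> real) \<Rightarrow> 'a \<Rightarrow> 'a" where
  "wgrad \<Omega> u = (SOME g. square_integrable \<Omega> g \<and> has_weak_gradient \<Omega> u g)"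

definition H1_seminorm :: "('a::euclidean_space) set \<Rightarrow> ('a \<Rightarrow> real) \<Rightarrow> real" where
  "H1_seminorm \<Omega> u = L2_norm \<Omega> (wgrad \<Omega> u)"

definition H1_norm :: "('a::euclidean_space) set \<Rightarrow> ('a \<Rightarrow> real) \<Rightarrow> real" where
  "H1_norm \<Omega> u = sqrt ((L2_norm \<Omega> u)\<^sup>2 + (H1_seminorm \<Omega> u)\<^sup>2)"

definition H1_closure ::
  "('a::euclidean_space) set \<Rightarrow> ('a \<Rightarrow> real) set \<Rightarrow> ('a \<Rightarrow> real) set" where
  "H1_closure \<Omega> S = {u \<in> H1 \<Omega>. \<forall>e>0. \<exists>\<eta>\<in>S. H1_norm \<Omega> (\<lambda>x. u x - \<eta> x) < e}"

definition H1_0 :: "('a::euclidean_space) set \<Rightarrow> ('a \<Rightarrow> real) set" where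
  "H1_0 \<Omega> = H1_closure \<Omega> (test_functions \<Omega>)"

text \<open>The columns of the invertible matrix \<open>A\<close> are the lattice vectors; \<open>c\<close> is a corner of the cell.\<close>

definition supercell :: "real^3^3 \<Rightarrow> real^3 \<Rightarrow> (real^3) set" where
  "supercell A c = {c + A *v t | t. \<forall>i. 0 < t $ i \<and> t $ i < 1}"

definition smooth_periodic :: "real^3^3 \<Rightarrow> (real^3 \<Rightarrow> real) set" where
  "smooth_periodic A = {\<eta>. smooth_on UNIV \<eta> \<and> (\<forall>x i. \<eta> (x + column i A) = \<eta> x)}"

definition H1_per :: "real^3^3 \<Rightarrow> (real^3) set \<Rightarrow> (real^3 \<Rightarrow> real) set" where
  "H1_per A \<Omega> = H1_closure \<Omega> (smooth_periodic A)"

definition wavefunction_space :: "(real^3) set \<Rightarrow> (real^3 \<Rightarrow> real) set \<Rightarrow> bool" where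
  "wavefunction_space \<Omega> X \<longleftrightarrow>
     X = H1_0 \<Omega> \<or> (\<exists>A c. invertible A \<and> \<Omega> = supercell A c \<and> X = H1_per A \<Omega>)"

definition finite_dim_subspace :: "('a \<Rightarrow> real) set \<Rightarrow> ('a \<Rightarrow> real) set \<Rightarrow> bool" where
  "finite_dim_subspace V X \<longleftrightarrow>
     V \<subseteq> X \<and> (\<exists>(m::nat) e. V = {(\<lambda>x. \<Sum>k<m. c k * e k x) | c. True})"

text \<open>An \<open>N\<close>-tuple of functions is a family over \<open>nat\<close> of which only the members \<open>1, \<dots>, N\<close> matter.\<close>

definition H1_product_neighborhood ::
  "('a::euclidean_space) set \<Rightarrow> nat \<Rightarrow> (nat \<Rightarrow> 'a \<Rightarrow> real) \<Rightarrow> ('a \<Rightarrow> real) \<Rightarrow>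
   ((nat \<Rightarrow> 'a \<Rightarrow> real) \<times> ('a \<Rightarrow> real)) set \<Rightarrow> bool" where
  "H1_product_neighborhood \<Omega> N \<Psi> \<phi> U \<longleftrightarrow> (\<exists>\<delta>>0. \<forall>\<Psi>' \<phi>'.
     (\<forall>i\<in>{1..N}. \<Psi>' i \<in> H1 \<Omega>) \<and> \<phi>' \<in> H1 \<Omega> \<and>
     sqrt ((\<Sum>i=1..N. (H1_norm \<Omega> (\<lambda>x. \<Psi>' i x - \<Psi> i x))\<^sup>2) + (H1_norm \<Omega> (\<lambda>x. \<phi>' x - \<phi> x))\<^sup>2) < \<delta>
     \<longrightarrow> (\<Psi>', \<phi>') \<in> U)"


section \<open>The Kohn-Sham model\<close>

definition density :: "nat \<Rightarrow> (nat \<Rightarrow> 'a \<Rightarrow> real) \<Rightarrow> 'a \<Rightarrow> real" where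
  "density N \<Psi> x = 2 * (\<Sum>i=1..N. (\<Psi> i x)\<^sup>2)"

definition eps_x :: "real \<Rightarrow> real" where
  "eps_x \<rho> = - (3/4) * (3 / pi) powr (1/3) * \<rho> powr (1/3)"

definition wigner_seitz :: "real \<Rightarrow> real" where
  "wigner_seitz \<rho> = (3 / (4 * pi * \<rho>)) powr (1/3)"

definition eps_c ::
  "real \<Rightarrow> real \<Rightarrow> real \<Rightarrow> real \<Rightarrow> real \<Rightarrow> real \<Rightarrow> real \<Rightarrow> real \<Rightarrow> real" where
  "eps_c \<gamma> \<beta>1 \<beta>2 A B C D \<rho> =
     (let r = wigner_seitz \<rho> in
      if r \<ge> 1 then \<gamma> / (1 + \<beta>1 * sqrt r + \<beta>2 * r)
      else A * ln r + B + C * r * ln r + D * r)"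

text \<open>The division by zero in \<open>wigner_seitz 0\<close> is harmless: the factor \<open>\<rho>\<close> makes the value at
  \<open>\<rho> = 0\<close> equal to \<open>0\<close>, which is also the limit for \<open>\<rho>\<close> tending to \<open>0\<close> from above.\<close>

definition xc_energy ::
  "real \<Rightarrow> real \<Rightarrow> real \<Rightarrow> real \<Rightarrow> real \<Rightarrow> real \<Rightarrow> real \<Rightarrow> real \<Rightarrow> real" where
  "xc_energy \<gamma> \<beta>1 \<beta>2 A B C D \<rho> = (eps_x \<rho> + eps_c \<gamma> \<beta>1 \<beta>2 A B C D \<rho>) * \<rho>"

definition KS_energy ::
  "('a::euclidean_space) set \<Rightarrow> nat \<Rightarrow> (real \<Rightarrow> real) \<Rightarrow> ('a \<Rightarrow> real) \<Rightarrow>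
   (nat \<Rightarrow> 'a \<Rightarrow> real) \<Rightarrow> ('a \<Rightarrow> real) \<Rightarrow> real" where
  "KS_energy \<Omega> N F b \<Psi> \<phi> =
     2 * (\<Sum>i=1..N. LINT x:\<Omega>|lborel. 1/2 * (norm (wgrad \<Omega> (\<Psi> i) x))\<^sup>2)
     + (LINT x:\<Omega>|lborel. F (density N \<Psi> x))
     - 1 / (8 * pi) * (LINT x:\<Omega>|lborel. (norm (wgrad \<Omega> \<phi> x))\<^sup>2)
     + (LINT x:\<Omega>|lborel. (density N \<Psi> x + b x) * \<phi> x)"

text \<open>\<open>V\<close> is both the trial and the test space: the full space for the continuous problem, the
  finite-element space for the discrete one. The value of \<open>deriv F\<close> at \<open>0\<close> is irrelevant, since
  every \<open>\<Psi> i\<close> vanishes where the density does.\<close>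

definition KS_solution ::
  "('a::euclidean_space) set \<Rightarrow> ('a \<Rightarrow> real) set \<Rightarrow> nat \<Rightarrow> (real \<Rightarrow> real) \<Rightarrow> ('a \<Rightarrow> real) \<Rightarrow>
   (nat \<Rightarrow> 'a \<Rightarrow> real) \<Rightarrow> ('a \<Rightarrow> real) \<Rightarrow> (nat \<Rightarrow> real) \<Rightarrow> bool" where
  "KS_solution \<Omega> V N F b \<Psi> \<phi> \<epsilon> \<longleftrightarrow>
     (\<forall>i\<in>{1..N}. \<Psi> i \<in> V) \<and> \<phi> \<in> V \<and>
     (\<forall>i\<in>{1..N}. \<forall>j\<in>{1..N}. (LINT x:\<Omega>|lborel. \<Psi> i x * \<Psi> j x) = (if i = j then 1 else 0)) \<and>
     (\<forall>v\<in>V. \<forall>i\<in>{1..N}.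
        1/2 * (LINT x:\<Omega>|lborel. wgrad \<Omega> (\<Psi> i) x \<bullet> wgrad \<Omega> v x)
        + (LINT x:\<Omega>|lborel. deriv F (density N \<Psi> x) * \<Psi> i x * v x)
        + (LINT x:\<Omega>|lborel. \<phi> x * \<Psi> i x * v x)
        = \<epsilon> i * (LINT x:\<Omega>|lborel. \<Psi> i x * v x)) \<and>
     (\<forall>v\<in>V. 1 / (4 * pi) * (LINT x:\<Omega>|lborel. wgrad \<Omega> \<phi> x \<bullet> wgrad \<Omega> v x)
        = (LINT x:\<Omega>|lborel. (density N \<Psi> x + b x) * v x))"

end

theory Submission
  imports Defs "HOL-Computational_Algebra.Polynomial"
begin

text \<open>
  Expanding \<open>E(\<Psi>\<^sup>h, \<phi>\<^sup>h) - E(\<Psi>, \<phi>)\<close> around the solution, the first-order terms are the weak equations tested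
  with \<open>e\<^sub>i = \<psi>\<^sub>i\<^sup>h - \<psi>\<^sub>i\<close> and \<open>f = \<phi>\<^sup>h - \<phi>\<close>, which is admissible because \<open>X\<^sub>h \<subseteq> X\<close>. What they leave is
  \<open>4 \<epsilon>\<^sub>i \<integral> \<psi>\<^sub>i e\<^sub>i\<close>, and this equals \<open>- 2 \<epsilon>\<^sub>i \<integral> e\<^sub>i\<^sup>2\<close> as both orbitals are normalised. All remaining
  terms are integrals of products of three or four functions and are controlled by the embedding of \<open>X\<close> into
  \<open>L\<^sup>4\<close>. That embedding comes from the Ladyzhenskaya inequality on a parallelepiped, which holds for all
  \<open>C\<^sup>1\<close> functions without boundary conditions and so covers both boundary conditions at once. The
  exchange-correlation remainder is handled pointwise: \<open>F\<close>, \<open>\<rho> F'\<close> and \<open>\<rho>\<^sup>2 F''\<close> are all \<open>O(\<rho> (1 + \<rho>))\<close>.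
\<close>

section \<open>Smooth bump functions\<close>

text \<open>\<open>wgrad\<close> is a Hilbert choice, so even the expansion of the Dirichlet energy
  rests on uniqueness of weak gradients almost everywhere; the bump functions serve to prove this.
  Both candidates for \<open>X\<close> are closures of smooth functions. The bound in L4 is
  therefore proved for smooth functions and passed to the closure by Fatou's lemma. A test function
  extends by zero from \<Omega> to a large cube, while the supercell is a parallelepiped already.
  After the cancellation the error \<open>f\<close> of the potential survives in its squared
  seminorm and in products with the change of the density. In \<integral> \<open>f\<close> \<psi>
  \<open>e\<close> the factor \<open>e\<close> is charged in L2 and the other two in L4, which is
  the origin of the mixed term of the claim. The neighbourhood is needed to lower powers: once the
  squared orbital errors sum to at most 1, the quartic term becomes quadratic and the cubic term
  \<integral> \<open>f\<close> \<open>e\<close>^2 becomes mixed. The correlation energy changes its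
  formula where the Wigner-Seitz radius is 1. The bounds on the derivatives are proved on both sides
  and reach the threshold by continuity.\<close>

lemma Ck_on_SucD: "Ck_on (Suc k) UNIV f \<Longrightarrow> Ck_on k UNIV f"
proof (induction k arbitrary: f)
  case 0
  then show ?case by (simp add: differentiable_imp_continuous_on)
next
  case (Suc k)
  then show ?case by (simp only: Ck_on.simps(2)) blast
qed

lemma frechet_derivative_eqI: "(f has_derivative f') (at x) \<Longrightarrow> frechet_derivative f (at x) = f'"
  by (metis frechet_derivative_at)

lemma differentiable_on_UNIV_D: "f differentiable_on UNIV \<Longrightarrow> (f has_derivative frechet_derivative f (at x)) (at x)"
  by (simp add: differentiable_on_def frechet_derivative_works)

lemma differentiable_on_UNIV_I: "(\<And>x. (f has_derivative f' x) (at x)) \<Longrightarrow> f differentiable_on UNIV"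
  by (auto simp: differentiable_on_def differentiable_def)

lemma Ck_on_const: "Ck_on k UNIV (\<lambda>_. c)"
proof (induction k arbitrary: c)
  case (Suc k)
  then show ?case by (simp add: differentiable_on_const)
qed simp

lemma Ck_on_linear_combination:
  "\<lbrakk>Ck_on k UNIV f; Ck_on k UNIV g\<rbrakk> \<Longrightarrow> Ck_on k UNIV (\<lambda>x. a * f x + c * g x)"
proof (induction k arbitrary: f g)
  case 0
  then show ?case by (auto intro!: continuous_intros)
next
  case (Suc k)
  have d: "((\<lambda>x. a * f x + c * g x) has_derivative
      (\<lambda>h. a * frechet_derivative f (at x) h + c * frechet_derivative g (at x) h)) (at x)" for x
    using Suc.prems by (auto intro!: derivative_eq_intros differentiable_on_UNIV_D)
  show ?case
    using Suc by (auto simp: frechet_derivative_eqI[OF d] intro: differentiable_on_UNIV_I[OF d])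
qed

lemma Ck_on_diff: "\<lbrakk>Ck_on k UNIV f; Ck_on k UNIV g\<rbrakk> \<Longrightarrow> Ck_on k UNIV (\<lambda>x. f x - g x)"
  using Ck_on_linear_combination[of k f g 1 "-1"] by simp

lemma Ck_on_mult:
  "\<lbrakk>Ck_on k UNIV f; Ck_on k UNIV g\<rbrakk> \<Longrightarrow> Ck_on k UNIV (\<lambda>x. f x * g x)"
proof (induction k arbitrary: f g)
  case 0
  then show ?case by (auto intro!: continuous_intros)
next
  case (Suc k)
  \<comment> \<open>The factors \<open>1 *\<close> give the derivative literally the shape of
    \<open>Ck_on_linear_combination\<close>.\<close>
  have d: "((\<lambda>x. f x * g x) has_derivative
      (\<lambda>h. 1 * (f x * frechet_derivative g (at x) h) + 1 * (frechet_derivative f (at x) h * g x))) (at x)" for x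
    using Suc.prems by (auto intro!: derivative_eq_intros differentiable_on_UNIV_D)
  have "Ck_on k UNIV (\<lambda>x. 1 * (f x * frechet_derivative g (at x) i) + 1 * (frechet_derivative f (at x) i * g x))"
    if "i \<in> Basis" for i
  proof (rule Ck_on_linear_combination; rule Suc.IH)
    show "Ck_on k UNIV f" "Ck_on k UNIV g" using Suc.prems by (auto intro!: Ck_on_SucD simp del: Ck_on.simps)
  qed (use Suc.prems that in auto)
  then show ?case
    using Suc.prems by (auto simp: frechet_derivative_eqI[OF d] intro: differentiable_on_UNIV_I[OF d])
qed

text \<open>This special chain rule is enough for bumps that are products of one-variable functions
  of affine forms. The induction closes because a partial derivative has the same shape again, times
  the constant \<open>i \<bullet> w\<close>.\<close>

lemma Ck_on_compose_inner:
  fixes h :: "real \<Rightarrow> real" and w :: "'a::euclidean_space"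
  shows "Ck_on k UNIV h \<Longrightarrow> Ck_on k UNIV (\<lambda>x. h (x \<bullet> w + c))"
proof (induction k arbitrary: h)
  case 0
  then show ?case
    by (auto intro!: continuous_intros intro: continuous_on_compose2[of UNIV h])
next
  case (Suc k)
  have lin: "frechet_derivative h (at t) s = s * frechet_derivative h (at t) 1" for t s
  proof -
    have "linear (frechet_derivative h (at t))"
      using Suc.prems by (intro linear_frechet_derivative) (auto simp: differentiable_on_def)
    then show ?thesis by (metis linear_scale mult.right_neutral real_scaleR_def)
  qed
  have d: "((\<lambda>x. h (x \<bullet> w + c)) has_derivative (\<lambda>v. frechet_derivative h (at (x \<bullet> w + c)) (v \<bullet> w))) (at x)" for x
  proof -
    have "((\<lambda>x. x \<bullet> w + c) has_derivative (\<lambda>v. v \<bullet> w)) (at x)"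
      by (auto intro!: derivative_eq_intros)
    moreover have "(h has_derivative frechet_derivative h (at (x \<bullet> w + c))) (at (x \<bullet> w + c))"
      using Suc.prems by (auto intro: differentiable_on_UNIV_D)
    ultimately show ?thesis by (rule has_derivative_compose)
  qed
  have "Ck_on k UNIV (\<lambda>x. (i \<bullet> w) * frechet_derivative h (at (x \<bullet> w + c)) 1)" for i
    by (intro Ck_on_mult Ck_on_const Suc.IH) (use Suc.prems in simp)
  then show ?case
    by (auto simp: frechet_derivative_eqI[OF d] lin[of _ "_ \<bullet> _"] intro: differentiable_on_UNIV_I[OF d])
qed

lemma Ck_on_prod:
  "(\<And>i. i \<in> I \<Longrightarrow> Ck_on k UNIV (f i)) \<Longrightarrow> Ck_on k UNIV (\<lambda>x. \<Prod>i\<in>I. f i x)"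
  by (induction I rule: infinite_finite_induct) (auto intro: Ck_on_const Ck_on_mult)

text \<open>This family is closed under differentiation, hence consists of smooth functions.\<close>

definition exp_poly_inverse :: "real poly \<Rightarrow> real \<Rightarrow> real" where
  "exp_poly_inverse p t = (if t > 0 then poly p (1 / t) * exp (- (1 / t)) else 0)"

text \<open>The power \<open>y ^ k\<close> is carried along for the induction: splitting off a
  coefficient of the polynomial raises it by one.\<close>

lemma tendsto_poly_div_exp_0: "((\<lambda>y::real. y ^ k * poly p y / exp y) \<longlongrightarrow> 0) at_top"
proof (induction p arbitrary: k rule: pCons_induct)
  case (pCons a p)
  have "((\<lambda>y. a * (y ^ k / exp y) + y ^ Suc k * poly p y / exp y) \<longlongrightarrow> a * 0 + 0) at_top"
    by (intro tendsto_intros tendsto_power_div_exp_0 pCons.IH)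
  then show ?case by (simp add: field_simps)
qed simp

lemma exp_poly_inverse_tendsto_0: "(exp_poly_inverse p \<longlongrightarrow> 0) (at 0)"
proof (rule filterlim_split_at)
  show "(exp_poly_inverse p \<longlongrightarrow> 0) (at_left 0)"
    by (rule Lim_transform_eventually[OF tendsto_const])
      (auto simp: exp_poly_inverse_def eventually_at_left_field intro!: exI[of _ "-1"])
  have "((\<lambda>t. poly p (inverse t) / exp (inverse t)) \<longlongrightarrow> 0) (at_right 0)"
    using filterlim_compose[OF tendsto_poly_div_exp_0[of 0 p] filterlim_inverse_at_top_right] by simp
  then show "(exp_poly_inverse p \<longlongrightarrow> 0) (at_right 0)"
    by (rule Lim_transform_eventually)
      (auto simp: exp_poly_inverse_def eventually_at_right_field exp_minus divide_inverse intro!: exI[of _ 1])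
qed

text \<open>For \<open>t > 0\<close> the chain rule turns \<open>p\<close> into
  \<open>p - pderiv p\<close> and produces a factor \<open>(1 / t)\<^sup>2\<close>, which
  \<open>[:0,0,1:]\<close> encodes.\<close>

lemma exp_poly_inverse_DERIV:
  "(exp_poly_inverse p has_real_derivative exp_poly_inverse ([:0,0,1:] * (p - pderiv p)) t) (at t)"
proof -
  consider "t < 0" | "t = 0" | "t > 0" by linarith
  then show ?thesis
  proof cases
    case 1
    have "((\<lambda>_. 0) has_real_derivative 0) (at t)" by simp
    then have "(exp_poly_inverse p has_real_derivative 0) (at t)"
      by (rule has_field_derivative_transform_within_open[where S="{..<0}"])
        (use 1 in \<open>auto simp: exp_poly_inverse_def\<close>)
    then show ?thesis using 1 by (simp add: exp_poly_inverse_def)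
  next
    case 2
    \<comment> \<open>Division by \<open>h\<close> multiplies the polynomial by its variable, so the
      difference quotient at 0 is itself a member of the family and tends to 0.\<close>
    have "((\<lambda>h. exp_poly_inverse p h / h) \<longlongrightarrow> 0) (at 0)"
      by (rule Lim_transform_eventually[OF exp_poly_inverse_tendsto_0[of "[:0,1:] * p"]])
        (auto simp: exp_poly_inverse_def eventually_at_filter)
    then show ?thesis using 2
      by (simp add: DERIV_def exp_poly_inverse_def)
  next
    case 3
    have inv: "((\<lambda>t. 1 / t) has_real_derivative - (1 / t)\<^sup>2) (at t)"
      using 3 by (auto intro!: derivative_eq_intros simp: power2_eq_square)
    have "((\<lambda>t. poly p (1 / t) * exp (- (1 / t))) has_real_derivative
       poly (pderiv p) (1 / t) * - (1 / t)\<^sup>2 * exp (- (1 / t)) + exp (- (1 / t)) * - (- (1 / t)\<^sup>2) * poly p (1 / t)) (at t)"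
      by (intro DERIV_mult DERIV_chain2[OF poly_DERIV inv] DERIV_chain2[OF DERIV_exp DERIV_minus[OF inv]])
    also have "poly (pderiv p) (1 / t) * - (1 / t)\<^sup>2 * exp (- (1 / t)) + exp (- (1 / t)) * - (- (1 / t)\<^sup>2) * poly p (1 / t)
        = exp_poly_inverse ([:0,0,1:] * (p - pderiv p)) t"
      using 3 by (simp add: exp_poly_inverse_def power2_eq_square algebra_simps)
    finally have "((\<lambda>t. poly p (1 / t) * exp (- (1 / t))) has_real_derivative
       exp_poly_inverse ([:0,0,1:] * (p - pderiv p)) t) (at t)" .
    then show ?thesis
      by (rule has_field_derivative_transform_within_open[where S="{0<..}"])
        (use 3 in \<open>auto simp: exp_poly_inverse_def\<close>)
  qed
qed

lemma Ck_on_exp_poly_inverse: "Ck_on k UNIV (exp_poly_inverse p)"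
proof (induction k arbitrary: p)
  case 0
  then show ?case
    using exp_poly_inverse_DERIV by (auto intro: DERIV_continuous_on)
next
  case (Suc k)
  have d: "(exp_poly_inverse p has_derivative (\<lambda>h. exp_poly_inverse ([:0,0,1:] * (p - pderiv p)) x * h)) (at x)" for x
    using exp_poly_inverse_DERIV by (simp add: has_field_derivative_def)
  show ?case
    using Suc by (auto simp: frechet_derivative_eqI[OF d] simp del: mult_pCons_left intro: differentiable_on_UNIV_I[OF d])
qed

text \<open>The arguments are dilated by \<open>Suc n\<close>, so that each factor \<open>exp (- 1 / t)\<close> becomes
  \<open>exp (- 1 / (Suc n * t))\<close> and tends to \<open>1\<close> for \<open>t > 0\<close>.\<close>

definition box_bump :: "nat \<Rightarrow> 'a::euclidean_space \<Rightarrow> 'a \<Rightarrow> 'a \<Rightarrow> real" where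
  "box_bump n a b x = (\<Prod>i\<in>Basis. exp_poly_inverse 1 (x \<bullet> (real (Suc n) *\<^sub>R i) + (- real (Suc n) * (a \<bullet> i)))
      * exp_poly_inverse 1 (x \<bullet> (- real (Suc n) *\<^sub>R i) + real (Suc n) * (b \<bullet> i)))"

lemma box_bump_eq:
  "box_bump n a b x = (\<Prod>i\<in>Basis. exp_poly_inverse 1 (real (Suc n) * ((x - a) \<bullet> i)) * exp_poly_inverse 1 (real (Suc n) * ((b - x) \<bullet> i)))"
  unfolding box_bump_def by (intro prod.cong refl) (simp add: inner_diff_left algebra_simps)

lemma exp_poly_inverse_1_bounds: "0 \<le> exp_poly_inverse 1 t" "exp_poly_inverse 1 t \<le> 1"
  "exp_poly_inverse 1 t \<noteq> 0 \<longleftrightarrow> t > 0"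
  by (auto simp: exp_poly_inverse_def)

lemma box_bump_bounds: "0 \<le> box_bump n a b x" "box_bump n a b x \<le> 1"
  by (auto simp: box_bump_def exp_poly_inverse_1_bounds intro!: prod_nonneg prod_le_1 mult_le_one)

lemma box_bump_nonzero_iff: "box_bump n a b x \<noteq> 0 \<longleftrightarrow> x \<in> box a b"
proof -
  have "box_bump n a b x \<noteq> 0 \<longleftrightarrow> (\<forall>i\<in>Basis. 0 < real (Suc n) * ((x - a) \<bullet> i) \<and> 0 < real (Suc n) * ((b - x) \<bullet> i))"
    unfolding box_bump_eq by (simp add: exp_poly_inverse_1_bounds del: of_nat_Suc)
  also have "\<dots> \<longleftrightarrow> x \<in> box a b"
    by (auto simp: zero_less_mult_iff mem_box inner_diff_left simp del: of_nat_Suc)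
  finally show ?thesis .
qed

lemma box_bump_test_function:
  assumes "cbox a b \<subseteq> \<Omega>"
  shows "box_bump n a b \<in> test_functions \<Omega>"
proof -
  have "{x. box_bump n a b x \<noteq> 0} = box a b" using box_bump_nonzero_iff by blast
  moreover have cl: "closure (box a b) \<subseteq> cbox a b"
    by (rule closure_minimal) (auto simp: mem_box less_imp_le)
  moreover have "compact (closure (box a b))" by (simp add: bounded_box)
  moreover have "smooth_on UNIV (box_bump n a b)"
    unfolding smooth_on_def box_bump_def[abs_def]
    by (intro allI Ck_on_prod Ck_on_mult Ck_on_compose_inner Ck_on_exp_poly_inverse)
  ultimately show ?thesis using assms by (auto simp: test_functions_def)
qed

lemma box_bump_tendsto_indicator:
  fixes x :: "'a::euclidean_space"
  shows "(\<lambda>n. box_bump n a b x) \<longlonglongrightarrow> indicator (box a b) x"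
proof (cases "x \<in> box a b")
  case True
  have lim: "(\<lambda>n. exp_poly_inverse 1 (real (Suc n) * s)) \<longlonglongrightarrow> 1" if "s > 0" for s
  proof -
    have "(\<lambda>n. exp (- (inverse (real (Suc n)) * (1 / s)))) \<longlonglongrightarrow> exp (- (0 * (1 / s)))"
      by (intro tendsto_intros LIMSEQ_inverse_real_of_nat)
    then show ?thesis using that
      by (simp add: exp_poly_inverse_def zero_less_mult_iff divide_inverse mult_ac)
  qed
  have "(\<lambda>n. \<Prod>i\<in>Basis. exp_poly_inverse 1 (real (Suc n) * ((x - a) \<bullet> i)) * exp_poly_inverse 1 (real (Suc n) * ((b - x) \<bullet> i)))
     \<longlonglongrightarrow> (\<Prod>i\<in>(Basis :: 'a set). 1 * 1)"
    using True by (intro tendsto_prod tendsto_mult lim) (auto simp: mem_box inner_diff_left)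
  then have "(\<lambda>n. box_bump n a b x) \<longlonglongrightarrow> 1"
    by (simp add: box_bump_eq[abs_def] del: of_nat_Suc)
  then show ?thesis using True by simp
next
  case False
  then show ?thesis using box_bump_nonzero_iff[of _ a b x] by simp
qed

section \<open>Weak gradients on a bounded domain\<close>

locale bounded_domain =
  fixes \<Omega> :: "'a::euclidean_space set"
  assumes open_domain: "open \<Omega>" and bounded_domain: "bounded \<Omega>"
begin

text \<open>Over this measure the integrals on \<Omega> become plain integrals on a finite measure
  space, where bounded measurable functions are integrable.\<close>

abbreviation M :: "'a measure" where "M \<equiv> restrict_space lborel \<Omega>"

lemma domain_sets[measurable, simp]: "\<Omega> \<in> sets borel"
  using open_domain by simp

lemma space_M[simp]: "space M = \<Omega>"
  by (simp add: space_restrict_space)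

lemma finite_measure_M: "finite_measure M"
proof
  have "emeasure lborel \<Omega> < \<infinity>" using bounded_domain by (rule emeasure_bounded_finite)
  then show "emeasure M (space M) \<noteq> \<infinity>"
    by (simp add: emeasure_restrict_space)
qed

sublocale finite_measure M by (rule finite_measure_M)

lemma set_integral_eq: "(LINT x:\<Omega>|lborel. f x) = (\<integral>x. f x \<partial>M)" for f :: "'a \<Rightarrow> real"
  by (simp add: set_lebesgue_integral_def integral_restrict_space)

section \<open>Calculus with square integrable functions\<close>

lemma square_integrable_iff:
  "square_integrable \<Omega> f \<longleftrightarrow> f \<in> borel_measurable M \<and> integrable M (\<lambda>x. (norm (f x))\<^sup>2)"
  by (simp add: square_integrable_def set_borel_measurable_def set_integrable_def
      borel_measurable_restrict_space_iff integrable_restrict_space)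

lemma L2_norm_sq: "(L2_norm \<Omega> f)\<^sup>2 = (\<integral>x. (norm (f x))\<^sup>2 \<partial>M)"
  by (simp add: L2_norm_def set_integral_eq)

lemma L2_norm_nonneg: "0 \<le> L2_norm \<Omega> f"
  by (simp add: L2_norm_def set_integral_eq)

lemma borel_measurable_M: "f \<in> borel_measurable borel \<Longrightarrow> f \<in> borel_measurable M"
  by (rule measurable_restrict_space1) simp

lemma square_integrable_measurable: "square_integrable \<Omega> f \<Longrightarrow> f \<in> borel_measurable M"
  by (simp add: square_integrable_iff)

lemma square_integrable_bounded:
  assumes "f \<in> borel_measurable M" "\<And>x. x \<in> \<Omega> \<Longrightarrow> norm (f x) \<le> B"
  shows "square_integrable \<Omega> f"
proof -
  have "integrable M (\<lambda>x. (norm (f x))\<^sup>2)"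
  proof (rule integrable_const_bound[where B="B\<^sup>2"])
    show "AE x in M. norm ((norm (f x))\<^sup>2) \<le> B\<^sup>2"
      using assms(2) by (auto intro!: AE_I2 power_mono)
  qed (use assms(1) in measurable)
  then show ?thesis using assms(1) by (simp add: square_integrable_iff)
qed

lemma norm_mult_integrable:
  assumes f: "square_integrable \<Omega> f" and g: "square_integrable \<Omega> g"
  shows "integrable M (\<lambda>x. norm (f x) * norm (g x))"
proof (rule Bochner_Integration.integrable_bound)
  note [measurable] = f[THEN square_integrable_measurable] g[THEN square_integrable_measurable]
  show "integrable M (\<lambda>x. (norm (f x))\<^sup>2 + (norm (g x))\<^sup>2)"
    using f g by (auto simp: square_integrable_iff)
  show "(\<lambda>x. norm (f x) * norm (g x)) \<in> borel_measurable M" by measurable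
  show "AE x in M. norm (norm (f x) * norm (g x)) \<le> norm ((norm (f x))\<^sup>2 + (norm (g x))\<^sup>2)"
  proof (intro AE_I2)
    fix x
    have "2 * (norm (f x) * norm (g x)) \<le> (norm (f x))\<^sup>2 + (norm (g x))\<^sup>2"
      using sum_squares_bound[of "norm (f x)" "norm (g x)"] by simp
    moreover have "0 \<le> norm (f x) * norm (g x)" by simp
    ultimately show "norm (norm (f x) * norm (g x)) \<le> norm ((norm (f x))\<^sup>2 + (norm (g x))\<^sup>2)"
      unfolding real_norm_def by linarith
  qed
qed

lemma mult_integrable:
  fixes f g :: "'a \<Rightarrow> real"
  assumes f: "square_integrable \<Omega> f" and g: "square_integrable \<Omega> g"
  shows "integrable M (\<lambda>x. f x * g x)"
  by (rule Bochner_Integration.integrable_bound[OF norm_mult_integrable[OF f g]])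
    (use f[THEN square_integrable_measurable] g[THEN square_integrable_measurable] in \<open>auto simp: abs_mult\<close>)

lemma inner_integrable:
  assumes f: "square_integrable \<Omega> f" and g: "square_integrable \<Omega> g"
  shows "integrable M (\<lambda>x. f x \<bullet> g x)"
  by (rule Bochner_Integration.integrable_bound[OF norm_mult_integrable[OF f g]])
    (use f[THEN square_integrable_measurable] g[THEN square_integrable_measurable] in \<open>auto simp: Cauchy_Schwarz_ineq2\<close>)

lemma Cauchy_Schwarz_L2:
  assumes f: "square_integrable \<Omega> f" and g: "square_integrable \<Omega> g"
  shows "(\<integral>x. norm (f x) * norm (g x) \<partial>M) \<le> L2_norm \<Omega> f * L2_norm \<Omega> g"
proof -
  note [measurable] = f[THEN square_integrable_measurable] g[THEN square_integrable_measurable]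
  have "(ennreal (\<integral>x. norm (f x) * norm (g x) \<partial>M))\<^sup>2 = (\<integral>\<^sup>+x. ennreal (norm (f x)) * ennreal (norm (g x)) \<partial>M)\<^sup>2"
    by (subst nn_integral_eq_integral[symmetric]) (auto simp: norm_mult_integrable f g ennreal_mult)
  also have "\<dots> \<le> (\<integral>\<^sup>+x. (ennreal (norm (f x)))\<^sup>2 \<partial>M) * (\<integral>\<^sup>+x. (ennreal (norm (g x)))\<^sup>2 \<partial>M)"
    by (rule Cauchy_Schwarz_nn_integral) measurable
  also have "\<dots> = ennreal ((L2_norm \<Omega> f)\<^sup>2) * ennreal ((L2_norm \<Omega> g)\<^sup>2)"
    unfolding L2_norm_sq using f g
    by (subst (1 2) nn_integral_eq_integral[symmetric]) (auto simp: square_integrable_iff ennreal_power)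
  finally have "ennreal ((\<integral>x. norm (f x) * norm (g x) \<partial>M)\<^sup>2) \<le> ennreal ((L2_norm \<Omega> f * L2_norm \<Omega> g)\<^sup>2)"
    by (simp add: ennreal_power ennreal_mult power_mult_distrib)
  then have "(\<integral>x. norm (f x) * norm (g x) \<partial>M)\<^sup>2 \<le> (L2_norm \<Omega> f * L2_norm \<Omega> g)\<^sup>2"
    by simp
  then show ?thesis
    by (rule power2_le_imp_le) (simp add: L2_norm_nonneg)
qed

lemma square_integrable_scaleR:
  assumes f: "square_integrable \<Omega> f" shows "square_integrable \<Omega> (\<lambda>x. c *\<^sub>R f x)"
  using f by (auto simp: square_integrable_iff power_mult_distrib)

lemma square_integrable_add:
  assumes f: "square_integrable \<Omega> f" and g: "square_integrable \<Omega> g"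
  shows "square_integrable \<Omega> (\<lambda>x. f x + g x)"
proof -
  note [measurable] = f[THEN square_integrable_measurable] g[THEN square_integrable_measurable]
  have "integrable M (\<lambda>x. (norm (f x + g x))\<^sup>2)"
  proof (rule Bochner_Integration.integrable_bound)
    show "integrable M (\<lambda>x. (norm (f x))\<^sup>2 + 2 * (norm (f x) * norm (g x)) + (norm (g x))\<^sup>2)"
      using f g norm_mult_integrable[OF f g] by (auto simp: square_integrable_iff)
    show "AE x in M. norm ((norm (f x + g x))\<^sup>2) \<le> norm ((norm (f x))\<^sup>2 + 2 * (norm (f x) * norm (g x)) + (norm (g x))\<^sup>2)"
    proof (intro AE_I2)
      fix x
      have "(norm (f x + g x))\<^sup>2 \<le> (norm (f x) + norm (g x))\<^sup>2"
        by (intro power_mono norm_triangle_ineq) simp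
      then show "norm ((norm (f x + g x))\<^sup>2) \<le> norm ((norm (f x))\<^sup>2 + 2 * (norm (f x) * norm (g x)) + (norm (g x))\<^sup>2)"
        by (simp add: power2_sum)
    qed
  qed measurable
  then show ?thesis by (simp add: square_integrable_iff)
qed

lemma square_integrable_diff:
  assumes "square_integrable \<Omega> f" and "square_integrable \<Omega> g"
  shows "square_integrable \<Omega> (\<lambda>x. f x - g x)"
  using square_integrable_add[OF assms(1) square_integrable_scaleR[OF assms(2), of "-1"]] by simp

lemma square_integrable_inner:
  assumes f: "square_integrable \<Omega> f" shows "square_integrable \<Omega> (\<lambda>x. f x \<bullet> w)"
proof -
  note [measurable] = f[THEN square_integrable_measurable]
  have "integrable M (\<lambda>x. (norm (f x \<bullet> w))\<^sup>2)"
  proof (rule Bochner_Integration.integrable_bound)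
    show "integrable M (\<lambda>x. (norm w)\<^sup>2 * (norm (f x))\<^sup>2)"
      using f by (auto simp: square_integrable_iff)
    show "AE x in M. norm ((norm (f x \<bullet> w))\<^sup>2) \<le> norm ((norm w)\<^sup>2 * (norm (f x))\<^sup>2)"
    proof (intro AE_I2)
      fix x
      have "(\<bar>f x \<bullet> w\<bar>)\<^sup>2 \<le> (norm (f x) * norm w)\<^sup>2"
        by (intro power_mono Cauchy_Schwarz_ineq2) simp
      then show "norm ((norm (f x \<bullet> w))\<^sup>2) \<le> norm ((norm w)\<^sup>2 * (norm (f x))\<^sup>2)"
        by (simp add: power_mult_distrib mult.commute)
    qed
  qed measurable
  then show ?thesis by (simp add: square_integrable_iff)
qed

lemma L2_norm_triangle:
  assumes f: "square_integrable \<Omega> f" and g: "square_integrable \<Omega> g"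
  shows "L2_norm \<Omega> (\<lambda>x. f x + g x) \<le> L2_norm \<Omega> f + L2_norm \<Omega> g"
proof (rule power2_le_imp_le)
  have "(L2_norm \<Omega> (\<lambda>x. f x + g x))\<^sup>2 \<le> (\<integral>x. (norm (f x))\<^sup>2 + 2 * (norm (f x) * norm (g x)) + (norm (g x))\<^sup>2 \<partial>M)"
    unfolding L2_norm_sq
  proof (rule integral_mono)
    show "integrable M (\<lambda>x. (norm (f x + g x))\<^sup>2)"
      using square_integrable_add[OF f g] by (simp add: square_integrable_iff)
    show "integrable M (\<lambda>x. (norm (f x))\<^sup>2 + 2 * (norm (f x) * norm (g x)) + (norm (g x))\<^sup>2)"
      using f g norm_mult_integrable[OF f g] by (auto simp: square_integrable_iff)
    fix x
    have "(norm (f x + g x))\<^sup>2 \<le> (norm (f x) + norm (g x))\<^sup>2"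
      by (intro power_mono norm_triangle_ineq) simp
    then show "(norm (f x + g x))\<^sup>2 \<le> (norm (f x))\<^sup>2 + 2 * (norm (f x) * norm (g x)) + (norm (g x))\<^sup>2"
      by (simp add: power2_sum)
  qed
  also have "\<dots> = (L2_norm \<Omega> f)\<^sup>2 + 2 * (\<integral>x. norm (f x) * norm (g x) \<partial>M) + (L2_norm \<Omega> g)\<^sup>2"
    using f g norm_mult_integrable[OF f g] by (simp add: L2_norm_sq square_integrable_iff)
  also have "\<dots> \<le> (L2_norm \<Omega> f + L2_norm \<Omega> g)\<^sup>2"
    using Cauchy_Schwarz_L2[OF f g] by (simp add: power2_sum)
  finally show "(L2_norm \<Omega> (\<lambda>x. f x + g x))\<^sup>2 \<le> (L2_norm \<Omega> f + L2_norm \<Omega> g)\<^sup>2" .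
qed (simp add: L2_norm_nonneg)

lemma L2_norm_cong_AE:
  assumes "AE x in M. f x = g x" "square_integrable \<Omega> f" "square_integrable \<Omega> g"
  shows "L2_norm \<Omega> f = L2_norm \<Omega> g"
proof -
  have "(\<integral>x. (norm (f x))\<^sup>2 \<partial>M) = (\<integral>x. (norm (g x))\<^sup>2 \<partial>M)"
    by (rule integral_cong_AE) (use assms in \<open>auto simp: square_integrable_iff\<close>)
  then show ?thesis by (simp add: L2_norm_def set_integral_eq)
qed

lemma L2_norm_scaleR: "L2_norm \<Omega> (\<lambda>x. c *\<^sub>R f x) = \<bar>c\<bar> * L2_norm \<Omega> f"
  by (simp add: L2_norm_def set_integral_eq power_mult_distrib real_sqrt_mult)

section \<open>The fundamental lemma of the calculus of variations\<close>

lemma set_integral_box_zero: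
  fixes k :: "'a \<Rightarrow> real"
  assumes k: "integrable M k" and z: "\<And>\<eta>. \<eta> \<in> test_functions \<Omega> \<Longrightarrow> (\<integral>x. k x * \<eta> x \<partial>M) = 0"
    and box: "cbox a b \<subseteq> \<Omega>"
  shows "(\<integral>x. k x * indicator (box a b) x \<partial>M) = 0"
proof -
  have [measurable]: "k \<in> borel_measurable M" using k by simp
  have bm[measurable]: "box_bump n a b \<in> borel_measurable M" for n
  proof (rule borel_measurable_M)
    have "smooth_on UNIV (box_bump n a b)"
      using box_bump_test_function[OF box] by (simp add: test_functions_def)
    then have "Ck_on 0 UNIV (box_bump n a b)" unfolding smooth_on_def by blast
    then show "box_bump n a b \<in> borel_measurable borel" by (simp add: borel_measurable_continuous_onI)
  qed
  have [measurable]: "box a b \<in> sets M" using box box_subset_cbox[of a b] by (auto simp: sets_restrict_space_iff)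
  have "(\<lambda>n. \<integral>x. k x * box_bump n a b x \<partial>M) \<longlonglongrightarrow> (\<integral>x. k x * indicator (box a b) x \<partial>M)"
  proof (rule integral_dominated_convergence[where w="\<lambda>x. \<bar>k x\<bar>"])
    show "AE x in M. (\<lambda>n. k x * box_bump n a b x) \<longlonglongrightarrow> k x * indicator (box a b) x"
      by (intro AE_I2 tendsto_intros box_bump_tendsto_indicator)
    show "AE x in M. norm (k x * box_bump n a b x) \<le> \<bar>k x\<bar>" for n
      using box_bump_bounds[of n a b] by (auto simp: abs_mult intro!: AE_I2 mult_left_le)
    show "(\<lambda>x. k x * indicator (box a b) x) \<in> borel_measurable M" by measurable
  qed (use k in auto)
  then show ?thesis
    using z[OF box_bump_test_function[OF box]] by (simp add: LIMSEQ_const_iff)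
qed

text \<open>Inside a fixed box the integrals over all sub-boxes vanish, because bumps approximate
  their indicators. A Dynkin argument extends this to all Borel subsets, and countably many such
  boxes cover \<Omega>.\<close>

lemma AE_zero_if_orthogonal_to_test_functions:
  fixes k :: "'a \<Rightarrow> real"
  assumes k: "integrable M k" and z: "\<And>\<eta>. \<eta> \<in> test_functions \<Omega> \<Longrightarrow> (\<integral>x. k x * \<eta> x \<partial>M) = 0"
  shows "AE x in M. k x = 0"
proof -
  have on_box: "AE x in M. x \<in> box a b \<longrightarrow> k x = 0" if box: "cbox a b \<subseteq> \<Omega>" for a b
  proof -
    \<comment> \<open>Localising to one box makes the total integral zero, as the complement step of
      the induction requires. For \<open>k\<close> on all of \<Omega> this is not yet known.\<close>
    define kB where "kB x = k x * indicator (box a b) x" for x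
    have bs: "box a b \<in> sets M" using box box_subset_cbox[of a b] by (auto simp: sets_restrict_space_iff)
    have kB: "integrable M kB"
      unfolding kB_def[abs_def] using integrable_mult_indicator[OF bs k] by (simp add: mult.commute)
    have total: "(\<integral>x. kB x \<partial>M) = 0"
      unfolding kB_def using set_integral_box_zero[OF k z box] .
    have si: "set_integrable M (A \<inter> \<Omega>) kB" if "A \<in> sets borel" for A
      unfolding set_integrable_def using that kB
      by (intro integrable_mult_indicator) (auto simp: sets_restrict_space_iff)
    have int0: "(LINT x:A \<inter> \<Omega>|M. kB x) = 0" if "A \<in> sigma_sets UNIV (range (\<lambda>(a, b). box a b))" for A
    proof (induction rule: sigma_sets_induct_disjoint[OF _ _ that])
      case 1
      show ?case by (auto simp: Int_stable_def box_Int_box)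
    next
      case 2
      show ?case by simp
    next
      case (3 A)
      then obtain c d where A: "A = box c d" by auto
      obtain l u where lu: "box a b \<inter> box c d = box l u" "cbox a b \<inter> cbox c d = cbox l u"
        using box_Int_box[of a b c d] Int_interval[of a b c d] by blast
      have "(\<integral>x. k x * indicator (box l u) x \<partial>M) = 0"
        using box lu by (intro set_integral_box_zero[OF k z]) auto
      moreover have "(LINT x:A \<inter> \<Omega>|M. kB x) = (\<integral>x. k x * indicator (box l u) x \<partial>M)"
        unfolding set_lebesgue_integral_def kB_def A lu(1)[symmetric]
        by (intro Bochner_Integration.integral_cong refl) (auto split: split_indicator)
      ultimately show ?case by simp
    next
      case 4
      show ?case by (simp add: set_lebesgue_integral_def)
    next
      case (5 A)
      then have A: "A \<in> sets borel" by (simp add: borel_eq_box)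
      have "(\<integral>x. kB x \<partial>M) = (LINT x:(A \<inter> \<Omega>) \<union> (UNIV - A) \<inter> \<Omega>|M. kB x)"
        unfolding set_lebesgue_integral_def
        by (intro Bochner_Integration.integral_cong refl) (auto split: split_indicator)
      also have "\<dots> = (LINT x:A \<inter> \<Omega>|M. kB x) + (LINT x:(UNIV - A) \<inter> \<Omega>|M. kB x)"
        using A by (intro set_integral_Un si) auto
      finally show ?case using 5 total by simp
    next
      case (6 A)
      then have A: "A i \<in> sets borel" for i by (auto simp: borel_eq_box)
      have eq: "(\<Union> (range A)) \<inter> \<Omega> = (\<Union>i. A i \<inter> \<Omega>)" by auto
      have "(LINT x:(\<Union> (range A)) \<inter> \<Omega>|M. kB x) = (\<Sum>i. LINT x:A i \<inter> \<Omega>|M. kB x)"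
        unfolding eq
      proof (rule lebesgue_integral_countable_add)
        show "A i \<inter> \<Omega> \<in> sets M" for i using A by (auto simp: sets_restrict_space_iff)
        show "(A i \<inter> \<Omega>) \<inter> (A j \<inter> \<Omega>) = {}" if "i \<noteq> j" for i j
          using 6(1) that by (auto simp: disjoint_family_on_def)
        show "set_integrable M (\<Union>i. A i \<inter> \<Omega>) kB"
          unfolding eq[symmetric] using A by (intro si) auto
      qed
      then show ?case using 6 by simp
    qed
    have "AE x in M. kB x = 0"
    proof (rule density_zero[OF kB])
      fix A assume "A \<in> sets M"
      then have A: "A \<subseteq> \<Omega>" "A \<in> sets borel" by (auto simp: sets_restrict_space_iff)
      then have "A \<inter> \<Omega> = A" by auto
      then show "(LINT x:A|M. kB x) = 0" using int0[of A] A by (simp add: borel_eq_box)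
    qed
    then show ?thesis by (auto simp: kB_def)
  qed
  define \<B> where "\<B> = {box a b | a b. cbox a b \<subseteq> \<Omega>}"
  \<comment> \<open>A countable subcover keeps the union of the exceptional sets null.\<close>
  obtain \<D> where D: "\<D> \<subseteq> \<B>" "countable \<D>" "\<Union>\<D> = \<Union>\<B>"
    using Lindelof[of \<B>] by (auto simp: \<B>_def)
  have "\<Omega> \<subseteq> \<Union>\<B>"
  proof
    fix x assume "x \<in> \<Omega>"
    then obtain e where e: "e > 0" "cball x e \<subseteq> \<Omega>" using open_domain open_contains_cball by blast
    obtain a b where ab: "cbox a b \<subseteq> cball x e" "x \<in> box a b"
    proof -
      obtain a b where ab: "x \<in> box a b" "box a b \<subseteq> ball x e" using rational_boxes[OF e(1)] by metis
      then have "cbox a b = closure (box a b)" by (metis closure_box empty_iff)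
      also have "\<dots> \<subseteq> cball x e" using ab(2) e(1) closure_mono closure_ball by blast
      finally show thesis using ab that by blast
    qed
    then have "box a b \<in> \<B>" using e(2) unfolding \<B>_def by blast
    then show "x \<in> \<Union>\<B>" using ab(2) by blast
  qed
  have "AE x in M. \<forall>B\<in>\<D>. x \<in> B \<longrightarrow> k x = 0"
    using D(1,2) on_box by (subst AE_ball_countable) (auto simp: \<B>_def)
  moreover have "AE x in M. x \<in> \<Omega>" using AE_space[of M] by simp
  ultimately show ?thesis
    by eventually_elim (use \<open>\<Omega> \<subseteq> \<Union>\<B>\<close> D(3) in blast)
qed

end

section \<open>Integration by parts for smooth functions\<close>

lemma linear_eq_sum_Basis:
  fixes f :: "'a::euclidean_space \<Rightarrow> real"
  assumes "linear f" shows "f h = (\<Sum>j\<in>Basis. (h \<bullet> j) * f j)"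
proof -
  have "f h = f (\<Sum>j\<in>Basis. (h \<bullet> j) *\<^sub>R j)" by (simp add: euclidean_representation)
  also have "\<dots> = (\<Sum>j\<in>Basis. (h \<bullet> j) * f j)"
    by (simp only: linear_sum[OF assms] linear_scale[OF assms] real_scaleR_def)
  finally show ?thesis .
qed

definition gradient :: "('a::euclidean_space \<Rightarrow> real) \<Rightarrow> 'a \<Rightarrow> 'a" where
  "gradient u x = (\<Sum>i\<in>Basis. frechet_derivative u (at x) i *\<^sub>R i)"

lemma gradient_inner_Basis: "i \<in> Basis \<Longrightarrow> gradient u x \<bullet> i = frechet_derivative u (at x) i"
  by (simp add: gradient_def inner_sum_left inner_Basis if_distrib cong: if_cong)

lemma smooth_gradient:
  assumes "smooth_on UNIV u"
  shows "(u has_derivative (\<lambda>h. gradient u x \<bullet> h)) (at x)" "continuous_on UNIV (gradient u)"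
proof -
  have C1: "Ck_on 1 UNIV u" using assms by (simp add: smooth_on_def del: Ck_on.simps)
  have d: "(u has_derivative frechet_derivative u (at x)) (at x)"
    using C1 by (auto intro: differentiable_on_UNIV_D)
  have lin: "linear (frechet_derivative u (at x))"
    using d by (simp add: has_derivative_linear)
  have "frechet_derivative u (at x) h = gradient u x \<bullet> h" for h
  proof -
    have "frechet_derivative u (at x) h = (\<Sum>j\<in>Basis. (h \<bullet> j) * frechet_derivative u (at x) j)"
      by (rule linear_eq_sum_Basis[OF lin])
    then show ?thesis by (simp only: gradient_def inner_sum_left inner_scaleR_left inner_commute[of h] mult.commute)
  qed
  then show "(u has_derivative (\<lambda>h. gradient u x \<bullet> h)) (at x)"
    using d by presburger
  show "continuous_on UNIV (gradient u)"
    unfolding gradient_def[abs_def] using C1 by (auto intro!: continuous_intros)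
qed

lemma test_functions_C1:
  assumes "\<eta> \<in> test_functions \<Omega>"
  shows "(\<eta> has_derivative frechet_derivative \<eta> (at x)) (at x)"
    "continuous_on UNIV (\<lambda>x. frechet_derivative \<eta> (at x) i)"
proof -
  have s: "smooth_on UNIV \<eta>" using assms by (simp add: test_functions_def)
  note d = smooth_gradient(1)[OF s]
  show "(\<eta> has_derivative frechet_derivative \<eta> (at x)) (at x)"
    unfolding frechet_derivative_eqI[OF d] by (rule d)
  show "continuous_on UNIV (\<lambda>x. frechet_derivative \<eta> (at x) i)"
    unfolding frechet_derivative_eqI[OF d] by (intro continuous_intros smooth_gradient(2)[OF s])
qed

text \<open>Allows integrals over \<Omega> to be taken over the whole space or over a larger cell.
  The gradient vanishes because the complement of the support is open, so \<eta> is zero near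
  \<open>x\<close>.\<close>

lemma test_function_outside:
  assumes "\<eta> \<in> test_functions \<Omega>" "x \<notin> \<Omega>"
  shows "\<eta> x = 0" "gradient \<eta> x = 0"
proof -
  have supp: "{x. \<eta> x \<noteq> 0} \<subseteq> closure {x. \<eta> x \<noteq> 0}" "closure {x. \<eta> x \<noteq> 0} \<subseteq> \<Omega>"
    using assms by (auto simp: test_functions_def closure_subset)
  show "\<eta> x = 0" using assms supp by blast
  have "((\<lambda>_. 0) has_derivative (\<lambda>_. 0)) (at x)" by simp
  then have "(\<eta> has_derivative (\<lambda>_. 0)) (at x)"
  proof (rule has_derivative_transform_within_open)
    show "open (- closure {x. \<eta> x \<noteq> 0})" "x \<in> - closure {x. \<eta> x \<noteq> 0}"
      using assms supp by auto
    show "0 = \<eta> y" if "y \<in> - closure {x. \<eta> x \<noteq> 0}" for y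
      using that supp(1) by auto
  qed
  then show "gradient \<eta> x = 0" by (simp add: gradient_def frechet_derivative_eqI)
qed

text \<open>By translation invariance each difference quotient in direction \<open>i\<close> has
  integral zero. The mean value theorem supplies a dominating function, so the limit inherits the
  zero.\<close>

lemma integral_directional_derivative_zero:
  fixes p :: "'a::euclidean_space \<Rightarrow> real"
  assumes der: "\<And>x. (p has_derivative p' x) (at x)" and cont: "continuous_on UNIV (\<lambda>x. p' x i)"
    and supp: "bounded {x. p x \<noteq> 0}"
  shows "(\<integral>x. p' x i \<partial>lborel) = 0"
proof -
  obtain R where R: "R > 0" "{x. p x \<noteq> 0} \<subseteq> ball 0 R"
    using supp bounded_subset_ballD by blast
  \<comment> \<open>The increments have length at most \<open>norm i\<close>, so the quotients
    vanish off the ball of radius \<open>S\<close>. From inside that ball the intermediate points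
    stay within \<open>R + 2 * norm i\<close>.\<close>
  define S where "S = R + norm i"
  have cp: "continuous_on UNIV p"
    by (rule has_derivative_continuous_on) (rule der)
  have "bounded ((\<lambda>x. p' x i) ` cball 0 (R + 2 * norm i))"
    by (intro compact_imp_bounded compact_continuous_image continuous_on_subset[OF cont]) auto
  then obtain B where B: "\<And>x. x \<in> cball 0 (R + 2 * norm i) \<Longrightarrow> \<bar>p' x i\<bar> \<le> B"
    unfolding bounded_iff by (metis imageI real_norm_def)
  have line: "((\<lambda>t. p (x + t *\<^sub>R i)) has_real_derivative p' (x + t *\<^sub>R i) i) (at t)" for x t
  proof -
    have "((\<lambda>t. x + t *\<^sub>R i) has_derivative (\<lambda>h. h *\<^sub>R i)) (at t)"
      by (auto intro!: derivative_eq_intros)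
    from has_derivative_compose[OF this der]
    have "((\<lambda>t. p (x + t *\<^sub>R i)) has_derivative (\<lambda>h. p' (x + t *\<^sub>R i) (h *\<^sub>R i))) (at t)" .
    moreover have "linear (p' (x + t *\<^sub>R i))" using der by (rule has_derivative_linear)
    ultimately show ?thesis
      by (simp add: has_field_derivative_def linear_scale mult_commute_abs)
  qed
  let ?q = "\<lambda>n x. (p (x + inverse (real (Suc n)) *\<^sub>R i) - p x) / inverse (real (Suc n))"
  have t1: "0 < inverse (real (Suc n))" "inverse (real (Suc n)) \<le> 1" for n
    by (simp_all add: field_simps)
  have zero: "?q n x = 0" if "x \<notin> cball 0 S" for x n
  proof -
    have "norm x - norm (inverse (real (Suc n)) *\<^sub>R i) \<le> norm (x + inverse (real (Suc n)) *\<^sub>R i)"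
      by (metis norm_diff_ineq)
    moreover have "norm (inverse (real (Suc n)) *\<^sub>R i) \<le> norm i"
      using t1[of n] mult_right_mono[of "inverse (real (Suc n))" 1 "norm i"] by (simp del: of_nat_Suc)
    moreover have "norm x > R + norm i" using that by (simp add: S_def)
    moreover have "norm x > R" using calculation(3) norm_ge_zero[of i] by linarith
    ultimately have "x \<notin> ball 0 R" "x + inverse (real (Suc n)) *\<^sub>R i \<notin> ball 0 R" by (auto simp del: of_nat_Suc)
    then have "p x = 0" "p (x + inverse (real (Suc n)) *\<^sub>R i) = 0" using R by blast+
    then show ?thesis by simp
  qed
  have bound: "\<bar>?q n x\<bar> \<le> B * indicator (cball 0 S) x" for n x
  proof (cases "x \<in> cball 0 S")
    case True
    obtain t where t: "0 < t" "t < inverse (real (Suc n))"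
      "p (x + inverse (real (Suc n)) *\<^sub>R i) - p (x + 0 *\<^sub>R i) = (inverse (real (Suc n)) - 0) * p' (x + t *\<^sub>R i) i"
      using MVT2[OF t1(1)[of n], of "\<lambda>t. p (x + t *\<^sub>R i)" "\<lambda>t. p' (x + t *\<^sub>R i) i"] line by blast
    then have "?q n x = p' (x + t *\<^sub>R i) i" using t1(1)[of n] by (simp add: field_simps del: of_nat_Suc)
    moreover have "x + t *\<^sub>R i \<in> cball 0 (R + 2 * norm i)"
    proof -
      have "norm (x + t *\<^sub>R i) \<le> norm x + t * norm i"
        using norm_triangle_ineq[of x "t *\<^sub>R i"] t(1) by simp
      also have "\<dots> \<le> S + 1 * norm i"
        using True t t1(2)[of n] by (intro add_mono mult_right_mono) auto
      finally show ?thesis by (simp add: S_def)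
    qed
    ultimately show ?thesis using B True by simp
  next
    case False
    then show ?thesis using zero[OF False, of n] by simp
  qed
  have [measurable]: "p \<in> borel_measurable borel" "(\<lambda>x. p' x i) \<in> borel_measurable borel"
    using cp cont by (auto intro: borel_measurable_continuous_onI)
  have pint: "integrable lborel p"
  proof -
    have "bounded (p ` cball 0 R)"
      by (intro compact_imp_bounded compact_continuous_image continuous_on_subset[OF cp]) auto
    then obtain C where C: "\<And>x. x \<in> cball 0 R \<Longrightarrow> \<bar>p x\<bar> \<le> C" unfolding bounded_iff by (metis imageI real_norm_def)
    show ?thesis
    proof (rule Bochner_Integration.integrable_bound[where f="\<lambda>x. C * indicator (cball 0 R) x"])
      show "integrable lborel (\<lambda>x. C * indicator (cball (0::'a) R) x)"
        by (intro integrable_mult_right integrable_real_indicator emeasure_bounded_finite) auto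
      show "AE x in lborel. norm (p x) \<le> norm (C * indicator (cball 0 R) x)"
      proof (intro AE_I2)
        fix x
        show "norm (p x) \<le> norm (C * indicator (cball 0 R) x)"
        proof (cases "x \<in> cball 0 R")
          case True
          then show ?thesis using C[OF True] by simp
        next
          case False
          then have "p x = 0" using R by (auto simp: subset_iff)
          then show ?thesis by simp
        qed
      qed
    qed simp
  qed
  have shift: "(\<integral>x. p (x + w) \<partial>lborel) = (\<integral>x. p x \<partial>lborel)" "integrable lborel (\<lambda>x. p (x + w))" for w
  proof -
    have d: "distr lborel borel ((+) w) = (lborel :: 'a measure)" by (rule lborel_distr_plus)
    show "(\<integral>x. p (x + w) \<partial>lborel) = (\<integral>x. p x \<partial>lborel)"
      by (subst (2) d[symmetric], subst integral_distr) (auto simp: add.commute)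
    have "integrable (distr lborel borel ((+) w)) p" using pint d by simp
    then show "integrable lborel (\<lambda>x. p (x + w))"
      by (subst (asm) integrable_distr_eq) (auto simp: add.commute)
  qed
  have "(\<lambda>n. \<integral>x. ?q n x \<partial>lborel) \<longlonglongrightarrow> (\<integral>x. p' x i \<partial>lborel)"
  proof (rule integral_dominated_convergence[where w="\<lambda>x. B * indicator (cball 0 S) x"])
    show "integrable lborel (\<lambda>x. B * indicator (cball (0::'a) S) x)"
      by (intro integrable_mult_right integrable_real_indicator emeasure_bounded_finite) auto
    show "AE x in lborel. (\<lambda>n. ?q n x) \<longlonglongrightarrow> p' x i"
    proof (intro AE_I2)
      fix x
      have "((\<lambda>h. (p (x + h *\<^sub>R i) - p x) / h) \<longlongrightarrow> p' x i) (at 0)"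
        using line[of x 0] by (simp add: DERIV_def)
      moreover have "filterlim (\<lambda>n. inverse (real (Suc n))) (at 0) sequentially"
        by (simp add: filterlim_at LIMSEQ_inverse_real_of_nat del: of_nat_Suc)
      ultimately show "(\<lambda>n. ?q n x) \<longlonglongrightarrow> p' x i"
        by (rule filterlim_compose)
    qed
    show "AE x in lborel. norm (?q n x) \<le> B * indicator (cball 0 S) x" for n
      using bound by simp
  qed measurable
  moreover have "(\<integral>x. ?q n x \<partial>lborel) = 0" for n
    by (simp add: shift pint del: of_nat_Suc)
  ultimately show ?thesis by (simp add: LIMSEQ_const_iff)
qed

section \<open>Uniqueness and linearity of weak gradients, and the H1 norm\<close>

context bounded_domain
begin

lemma continuous_square_integrable:
  fixes f :: "'a \<Rightarrow> 'b::euclidean_space"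
  assumes "continuous_on UNIV f" shows "square_integrable \<Omega> f"
proof -
  have "bounded (f ` closure \<Omega>)"
    using bounded_domain assms
    by (intro compact_imp_bounded compact_continuous_image continuous_on_subset[OF assms]) auto
  then obtain B where "\<And>x. x \<in> \<Omega> \<Longrightarrow> norm (f x) \<le> B"
    unfolding bounded_iff using closure_subset by fastforce
  then show ?thesis
    using assms by (intro square_integrable_bounded borel_measurable_M borel_measurable_continuous_onI)
qed

lemma test_function_square_integrable:
  assumes "\<eta> \<in> test_functions \<Omega>"
  shows "square_integrable \<Omega> \<eta>" "square_integrable \<Omega> (\<lambda>x. frechet_derivative \<eta> (at x) i)"
proof -
  have "continuous_on UNIV \<eta>"
    by (rule has_derivative_continuous_on) (rule test_functions_C1(1)[OF assms])
  then show "square_integrable \<Omega> \<eta>" by (rule continuous_square_integrable)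
  show "square_integrable \<Omega> (\<lambda>x. frechet_derivative \<eta> (at x) i)"
    by (intro continuous_square_integrable test_functions_C1(2)[OF assms])
qed

text \<open>Makes the choice in \<open>wgrad\<close> harmless. Each component of the difference of
  two candidates is orthogonal to all test functions.\<close>

lemma weak_gradient_unique:
  assumes g: "square_integrable \<Omega> g" "has_weak_gradient \<Omega> u g"
    and h: "square_integrable \<Omega> h" "has_weak_gradient \<Omega> u h"
  shows "AE x in M. g x = h x"
proof -
  have "AE x in M. (g x - h x) \<bullet> i = 0" if i: "i \<in> Basis" for i
  proof (rule AE_zero_if_orthogonal_to_test_functions)
    have gi: "square_integrable \<Omega> (\<lambda>x. g x \<bullet> i)" and hi: "square_integrable \<Omega> (\<lambda>x. h x \<bullet> i)"
      using g h by (auto intro: square_integrable_inner)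
    have "square_integrable \<Omega> (\<lambda>_. 1 :: real)"
      by (intro continuous_square_integrable) simp
    from mult_integrable[OF square_integrable_diff[OF gi hi] this]
    show "integrable M (\<lambda>x. (g x - h x) \<bullet> i)" by (simp add: inner_diff_left)
    fix \<eta> assume \<eta>: "\<eta> \<in> test_functions \<Omega>"
    have "(\<integral>x. (g x - h x) \<bullet> i * \<eta> x \<partial>M) = (\<integral>x. g x \<bullet> i * \<eta> x \<partial>M) - (\<integral>x. h x \<bullet> i * \<eta> x \<partial>M)"
      using mult_integrable[OF gi test_function_square_integrable(1)[OF \<eta>]]
        mult_integrable[OF hi test_function_square_integrable(1)[OF \<eta>]]
      by (simp add: inner_diff_left left_diff_distrib)
    also have "\<dots> = 0"
      using g(2) h(2) \<eta> i unfolding has_weak_gradient_def set_integral_eq by fastforce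
    finally show "(\<integral>x. (g x - h x) \<bullet> i * \<eta> x \<partial>M) = 0" .
  qed
  then have "AE x in M. \<forall>i\<in>Basis. (g x - h x) \<bullet> i = 0"
    by (subst AE_ball_countable) (auto simp: countable_finite)
  then show ?thesis
    by eventually_elim (metis euclidean_eqI inner_zero_left right_minus_eq)
qed

lemma weak_gradient_linear_combination:
  assumes u: "square_integrable \<Omega> u" "square_integrable \<Omega> g" "has_weak_gradient \<Omega> u g"
    and v: "square_integrable \<Omega> v" "square_integrable \<Omega> h" "has_weak_gradient \<Omega> v h"
  shows "has_weak_gradient \<Omega> (\<lambda>x. a * u x + c * v x) (\<lambda>x. a *\<^sub>R g x + c *\<^sub>R h x)"
  unfolding has_weak_gradient_def set_integral_eq
proof (intro ballI)
  fix \<eta> and i :: 'a assume \<eta>: "\<eta> \<in> test_functions \<Omega>" and i: "i \<in> Basis"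
  note sq = test_function_square_integrable[OF \<eta>]
  have gi: "square_integrable \<Omega> (\<lambda>x. g x \<bullet> i)" and hi: "square_integrable \<Omega> (\<lambda>x. h x \<bullet> i)"
    using u v by (auto intro: square_integrable_inner)
  have "(\<integral>x. (a * u x + c * v x) * frechet_derivative \<eta> (at x) i \<partial>M)
      = (\<integral>x. a * (u x * frechet_derivative \<eta> (at x) i) + c * (v x * frechet_derivative \<eta> (at x) i) \<partial>M)"
    by (simp add: algebra_simps)
  also have "\<dots> = a * (\<integral>x. u x * frechet_derivative \<eta> (at x) i \<partial>M) + c * (\<integral>x. v x * frechet_derivative \<eta> (at x) i \<partial>M)"
    using mult_integrable[OF u(1) sq(2)] mult_integrable[OF v(1) sq(2)] by simp
  also have "\<dots> = - (a * (\<integral>x. g x \<bullet> i * \<eta> x \<partial>M) + c * (\<integral>x. h x \<bullet> i * \<eta> x \<partial>M))"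
    using u(3) v(3) \<eta> i unfolding has_weak_gradient_def set_integral_eq by simp
  also have "a * (\<integral>x. g x \<bullet> i * \<eta> x \<partial>M) + c * (\<integral>x. h x \<bullet> i * \<eta> x \<partial>M)
      = (\<integral>x. a * (g x \<bullet> i * \<eta> x) + c * (h x \<bullet> i * \<eta> x) \<partial>M)"
    using mult_integrable[OF gi sq(1)] mult_integrable[OF hi sq(1)] by simp
  also have "\<dots> = (\<integral>x. (a *\<^sub>R g x + c *\<^sub>R h x) \<bullet> i * \<eta> x \<partial>M)"
    by (simp add: inner_add_left algebra_simps)
  finally show "(\<integral>x. (a * u x + c * v x) * frechet_derivative \<eta> (at x) i \<partial>M) = - (\<integral>x. (a *\<^sub>R g x + c *\<^sub>R h x) \<bullet> i * \<eta> x \<partial>M)" .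
qed

text \<open>The two integrands add up to a partial derivative of \<open>u * \<eta>\<close>, a
  function with bounded support; its integral is zero.\<close>

lemma smooth_weak_gradient:
  assumes "smooth_on UNIV u"
  shows "has_weak_gradient \<Omega> u (gradient u)"
  unfolding has_weak_gradient_def set_integral_eq
proof (intro ballI)
  fix \<eta> and i :: 'a assume \<eta>: "\<eta> \<in> test_functions \<Omega>" and i: "i \<in> Basis"
  note sq = test_function_square_integrable[OF \<eta>]
  note du = smooth_gradient[OF assms]
  have cu: "continuous_on UNIV u"
    by (rule has_derivative_continuous_on) (rule du(1))
  have c\<eta>: "continuous_on UNIV \<eta>"
    by (rule has_derivative_continuous_on) (rule test_functions_C1(1)[OF \<eta>])
  let ?p' = "\<lambda>x h. u x * frechet_derivative \<eta> (at x) h + (gradient u x \<bullet> h) * \<eta> x"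
  have supp: "{x. \<eta> x \<noteq> 0} \<subseteq> closure {x. \<eta> x \<noteq> 0}" "closure {x. \<eta> x \<noteq> 0} \<subseteq> \<Omega>" "compact (closure {x. \<eta> x \<noteq> 0})"
    using \<eta> by (auto simp: test_functions_def closure_subset)
  have out: "\<eta> x = 0" "frechet_derivative \<eta> (at x) i = 0" if "x \<notin> \<Omega>" for x
    using test_function_outside[OF \<eta> that] gradient_inner_Basis[OF i, of \<eta> x] by simp_all
  have "(\<integral>x. ?p' x i \<partial>lborel) = 0"
  proof (rule integral_directional_derivative_zero)
    show "((\<lambda>x. u x * \<eta> x) has_derivative ?p' x) (at x)" for x
      by (rule has_derivative_mult[OF du(1) test_functions_C1(1)[OF \<eta>]])
    show "continuous_on UNIV (\<lambda>x. ?p' x i)"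
      by (intro continuous_intros cu c\<eta> du(2) test_functions_C1(2)[OF \<eta>])
    show "bounded {x. u x * \<eta> x \<noteq> 0}"
      by (rule bounded_subset[OF compact_imp_bounded[OF supp(3)]]) (use supp(1) in auto)
  qed
  also have "(\<integral>x. ?p' x i \<partial>lborel) = (\<integral>x. indicator \<Omega> x *\<^sub>R ?p' x i \<partial>lborel)"
    by (intro Bochner_Integration.integral_cong refl) (auto simp: out split: split_indicator)
  also have "\<dots> = (\<integral>x. ?p' x i \<partial>M)"
    by (simp add: integral_restrict_space)
  also have "\<dots> = (\<integral>x. u x * frechet_derivative \<eta> (at x) i \<partial>M) + (\<integral>x. (gradient u x \<bullet> i) * \<eta> x \<partial>M)"
    by (intro Bochner_Integration.integral_add mult_integrable sq square_integrable_inner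
        continuous_square_integrable cu du(2))
  finally show "(\<integral>x. u x * frechet_derivative \<eta> (at x) i \<partial>M) = - (\<integral>x. gradient u x \<bullet> i * \<eta> x \<partial>M)"
    by simp
qed

lemma H1_wgrad:
  assumes "u \<in> H1 \<Omega>"
  shows "square_integrable \<Omega> u" "square_integrable \<Omega> (wgrad \<Omega> u)" "has_weak_gradient \<Omega> u (wgrad \<Omega> u)"
proof -
  have "\<exists>g. square_integrable \<Omega> g \<and> has_weak_gradient \<Omega> u g" and *: "square_integrable \<Omega> u"
    using assms by (auto simp: H1_def)
  from someI_ex[OF this(1)] show "square_integrable \<Omega> (wgrad \<Omega> u)" "has_weak_gradient \<Omega> u (wgrad \<Omega> u)"
    by (auto simp: wgrad_def)
  show "square_integrable \<Omega> u" by (fact *)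
qed

lemma wgrad_eq_AE:
  assumes "square_integrable \<Omega> u" "square_integrable \<Omega> g" "has_weak_gradient \<Omega> u g"
  shows "u \<in> H1 \<Omega>" "AE x in M. wgrad \<Omega> u x = g x"
proof -
  show "u \<in> H1 \<Omega>" using assms by (auto simp: H1_def)
  then show "AE x in M. wgrad \<Omega> u x = g x"
    using assms H1_wgrad by (intro weak_gradient_unique) auto
qed

lemma square_integrable_linear_combination:
  assumes "square_integrable \<Omega> f" "square_integrable \<Omega> g"
  shows "square_integrable \<Omega> (\<lambda>x. a *\<^sub>R f x + c *\<^sub>R g x)"
  by (intro square_integrable_add square_integrable_scaleR assms)

text \<open>Linearity of \<open>wgrad\<close> can hold only almost everywhere, since a
  representative is chosen separately for each function. It is uniqueness applied to the evident
  candidate.\<close>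

lemma H1_linear_combination:
  assumes u: "u \<in> H1 \<Omega>" and v: "v \<in> H1 \<Omega>"
  shows "(\<lambda>x. a * u x + c * v x) \<in> H1 \<Omega>"
    "AE x in M. wgrad \<Omega> (\<lambda>x. a * u x + c * v x) x = a *\<^sub>R wgrad \<Omega> u x + c *\<^sub>R wgrad \<Omega> v x"
proof -
  have sq: "square_integrable \<Omega> (\<lambda>x. a * u x + c * v x)"
    using square_integrable_linear_combination[OF H1_wgrad(1)[OF u] H1_wgrad(1)[OF v]] by simp
  note W = wgrad_eq_AE[OF sq square_integrable_linear_combination[OF H1_wgrad(2)[OF u] H1_wgrad(2)[OF v]]
      weak_gradient_linear_combination[OF H1_wgrad[OF u] H1_wgrad[OF v]]]
  show "(\<lambda>x. a * u x + c * v x) \<in> H1 \<Omega>" by (rule W(1))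
  show "AE x in M. wgrad \<Omega> (\<lambda>x. a * u x + c * v x) x = a *\<^sub>R wgrad \<Omega> u x + c *\<^sub>R wgrad \<Omega> v x" by (rule W(2))
qed

lemma H1_diff:
  assumes u: "u \<in> H1 \<Omega>" and v: "v \<in> H1 \<Omega>"
  shows "(\<lambda>x. u x - v x) \<in> H1 \<Omega>" "AE x in M. wgrad \<Omega> (\<lambda>x. u x - v x) x = wgrad \<Omega> u x - wgrad \<Omega> v x"
  using H1_linear_combination[OF u v, of 1 "-1"] by simp_all

lemma smooth_H1:
  assumes "smooth_on UNIV u"
  shows "u \<in> H1 \<Omega>" "AE x in M. wgrad \<Omega> u x = gradient u x"
proof -
  note du = smooth_gradient[OF assms]
  have cu: "continuous_on UNIV u"
    by (rule has_derivative_continuous_on) (rule du(1))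
  show "u \<in> H1 \<Omega>" "AE x in M. wgrad \<Omega> u x = gradient u x"
    by (rule wgrad_eq_AE[OF continuous_square_integrable[OF cu] continuous_square_integrable[OF du(2)] smooth_weak_gradient[OF assms]])+
qed

lemma H1_seminorm_nonneg: "0 \<le> H1_seminorm \<Omega> u"
  by (simp add: H1_seminorm_def L2_norm_nonneg)

lemma H1_norm_nonneg: "0 \<le> H1_norm \<Omega> u"
  by (simp add: H1_norm_def)

lemma H1_norm_sq: "(H1_norm \<Omega> u)\<^sup>2 = (L2_norm \<Omega> u)\<^sup>2 + (H1_seminorm \<Omega> u)\<^sup>2"
  by (simp add: H1_norm_def)

lemma L2_norm_le_H1_norm: "L2_norm \<Omega> u \<le> H1_norm \<Omega> u"
  by (rule power2_le_imp_le) (simp_all add: H1_norm_sq H1_norm_nonneg)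

lemma H1_norm_linear_combination:
  assumes u: "u \<in> H1 \<Omega>" and v: "v \<in> H1 \<Omega>"
  shows "H1_norm \<Omega> (\<lambda>x. a * u x + c * v x) \<le> \<bar>a\<bar> * H1_norm \<Omega> u + \<bar>c\<bar> * H1_norm \<Omega> v"
proof -
  note U = H1_wgrad[OF u] and V = H1_wgrad[OF v] and UV = H1_linear_combination[OF u v, of a c]
  have 1: "L2_norm \<Omega> (\<lambda>x. a * u x + c * v x) \<le> \<bar>a\<bar> * L2_norm \<Omega> u + \<bar>c\<bar> * L2_norm \<Omega> v"
    using L2_norm_triangle[OF square_integrable_scaleR[OF U(1), of a] square_integrable_scaleR[OF V(1), of c]]
    unfolding L2_norm_scaleR by simp
  have "H1_seminorm \<Omega> (\<lambda>x. a * u x + c * v x) = L2_norm \<Omega> (\<lambda>x. a *\<^sub>R wgrad \<Omega> u x + c *\<^sub>R wgrad \<Omega> v x)"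
    unfolding H1_seminorm_def
    by (intro L2_norm_cong_AE UV H1_wgrad square_integrable_linear_combination U V)
  also have "\<dots> \<le> \<bar>a\<bar> * H1_seminorm \<Omega> u + \<bar>c\<bar> * H1_seminorm \<Omega> v"
    using L2_norm_triangle[OF square_integrable_scaleR[OF U(2), of a] square_integrable_scaleR[OF V(2), of c]]
    unfolding L2_norm_scaleR H1_seminorm_def .
  finally have 2: "H1_seminorm \<Omega> (\<lambda>x. a * u x + c * v x) \<le> \<bar>a\<bar> * H1_seminorm \<Omega> u + \<bar>c\<bar> * H1_seminorm \<Omega> v" .
  have "H1_norm \<Omega> (\<lambda>x. a * u x + c * v x)
      \<le> sqrt ((\<bar>a\<bar> * L2_norm \<Omega> u + \<bar>c\<bar> * L2_norm \<Omega> v)\<^sup>2 + (\<bar>a\<bar> * H1_seminorm \<Omega> u + \<bar>c\<bar> * H1_seminorm \<Omega> v)\<^sup>2)"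
    unfolding H1_norm_def using 1 2 by (intro real_sqrt_le_mono add_mono power_mono) (auto simp: L2_norm_nonneg H1_seminorm_nonneg)
  also have "\<dots> \<le> sqrt ((\<bar>a\<bar> * L2_norm \<Omega> u)\<^sup>2 + (\<bar>a\<bar> * H1_seminorm \<Omega> u)\<^sup>2) + sqrt ((\<bar>c\<bar> * L2_norm \<Omega> v)\<^sup>2 + (\<bar>c\<bar> * H1_seminorm \<Omega> v)\<^sup>2)"
    by (rule real_sqrt_sum_squares_triangle_ineq)
  also have "\<dots> = \<bar>a\<bar> * H1_norm \<Omega> u + \<bar>c\<bar> * H1_norm \<Omega> v"
    by (simp add: H1_norm_def power_mult_distrib distrib_left[symmetric] real_sqrt_mult)
  finally show ?thesis .
qed

lemma H1_norm_diff:
  assumes "u \<in> H1 \<Omega>" and "v \<in> H1 \<Omega>"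
  shows "H1_norm \<Omega> (\<lambda>x. u x - v x) \<le> H1_norm \<Omega> u + H1_norm \<Omega> v"
  using H1_norm_linear_combination[OF assms, of 1 "-1"] by simp

text \<open>With this the errors of the orbitals and of the potential belong to the space and are
  admissible test functions.\<close>

lemma H1_closure_diff:
  assumes S: "\<And>\<eta> \<zeta>. \<lbrakk>\<eta> \<in> S; \<zeta> \<in> S\<rbrakk> \<Longrightarrow> (\<lambda>x. \<eta> x - \<zeta> x) \<in> S" and SH: "S \<subseteq> H1 \<Omega>"
    and u: "u \<in> H1_closure \<Omega> S" and v: "v \<in> H1_closure \<Omega> S"
  shows "(\<lambda>x. u x - v x) \<in> H1_closure \<Omega> S"
proof -
  have uv: "u \<in> H1 \<Omega>" "v \<in> H1 \<Omega>" using u v by (auto simp: H1_closure_def)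
  have "\<exists>\<eta>\<in>S. H1_norm \<Omega> (\<lambda>x. u x - v x - \<eta> x) < e" if "e > 0" for e
  proof -
    have "e / 2 > 0" using that by simp
    then obtain \<eta> \<zeta> where \<eta>: "\<eta> \<in> S" "H1_norm \<Omega> (\<lambda>x. u x - \<eta> x) < e / 2"
      and \<zeta>: "\<zeta> \<in> S" "H1_norm \<Omega> (\<lambda>x. v x - \<zeta> x) < e / 2"
      using u v unfolding H1_closure_def mem_Collect_eq by meson
    have "H1_norm \<Omega> (\<lambda>x. (u x - \<eta> x) - (v x - \<zeta> x)) \<le> H1_norm \<Omega> (\<lambda>x. u x - \<eta> x) + H1_norm \<Omega> (\<lambda>x. v x - \<zeta> x)"
      using \<eta> \<zeta> SH uv by (intro H1_norm_diff H1_diff) auto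
    also have "\<dots> < e" using \<eta> \<zeta> by simp
    finally have "H1_norm \<Omega> (\<lambda>x. u x - v x - (\<eta> x - \<zeta> x)) < e" by (simp add: algebra_simps)
    then show ?thesis by (rule bexI[OF _ S[OF \<eta>(1) \<zeta>(1)]])
  qed
  then show ?thesis using H1_diff(1)[OF uv] by (auto simp: H1_closure_def)
qed

end

section \<open>The Ladyzhenskaya inequality on a parallelepiped\<close>

text \<open>To be used with \<open>v = \<bar>u\<bar>\<close> and \<open>g\<close> dominating \<open>\<bar>u\<bar> + 2 * \<bar>\<partial>\<^sub>j u\<bar>\<close>. On a slice \<open>z = const\<close>, bounding one factor
  \<open>v\<^sup>2\<close> along \<open>x\<close> and the other along \<open>y\<close> separates the variables; the bound along \<open>z\<close> then makes the
  slice integrals of \<open>v\<^sup>2\<close> uniformly bounded.\<close>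

lemma (in sigma_finite_measure) Ladyzhenskaya_nn_integral:
  fixes v g :: "'a \<Rightarrow> 'a \<Rightarrow> 'a \<Rightarrow> ennreal"
  assumes "(\<lambda>(x,y,z). v x y z) \<in> borel_measurable (M \<Otimes>\<^sub>M M \<Otimes>\<^sub>M M)"
    "(\<lambda>(x,y,z). g x y z) \<in> borel_measurable (M \<Otimes>\<^sub>M M \<Otimes>\<^sub>M M)"
    and vg: "\<And>x y z. v x y z \<le> g x y z"
    and b1: "\<And>x y z. \<lbrakk>x \<in> space M; y \<in> space M; z \<in> space M\<rbrakk> \<Longrightarrow> (v x y z)\<^sup>2 \<le> (\<integral>\<^sup>+s. v s y z * g s y z \<partial>M)"
    and b2: "\<And>x y z. \<lbrakk>x \<in> space M; y \<in> space M; z \<in> space M\<rbrakk> \<Longrightarrow> (v x y z)\<^sup>2 \<le> (\<integral>\<^sup>+s. v x s z * g x s z \<partial>M)"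
    and b3: "\<And>x y z. \<lbrakk>x \<in> space M; y \<in> space M; z \<in> space M\<rbrakk> \<Longrightarrow> (v x y z)\<^sup>2 \<le> (\<integral>\<^sup>+s. v x y s * g x y s \<partial>M)"
  shows "(\<integral>\<^sup>+z. \<integral>\<^sup>+y. \<integral>\<^sup>+x. (v x y z)^4 \<partial>M \<partial>M \<partial>M) \<le> (\<integral>\<^sup>+z. \<integral>\<^sup>+y. \<integral>\<^sup>+x. (g x y z)\<^sup>2 \<partial>M \<partial>M \<partial>M)\<^sup>2"
proof -
  interpret P: pair_sigma_finite M M ..
  have v_meas[measurable (raw)]: "(\<lambda>p. v (a p) (b p) (c p)) \<in> borel_measurable L"
    if "a \<in> measurable L M" "b \<in> measurable L M" "c \<in> measurable L M" for a b c and L :: "_ measure"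
    using measurable_compose[OF measurable_Pair[OF that(1) measurable_Pair[OF that(2,3)]] assms(1)] by simp
  have g_meas[measurable (raw)]: "(\<lambda>p. g (a p) (b p) (c p)) \<in> borel_measurable L"
    if "a \<in> measurable L M" "b \<in> measurable L M" "c \<in> measurable L M" for a b c and L :: "_ measure"
    using measurable_compose[OF measurable_Pair[OF that(1) measurable_Pair[OF that(2,3)]] assms(2)] by simp
  define G where "G = (\<integral>\<^sup>+z. \<integral>\<^sup>+y. \<integral>\<^sup>+x. (g x y z)\<^sup>2 \<partial>M \<partial>M \<partial>M)"
  define J where "J z = (\<integral>\<^sup>+y. \<integral>\<^sup>+x. (g x y z)\<^sup>2 \<partial>M \<partial>M)" for z
  have J_meas[measurable]: "J \<in> borel_measurable M"
    unfolding J_def by measurable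
  have slice: "(\<integral>\<^sup>+y. \<integral>\<^sup>+x. (v x y z)^4 \<partial>M \<partial>M) \<le> G * J z" if z[measurable]: "z \<in> space M" for z
  proof -
    have [measurable]: "(\<lambda>p. v (snd p) (fst p) z) \<in> borel_measurable (M \<Otimes>\<^sub>M M)"
      "(\<lambda>p. g (snd p) (fst p) z) \<in> borel_measurable (M \<Otimes>\<^sub>M M)"
      using z by (auto intro!: v_meas g_meas)
    define I where "I = (\<integral>\<^sup>+y. \<integral>\<^sup>+x. v x y z * g x y z \<partial>M \<partial>M)"
    have I_pair: "I = (\<integral>\<^sup>+p. v (snd p) (fst p) z * g (snd p) (fst p) z \<partial>(M \<Otimes>\<^sub>M M))"
      unfolding I_def by (subst nn_integral_fst[symmetric]) simp_all
    have "(\<integral>\<^sup>+y. \<integral>\<^sup>+x. (v x y z)^4 \<partial>M \<partial>M)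
        \<le> (\<integral>\<^sup>+y. \<integral>\<^sup>+x. (\<integral>\<^sup>+s. v s y z * g s y z \<partial>M) * (\<integral>\<^sup>+s. v x s z * g x s z \<partial>M) \<partial>M \<partial>M)"
    proof (intro nn_integral_mono)
      fix x y assume xy: "x \<in> space M" "y \<in> space M"
      have "(v x y z)^4 = (v x y z)\<^sup>2 * (v x y z)\<^sup>2"
        by (simp add: power_add[symmetric])
      also have "\<dots> \<le> (\<integral>\<^sup>+s. v s y z * g s y z \<partial>M) * (\<integral>\<^sup>+s. v x s z * g x s z \<partial>M)"
        by (intro mult_mono b1 b2 xy z) auto
      finally show "(v x y z)^4 \<le> (\<integral>\<^sup>+s. v s y z * g s y z \<partial>M) * (\<integral>\<^sup>+s. v x s z * g x s z \<partial>M)" .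
    qed
    also have "\<dots> = (\<integral>\<^sup>+y. (\<integral>\<^sup>+s. v s y z * g s y z \<partial>M) * (\<integral>\<^sup>+x. \<integral>\<^sup>+s. v x s z * g x s z \<partial>M \<partial>M) \<partial>M)"
      by (intro nn_integral_cong nn_integral_cmult) measurable
    also have "\<dots> = I * (\<integral>\<^sup>+x. \<integral>\<^sup>+s. v x s z * g x s z \<partial>M \<partial>M)"
      unfolding I_def by (intro nn_integral_multc) measurable
    \<comment> \<open>By Fubini both factors are the same slice integral, so their product is a
      square to which Cauchy-Schwarz applies.\<close>
    also have "(\<integral>\<^sup>+x. \<integral>\<^sup>+s. v x s z * g x s z \<partial>M \<partial>M) = I"
      unfolding I_def
      by (rule P.Fubini'[symmetric]) measurable
    also have "I * I = (\<integral>\<^sup>+p. v (snd p) (fst p) z * g (snd p) (fst p) z \<partial>(M \<Otimes>\<^sub>M M))\<^sup>2"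
      by (simp add: I_pair power2_eq_square)
    also have "\<dots> \<le> (\<integral>\<^sup>+p. (v (snd p) (fst p) z)\<^sup>2 \<partial>(M \<Otimes>\<^sub>M M)) * (\<integral>\<^sup>+p. (g (snd p) (fst p) z)\<^sup>2 \<partial>(M \<Otimes>\<^sub>M M))"
      by (intro Cauchy_Schwarz_nn_integral) measurable
    also have "(\<integral>\<^sup>+p. (g (snd p) (fst p) z)\<^sup>2 \<partial>(M \<Otimes>\<^sub>M M)) = J z"
      unfolding J_def by (subst nn_integral_fst[symmetric]) simp_all
    also have "(\<integral>\<^sup>+p. (v (snd p) (fst p) z)\<^sup>2 \<partial>(M \<Otimes>\<^sub>M M)) = (\<integral>\<^sup>+y. \<integral>\<^sup>+x. (v x y z)\<^sup>2 \<partial>M \<partial>M)"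
      by (subst nn_integral_fst[symmetric]) simp_all
    also have "\<dots> \<le> (\<integral>\<^sup>+y. \<integral>\<^sup>+x. \<integral>\<^sup>+s. v x y s * g x y s \<partial>M \<partial>M \<partial>M)"
      by (intro nn_integral_mono b3 z)
    also have "\<dots> \<le> (\<integral>\<^sup>+y. \<integral>\<^sup>+x. \<integral>\<^sup>+s. (g x y s)\<^sup>2 \<partial>M \<partial>M \<partial>M)"
      by (intro nn_integral_mono) (auto simp: power2_eq_square intro!: mult_mono vg)
    also have "\<dots> = (\<integral>\<^sup>+y. \<integral>\<^sup>+s. \<integral>\<^sup>+x. (g x y s)\<^sup>2 \<partial>M \<partial>M \<partial>M)"
      by (intro nn_integral_cong P.Fubini') measurable
    also have "\<dots> = G"
      unfolding G_def by (intro P.Fubini') measurable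
    finally show ?thesis by (simp add: mult_right_mono)
  qed
  have "(\<integral>\<^sup>+z. \<integral>\<^sup>+y. \<integral>\<^sup>+x. (v x y z)^4 \<partial>M \<partial>M \<partial>M) \<le> (\<integral>\<^sup>+z. G * J z \<partial>M)"
    by (intro nn_integral_mono slice)
  also have "\<dots> = G * (\<integral>\<^sup>+z. J z \<partial>M)"
    by (intro nn_integral_cmult) measurable
  also have "\<dots> = G\<^sup>2"
    by (simp add: G_def J_def power2_eq_square)
  finally show ?thesis unfolding G_def .
qed

section \<open>From the cell to iterated integrals over the unit cube\<close>

lemma vector_3_measurable [measurable]:
  "(\<lambda>(z,y,x). vector [x,y,z] :: real^3) \<in> borel_measurable (lborel \<Otimes>\<^sub>M lborel \<Otimes>\<^sub>M lborel)"
proof -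
  have "(\<lambda>(z,y,x). vector [x,y,z] :: real^3) =
     (\<lambda>p. snd (snd p) *\<^sub>R axis 1 1 + fst (snd p) *\<^sub>R axis 2 1 + fst p *\<^sub>R axis 3 1)"
    by (auto simp: fun_eq_iff vec_eq_iff forall_3 axis_def)
  then show ?thesis by simp
qed

text \<open>The order \<open>(z,y,x)\<close> puts \<open>x\<close> innermost in the iterated
  integral, as in \<open>Ladyzhenskaya_nn_integral\<close>. Comparing the measures of boxes
  suffices.\<close>

lemma distr_vector_3:
  "distr (lborel \<Otimes>\<^sub>M lborel \<Otimes>\<^sub>M lborel) borel (\<lambda>(z,y,x). vector [x,y,z] :: real^3) = lborel"
proof (rule sym, rule lborel_eqI)
  \<comment> \<open>The rules for product measures want a sigma-finite second factor; read as
    Lebesgue measure on the plane, it is one.\<close>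
  have sf: "sigma_finite_measure (lborel \<Otimes>\<^sub>M lborel :: (real \<times> real) measure)"
    unfolding lborel_prod by unfold_locales
  fix l u :: "real^3" assume le: "\<And>b. b \<in> Basis \<Longrightarrow> l \<bullet> b \<le> u \<bullet> b"
  have le': "l $ i \<le> u $ i" for i
    using le[of "axis i 1"] by (simp add: inner_axis axis_in_Basis_iff)
  have eq: "(\<lambda>(z,y,x). vector [x,y,z] :: real^3) -` box l u \<inter> space (lborel \<Otimes>\<^sub>M lborel \<Otimes>\<^sub>M lborel) =
     {l $ 3<..<u $ 3} \<times> {l $ 2<..<u $ 2} \<times> {l $ 1<..<u $ 1}"
    by (auto simp: mem_box_cart forall_3 space_pair_measure)
  have "emeasure (distr (lborel \<Otimes>\<^sub>M lborel \<Otimes>\<^sub>M lborel) borel (\<lambda>(z,y,x). vector [x,y,z] :: real^3)) (box l u)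
     = ennreal (u $ 3 - l $ 3) * (ennreal (u $ 2 - l $ 2) * ennreal (u $ 1 - l $ 1))"
    by (subst emeasure_distr) (auto simp: eq sigma_finite_measure.emeasure_pair_measure_Times[OF sf] lborel.emeasure_pair_measure_Times le')
  also have "\<dots> = ennreal (\<Prod>b\<in>Basis. (u - l) \<bullet> b)"
  proof -
    have Basis: "Basis = range (\<lambda>i. axis i 1 :: real^3)"
      by (auto simp: Basis_vec_def)
    have inj: "inj (\<lambda>i. axis i 1 :: real^3)"
      by (simp add: inj_def axis_eq_axis)
    have "(\<Prod>b\<in>Basis. (u - l) \<bullet> b) = (\<Prod>i\<in>UNIV. (u - l) $ i)"
      unfolding Basis by (subst prod.reindex[OF inj]) (simp only: o_def inner_axis inner_real_def mult_1_right)
    also have "\<dots> = (u - l) $ 3 * ((u - l) $ 2 * (u - l) $ 1)"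
      unfolding UNIV_3 by simp
    also have "\<dots> = (u $ 3 - l $ 3) * ((u $ 2 - l $ 2) * (u $ 1 - l $ 1))"
      by simp
    finally show ?thesis using le' by (simp only: ennreal_mult diff_ge_0_iff_ge mult_nonneg_nonneg)
  qed
  finally show "emeasure (distr (lborel \<Otimes>\<^sub>M lborel \<Otimes>\<^sub>M lborel) borel (\<lambda>(z,y,x). vector [x,y,z] :: real^3)) (box l u) = ennreal (\<Prod>b\<in>Basis. (u - l) \<bullet> b)" .
qed simp

lemma nn_integral_lborel_vec3:
  fixes h :: "real^3 \<Rightarrow> ennreal"
  assumes [measurable]: "h \<in> borel_measurable borel"
  shows "(\<integral>\<^sup>+x. h x \<partial>lborel) = (\<integral>\<^sup>+z. \<integral>\<^sup>+y. \<integral>\<^sup>+x. h (vector [x,y,z]) \<partial>lborel \<partial>lborel \<partial>lborel)"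
proof -
  have sf: "sigma_finite_measure (lborel \<Otimes>\<^sub>M lborel :: (real \<times> real) measure)"
    unfolding lborel_prod by unfold_locales
  have "(\<integral>\<^sup>+x. h x \<partial>lborel) = (\<integral>\<^sup>+p. h ((\<lambda>(z,y,x). vector [x,y,z]) p) \<partial>(lborel \<Otimes>\<^sub>M lborel \<Otimes>\<^sub>M lborel))"
    by (subst distr_vector_3[symmetric], subst nn_integral_distr) simp_all
  also have "\<dots> = (\<integral>\<^sup>+z. \<integral>\<^sup>+q. h ((\<lambda>(z,y,x). vector [x,y,z]) (z, q)) \<partial>(lborel \<Otimes>\<^sub>M lborel) \<partial>lborel)"
    by (rule sigma_finite_measure.nn_integral_fst[OF sf, symmetric]) measurable
  also have "\<dots> = (\<integral>\<^sup>+z. \<integral>\<^sup>+y. \<integral>\<^sup>+x. h (vector [x,y,z]) \<partial>lborel \<partial>lborel \<partial>lborel)"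
    by (intro nn_integral_cong, subst lborel.nn_integral_fst[symmetric]) simp_all
  finally show ?thesis .
qed

text \<open>The image measure scaled by \<open>\<bar>det A\<bar>\<close> agrees with Lebesgue
  measure on boxes: the preimage of a box is the image of a translated box under the inverse matrix
  \<open>B\<close>, and \<open>det A * det B = 1\<close>.\<close>

lemma nn_integral_lborel_linear:
  fixes h :: "real^3 \<Rightarrow> ennreal" and A :: "real^3^3"
  assumes [measurable]: "h \<in> borel_measurable borel" and A: "invertible A"
  shows "(\<integral>\<^sup>+x. h x \<partial>lborel) = ennreal \<bar>det A\<bar> * (\<integral>\<^sup>+x. h (c + A *v x) \<partial>lborel)"
proof -
  have d: "det A \<noteq> 0" using A by (simp add: invertible_det_nz)
  have T[measurable]: "(\<lambda>x. c + A *v x) \<in> borel_measurable borel"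
    by (intro borel_measurable_continuous_onI continuous_intros)
  have "lborel = scale_measure \<bar>det A\<bar> (distr lborel borel (\<lambda>x. c + A *v x))"
  proof (rule lborel_eqI)
    fix l u :: "real^3" assume le: "\<And>b. b \<in> Basis \<Longrightarrow> l \<bullet> b \<le> u \<bullet> b"
    obtain B where B: "A ** B = mat 1" "B ** A = mat 1" using A by (auto simp: invertible_def)
    have detB: "det A * det B = 1" using B(1) by (metis det_I det_mul)
    have eq: "(\<lambda>x. c + A *v x) -` box l u = (*v) B ` box (l - c) (u - c)"
    proof (intro equalityI subsetI; (elim imageE, hypsubst)?)
      fix x assume "x \<in> (\<lambda>x. c + A *v x) -` box l u"
      then have "A *v x \<in> box (l - c) (u - c)" by (auto simp: mem_box_cart algebra_simps)
      moreover have "x = B *v (A *v x)" by (simp add: matrix_vector_mul_assoc B)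
      ultimately show "x \<in> (*v) B ` box (l - c) (u - c)" by blast
    next
      fix x assume "x \<in> box (l - c) (u - c)"
      then show "B *v x \<in> (\<lambda>x. c + A *v x) -` box l u"
        by (auto simp: mem_box_cart algebra_simps matrix_vector_mul_assoc B)
    qed
    have lm: "(*v) B ` box (l - c) (u - c) \<in> lmeasurable"
      by (rule measurable_linear_image) (auto simp: matrix_vector_mul_linear)
    have bor: "(*v) B ` box (l - c) (u - c) \<in> sets borel"
      using measurable_sets[OF T, of "box l u"] by (simp add: eq)
    have "emeasure lborel ((*v) B ` box (l - c) (u - c)) = ennreal (measure lebesgue ((*v) B ` box (l - c) (u - c)))"
      using lm bor emeasure_eq_measure2[OF lm] by simp
    also have "measure lebesgue ((*v) B ` box (l - c) (u - c)) = \<bar>det B\<bar> * measure lebesgue (box (l - c) (u - c))"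
      by (subst measure_linear_image) (auto simp: matrix_vector_mul_linear)
    also have "measure lebesgue (box (l - c) (u - c)) = (\<Prod>b\<in>Basis. (u - l) \<bullet> b)"
      using le by (auto simp: measure_lborel_box_eq inner_diff_left measure_completion intro!: prod.cong)
    finally have *: "emeasure lborel ((*v) B ` box (l - c) (u - c)) = ennreal (\<bar>det B\<bar> * (\<Prod>b\<in>Basis. (u - l) \<bullet> b))" .
    have "\<bar>det A\<bar> * (\<bar>det B\<bar> * (\<Prod>b\<in>Basis. (u - l) \<bullet> b)) = (\<Prod>b\<in>Basis. (u - l) \<bullet> b)"
      using detB by (simp add: mult.assoc[symmetric] abs_mult[symmetric])
    then have "ennreal \<bar>det A\<bar> * ennreal (\<bar>det B\<bar> * (\<Prod>b\<in>Basis. (u - l) \<bullet> b)) = ennreal (\<Prod>b\<in>Basis. (u - l) \<bullet> b)"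
      by (metis abs_ge_zero ennreal_mult')
    moreover have "emeasure (distr lborel borel (\<lambda>x. c + A *v x)) (box l u) = emeasure lborel ((*v) B ` box (l - c) (u - c))"
      by (subst emeasure_distr) (simp_all add: eq)
    ultimately show "emeasure (scale_measure \<bar>det A\<bar> (distr lborel borel (\<lambda>x. c + A *v x))) (box l u) = ennreal (\<Prod>b\<in>Basis. (u - l) \<bullet> b)"
      using * by (simp only: emeasure_scale_measure)
  qed simp
  then have "(\<integral>\<^sup>+x. h x \<partial>lborel) = (\<integral>\<^sup>+x. h x \<partial>scale_measure \<bar>det A\<bar> (distr lborel borel (\<lambda>x. c + A *v x)))"
    by simp
  also have "\<dots> = ennreal \<bar>det A\<bar> * (\<integral>\<^sup>+x. h (c + A *v x) \<partial>lborel)"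
    by (simp add: nn_integral_scale_measure nn_integral_distr)
  finally show ?thesis .
qed

text \<open>The fundamental theorem gives \<open>(f x)\<^sup>2 \<le> (f y)\<^sup>2 + c\<close> for
  every \<open>y\<close>, and this is averaged over the unit interval. The average takes the place
  of a zero boundary value.\<close>

lemma square_le_integral_unit_interval:
  fixes f f' :: "real \<Rightarrow> real"
  assumes der: "\<And>s. (f has_real_derivative f' s) (at s)" and cont: "continuous_on UNIV f'"
    and x: "x \<in> {0..1}"
  shows "(f x)\<^sup>2 \<le> integral {0..1} (\<lambda>s. \<bar>f s\<bar> * (\<bar>f s\<bar> + 2 * \<bar>f' s\<bar>))"
proof -
  have cf: "continuous_on S f" for S
    using der by (meson DERIV_isCont continuous_at_imp_continuous_on)
  have cf': "continuous_on S f'" for S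
    using cont continuous_on_subset by blast
  define c where "c = integral {0..1} (\<lambda>s. 2 * \<bar>f s\<bar> * \<bar>f' s\<bar>)"
  have ftc: "((\<lambda>s. 2 * f s * f' s) has_integral (f b)\<^sup>2 - (f a)\<^sup>2) {a..b}" if "a \<le> b" for a b
  proof (rule fundamental_theorem_of_calculus[OF that])
    fix s
    have "((\<lambda>s. (f s)\<^sup>2) has_real_derivative 2 * f s * f' s) (at s)"
      using DERIV_power[OF der[of s], of 2] by (simp add: mult_ac)
    then show "((\<lambda>s. (f s)\<^sup>2) has_vector_derivative 2 * f s * f' s) (at s within {a..b})"
      unfolding has_real_derivative_iff_has_vector_derivative[symmetric] by (rule has_field_derivative_at_within)
  qed
  have bound: "\<bar>(f b)\<^sup>2 - (f a)\<^sup>2\<bar> \<le> c" if "0 \<le> a" "a \<le> b" "b \<le> 1" for a b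
  proof -
    have "\<bar>integral {a..b} (\<lambda>s. 2 * f s * f' s)\<bar> \<le> integral {a..b} (\<lambda>s. 2 * \<bar>f s\<bar> * \<bar>f' s\<bar>)"
      using integral_norm_bound_integral[of "\<lambda>s. 2 * f s * f' s" "{a..b}" "\<lambda>s. 2 * \<bar>f s\<bar> * \<bar>f' s\<bar>"]
      by (simp add: abs_mult integrable_continuous_interval continuous_intros cf cf')
    also have "\<dots> \<le> c"
      unfolding c_def using that
      by (intro integral_subset_le) (auto intro!: integrable_continuous_interval continuous_intros cf cf')
    finally show ?thesis
      using ftc[OF \<open>a \<le> b\<close>] by (simp add: integral_unique)
  qed
  have pw: "(f x)\<^sup>2 \<le> (f y)\<^sup>2 + c" if "y \<in> {0..1}" for y
    using bound[of x y] bound[of y x] x that by (cases "x \<le> y") auto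
  have "integral {0..1} (\<lambda>y::real. (f x)\<^sup>2) \<le> integral {0..1} (\<lambda>y. (f y)\<^sup>2 + c)"
    by (intro integral_le) (auto intro!: integrable_continuous_interval continuous_intros cf pw)
  then have "(f x)\<^sup>2 \<le> integral {0..1} (\<lambda>y. (f y)\<^sup>2) + c"
    using integral_add[of "\<lambda>y. (f y)\<^sup>2" "{0..1}" "\<lambda>_. c"]
    by (simp add: integrable_continuous_interval continuous_intros cf)
  also have "\<dots> = integral {0..1} (\<lambda>s. (f s)\<^sup>2 + 2 * \<bar>f s\<bar> * \<bar>f' s\<bar>)"
    unfolding c_def by (intro integral_add[symmetric]) (auto intro!: integrable_continuous_interval continuous_intros cf cf')
  also have "\<dots> = integral {0..1} (\<lambda>s. \<bar>f s\<bar> * (\<bar>f s\<bar> + 2 * \<bar>f' s\<bar>))"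
    by (intro integral_cong) (simp add: power2_eq_square distrib_left)
  finally show ?thesis .
qed

text \<open>The previous bound in the form that the slices of the open cell require: an extended
  integral over the open interval, the endpoints being null.\<close>

lemma square_le_nn_integral_unit_interval:
  fixes f f' g :: "real \<Rightarrow> real"
  assumes der: "\<And>s. (f has_real_derivative f' s) (at s)" and cont: "continuous_on UNIV f'"
    and g: "\<And>s. \<bar>f s\<bar> + 2 * \<bar>f' s\<bar> \<le> g s"
    and x: "x \<in> {0<..<1}"
  shows "(ennreal \<bar>f x\<bar>)\<^sup>2 \<le> (\<integral>\<^sup>+s. ennreal \<bar>f s\<bar> * ennreal (g s) \<partial>restrict_space lborel {0<..<1})"
proof -
  let ?k = "\<lambda>s. \<bar>f s\<bar> * (\<bar>f s\<bar> + 2 * \<bar>f' s\<bar>)"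
  have cf: "continuous_on S f" for S
    using der by (meson DERIV_isCont continuous_at_imp_continuous_on)
  have cf': "continuous_on S f'" for S
    using cont continuous_on_subset by blast
  have ck: "continuous_on S ?k" for S
    by (intro continuous_intros cf cf')
  have "(ennreal \<bar>f x\<bar>)\<^sup>2 = ennreal ((f x)\<^sup>2)"
    by (simp add: ennreal_power)
  also have "\<dots> \<le> ennreal (integral {0..1} ?k)"
    by (intro ennreal_leI square_le_integral_unit_interval der cont) (use x in auto)
  also have "\<dots> = (\<integral>\<^sup>+s. ennreal (?k s) * indicator {0..1} s \<partial>lborel)"
  proof -
    have si: "set_integrable lborel {0..1} ?k"
      by (intro borel_integrable_atLeastAtMost' ck)
    have "(\<integral>\<^sup>+s. ennreal (?k s) * indicator {0..1} s \<partial>lborel) = (\<integral>\<^sup>+s. ennreal (indicator {0..1} s *\<^sub>R ?k s) \<partial>lborel)"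
      by (intro nn_integral_cong) (auto split: split_indicator)
    also have "\<dots> = ennreal (LINT s:{0..1}|lborel. ?k s)"
      unfolding set_lebesgue_integral_def
      by (intro nn_integral_eq_integral) (use si in \<open>auto simp: set_integrable_def\<close>)
    also have "(LINT s:{0..1}|lborel. ?k s) = integral {0..1} ?k"
      by (rule set_borel_integral_eq_integral[OF si])
    finally show ?thesis by simp
  qed
  also have "\<dots> = (\<integral>\<^sup>+s. ennreal (?k s) * indicator {0<..<1} s \<partial>lborel)"
    using AE_lborel_singleton[of "0::real"] AE_lborel_singleton[of "1::real"]
    by (intro nn_integral_cong_AE) (auto elim!: eventually_elim2 split: split_indicator)
  also have "\<dots> = (\<integral>\<^sup>+s. ennreal (?k s) \<partial>restrict_space lborel {0<..<1})"
    by (simp add: nn_integral_restrict_space)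
  also have "\<dots> \<le> (\<integral>\<^sup>+s. ennreal \<bar>f s\<bar> * ennreal (g s) \<partial>restrict_space lborel {0<..<1})"
  proof (intro nn_integral_mono)
    fix s
    have "ennreal (?k s) \<le> ennreal (\<bar>f s\<bar> * g s)"
      by (intro ennreal_leI mult_left_mono g abs_ge_zero)
    also have "\<dots> = ennreal \<bar>f s\<bar> * ennreal (g s)"
      by (rule ennreal_mult') simp
    finally show "ennreal (?k s) \<le> ennreal \<bar>f s\<bar> * ennreal (g s)" .
  qed
  finally show ?thesis .
qed

text \<open>The cell is the affine image of the unit cube. Along an edge direction the derivative of
  \<open>u\<close> is \<open>Du \<bullet> w\<close> with \<open>w\<close> a column of
  \<open>A\<close>, so the one-dimensional bound applies on each coordinate line of the
  cube.\<close>

lemma Ladyzhenskaya_cell: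
  fixes A :: "real^3^3" and c :: "real^3"
  assumes A: "invertible A"
  obtains K where "K > 0"
    "\<And>u (Du :: real^3 \<Rightarrow> real^3). \<lbrakk>\<And>x. (u has_derivative (\<lambda>h. Du x \<bullet> h)) (at x); continuous_on UNIV Du\<rbrakk> \<Longrightarrow>
      (\<integral>\<^sup>+x\<in>supercell A c. ennreal ((u x)^4) \<partial>lborel)
        \<le> ennreal K * (\<integral>\<^sup>+x\<in>supercell A c. ennreal ((u x)\<^sup>2 + (norm (Du x))\<^sup>2) \<partial>lborel)\<^sup>2"
proof -
  have d: "\<bar>det A\<bar> > 0" using A by (simp add: invertible_det_nz)
  \<comment> \<open>\<open>L\<close> dominates \<open>1 + 2 * norm w\<close> for each of the three
    columns \<open>w\<close>, so that a single \<open>g\<close> serves all directions.\<close>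
  define L where "L = 1 + 2 * (norm (column 1 A) + norm (column 2 A) + norm (column 3 A))"
  have L1: "L \<ge> 1" by (simp add: L_def)
  \<comment> \<open>The factor \<open>2 * L\<^sup>2\<close> comes from bounding
    \<open>g\<^sup>2\<close> and enters squared. The Jacobian occurs once on the left and twice in
    the squared integral on the right, which leaves one division by it.\<close>
  define K where "K = (2 * L\<^sup>2)\<^sup>2 / \<bar>det A\<bar>"
  have "K > 0" using d L1 by (simp add: K_def)
  moreover have "(\<integral>\<^sup>+x\<in>supercell A c. ennreal ((u x)^4) \<partial>lborel)
        \<le> ennreal K * (\<integral>\<^sup>+x\<in>supercell A c. ennreal ((u x)\<^sup>2 + (norm (Du x))\<^sup>2) \<partial>lborel)\<^sup>2"
    if der: "\<And>x. (u has_derivative (\<lambda>h. Du x \<bullet> h)) (at x)" and cont: "continuous_on UNIV Du" for u Du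
  proof -
    define T where "T = (\<lambda>x y z :: real. c + A *v vector [x,y,z])"
    have T_eq: "T x y z = c + x *\<^sub>R column 1 A + y *\<^sub>R column 2 A + z *\<^sub>R column 3 A" for x y z
      unfolding T_def matrix_mult_sum sum_3 by (simp only: vector_3 scalar_mult_eq_scaleR add.assoc)
    have T_line: "T x y z = (c + y *\<^sub>R column 2 A + z *\<^sub>R column 3 A) + x *\<^sub>R column 1 A"
      "T x y z = (c + x *\<^sub>R column 1 A + z *\<^sub>R column 3 A) + y *\<^sub>R column 2 A"
      "T x y z = (c + x *\<^sub>R column 1 A + y *\<^sub>R column 2 A) + z *\<^sub>R column 3 A" for x y z
      unfolding T_eq by (simp_all only: add_ac)
    have cu: "continuous_on UNIV u"
      using der has_derivative_continuous continuous_at_imp_continuous_on by blast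
    have inj: "inj ((*v) A)" using A inj_matrix_vector_mult by blast
    have cell: "c + A *v t \<in> supercell A c \<longleftrightarrow> (\<forall>i. 0 < t $ i \<and> t $ i < 1)" for t
      using inj by (auto simp: supercell_def inj_def)
    have cell_open: "open (supercell A c)"
    proof -
      have "supercell A c = (+) c ` (*v) A ` {t. \<forall>i. 0 < t $ i \<and> t $ i < 1}"
        by (auto simp: supercell_def)
      moreover have "{t. \<forall>i. 0 < t $ i \<and> t $ i < 1} = box 0 (1 :: real^3)"
        by (auto simp: mem_box_cart)
      moreover have "open ((*v) A ` box 0 (1 :: real^3))"
        by (rule open_surjective_linear_image) (use A in \<open>auto simp: matrix_vector_mul_linear invertible_right_inverse matrix_right_invertible_surjective\<close>)
      ultimately show ?thesis using open_translation by simp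
    qed
    have [measurable]: "supercell A c \<in> sets borel" using cell_open by simp
    let ?M = "restrict_space lborel {0<..<1::real}"
    interpret M: sigma_finite_measure ?M
      by (intro sigma_finite_measure_restrict_space) (auto intro: lborel.sigma_finite_measure_axioms)
    have transfer: "(\<integral>\<^sup>+x\<in>supercell A c. h x \<partial>lborel) =
        ennreal \<bar>det A\<bar> * (\<integral>\<^sup>+z. \<integral>\<^sup>+y. \<integral>\<^sup>+x. h (T x y z) \<partial>?M \<partial>?M \<partial>?M)"
      if [measurable]: "h \<in> borel_measurable borel" for h :: "real^3 \<Rightarrow> ennreal"
    proof -
      have [measurable]: "(\<lambda>x. c + A *v x) \<in> borel_measurable borel"
        by (intro borel_measurable_continuous_onI continuous_intros)
      have ind: "indicator (supercell A c) (T x y z) = (indicator {0<..<1} x * indicator {0<..<1} y * indicator {0<..<1} z :: ennreal)" for x y z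
        by (auto simp: T_def cell forall_3 split: split_indicator)
      have "(\<integral>\<^sup>+x\<in>supercell A c. h x \<partial>lborel) = \<bar>det A\<bar> * (\<integral>\<^sup>+x. h (c + A *v x) * indicator (supercell A c) (c + A *v x) \<partial>lborel)"
        by (rule nn_integral_lborel_linear[OF _ A]) measurable
      also have "\<dots> = \<bar>det A\<bar> * (\<integral>\<^sup>+z. \<integral>\<^sup>+y. \<integral>\<^sup>+x. h (T x y z) * indicator (supercell A c) (T x y z) \<partial>lborel \<partial>lborel \<partial>lborel)"
        unfolding T_def by (subst nn_integral_lborel_vec3) measurable
      also have "\<dots> = \<bar>det A\<bar> * (\<integral>\<^sup>+z. \<integral>\<^sup>+y. \<integral>\<^sup>+x. h (T x y z) \<partial>?M \<partial>?M \<partial>?M)"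
      proof -
        let ?U = "{0<..<1::real}"
        have "(\<integral>\<^sup>+x. h (T x y z) * (indicator ?U x * indicator ?U y * indicator ?U z) \<partial>lborel)
            = (\<integral>\<^sup>+x\<in>?U. h (T x y z) \<partial>lborel) * indicator ?U y * indicator ?U z" for y z
          by (cases "y \<in> ?U"; cases "z \<in> ?U") simp_all
        moreover have "(\<integral>\<^sup>+y. (\<integral>\<^sup>+x\<in>?U. h (T x y z) \<partial>lborel) * indicator ?U y * indicator ?U z \<partial>lborel)
            = (\<integral>\<^sup>+y\<in>?U. (\<integral>\<^sup>+x\<in>?U. h (T x y z) \<partial>lborel) \<partial>lborel) * indicator ?U z" for z
          by (cases "z \<in> ?U") simp_all
        ultimately show ?thesis
          unfolding ind by (simp add: nn_integral_restrict_space)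
      qed
      finally show ?thesis .
    qed
    define v where "v = (\<lambda>x y z. \<bar>u (T x y z)\<bar>)"
    define g where "g = (\<lambda>x y z. L * (\<bar>u (T x y z)\<bar> + norm (Du (T x y z))))"
    have der_line: "((\<lambda>s. u (p + s *\<^sub>R w)) has_real_derivative Du (p + s *\<^sub>R w) \<bullet> w) (at s)" for p w s
    proof -
      have "((\<lambda>s. p + s *\<^sub>R w) has_derivative (\<lambda>h. h *\<^sub>R w)) (at s)"
        by (auto intro!: derivative_eq_intros)
      from has_derivative_compose[OF this der]
      show ?thesis by (simp add: has_field_derivative_def mult_commute_abs)
    qed
    have cont_line: "continuous_on UNIV (\<lambda>s. Du (p + s *\<^sub>R w) \<bullet> w)" for p w
      by (intro continuous_intros continuous_on_compose2[OF cont]) auto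
    have line: "(ennreal \<bar>u (p + x *\<^sub>R w)\<bar>)\<^sup>2 \<le>
        (\<integral>\<^sup>+s. ennreal \<bar>u (p + s *\<^sub>R w)\<bar> * ennreal (L * (\<bar>u (p + s *\<^sub>R w)\<bar> + norm (Du (p + s *\<^sub>R w)))) \<partial>?M)"
      if x: "x \<in> {0<..<1}" and w: "1 + 2 * norm w \<le> L" for p w x
    proof (rule square_le_nn_integral_unit_interval[OF der_line cont_line _ x])
      fix s
      let ?q = "p + s *\<^sub>R w"
      have "\<bar>u ?q\<bar> + 2 * \<bar>Du ?q \<bullet> w\<bar> \<le> \<bar>u ?q\<bar> + 2 * (norm (Du ?q) * norm w)"
        using Cauchy_Schwarz_ineq2[of "Du ?q" w] by simp
      also have "\<dots> \<le> L * \<bar>u ?q\<bar> + L * norm (Du ?q)"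
      proof (rule add_mono)
        show "\<bar>u ?q\<bar> \<le> L * \<bar>u ?q\<bar>" using L1 by (simp add: mult_le_cancel_right1)
        have "(2 * norm w) * norm (Du ?q) \<le> L * norm (Du ?q)"
          using w by (intro mult_right_mono) auto
        then show "2 * (norm (Du ?q) * norm w) \<le> L * norm (Du ?q)" by (simp add: mult_ac)
      qed
      finally show "\<bar>u ?q\<bar> + 2 * \<bar>Du ?q \<bullet> w\<bar> \<le> L * (\<bar>u ?q\<bar> + norm (Du ?q))" by (simp add: algebra_simps)
    qed
    have T_meas: "(\<lambda>(x,y,z). T x y z) \<in> borel_measurable (?M \<Otimes>\<^sub>M ?M \<Otimes>\<^sub>M ?M)"
    proof -
      have [measurable]: "(\<lambda>x. x) \<in> borel_measurable ?M"
        by (rule measurable_restrict_space1) simp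
      show ?thesis unfolding T_eq by measurable
    qed
    have [measurable]: "u \<in> borel_measurable borel" "Du \<in> borel_measurable borel"
      using cu cont by (auto intro: borel_measurable_continuous_onI)
    have meas: "(\<lambda>(x,y,z). ennreal (v x y z)) \<in> borel_measurable (?M \<Otimes>\<^sub>M ?M \<Otimes>\<^sub>M ?M)"
      "(\<lambda>(x,y,z). ennreal (g x y z)) \<in> borel_measurable (?M \<Otimes>\<^sub>M ?M \<Otimes>\<^sub>M ?M)"
      using measurable_compose[OF T_meas, of "\<lambda>x. ennreal \<bar>u x\<bar>" borel]
        measurable_compose[OF T_meas, of "\<lambda>x. ennreal (L * (\<bar>u x\<bar> + norm (Du x)))" borel]
      by (simp_all add: v_def g_def case_prod_beta)
    let ?I = "\<integral>\<^sup>+z. \<integral>\<^sup>+y. \<integral>\<^sup>+x. ennreal (2 * L\<^sup>2) * ennreal ((u (T x y z))\<^sup>2 + (norm (Du (T x y z)))\<^sup>2) \<partial>?M \<partial>?M \<partial>?M"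
    have "(\<integral>\<^sup>+z. \<integral>\<^sup>+y. \<integral>\<^sup>+x. (ennreal (v x y z))^4 \<partial>?M \<partial>?M \<partial>?M)
       \<le> (\<integral>\<^sup>+z. \<integral>\<^sup>+y. \<integral>\<^sup>+x. (ennreal (g x y z))\<^sup>2 \<partial>?M \<partial>?M \<partial>?M)\<^sup>2"
    proof (rule M.Ladyzhenskaya_nn_integral[OF meas])
      fix x y z
      have "1 * v x y z \<le> g x y z" unfolding g_def v_def using L1 by (intro mult_mono) auto
      then show "ennreal (v x y z) \<le> ennreal (g x y z)" by (intro ennreal_leI) simp
    next
      fix x y z assume *: "x \<in> space ?M" "y \<in> space ?M" "z \<in> space ?M"
      show "(ennreal (v x y z))\<^sup>2 \<le> (\<integral>\<^sup>+s. ennreal (v s y z) * ennreal (g s y z) \<partial>?M)"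
        using line[of x "column 1 A" "c + y *\<^sub>R column 2 A + z *\<^sub>R column 3 A"] *
        by (simp add: v_def g_def T_line(1) L_def space_restrict_space)
      show "(ennreal (v x y z))\<^sup>2 \<le> (\<integral>\<^sup>+s. ennreal (v x s z) * ennreal (g x s z) \<partial>?M)"
        using line[of y "column 2 A" "c + x *\<^sub>R column 1 A + z *\<^sub>R column 3 A"] *
        by (simp add: v_def g_def T_line(2) L_def space_restrict_space)
      show "(ennreal (v x y z))\<^sup>2 \<le> (\<integral>\<^sup>+s. ennreal (v x y s) * ennreal (g x y s) \<partial>?M)"
        using line[of z "column 3 A" "c + x *\<^sub>R column 1 A + y *\<^sub>R column 2 A"] *
        by (simp add: v_def g_def T_line(3) L_def space_restrict_space)
    qed
    also have "\<dots> \<le> ?I\<^sup>2"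
    proof (intro power_mono nn_integral_mono)
      fix x y z
      have "(\<bar>u (T x y z)\<bar> + norm (Du (T x y z)))\<^sup>2 \<le> 2 * ((u (T x y z))\<^sup>2 + (norm (Du (T x y z)))\<^sup>2)"
        using sum_squares_bound[of "\<bar>u (T x y z)\<bar>" "norm (Du (T x y z))"]
        by (simp add: power2_sum)
      then have "L\<^sup>2 * (\<bar>u (T x y z)\<bar> + norm (Du (T x y z)))\<^sup>2 \<le> L\<^sup>2 * (2 * ((u (T x y z))\<^sup>2 + (norm (Du (T x y z)))\<^sup>2))"
        by (intro mult_left_mono) auto
      then have "(g x y z)\<^sup>2 \<le> 2 * L\<^sup>2 * ((u (T x y z))\<^sup>2 + (norm (Du (T x y z)))\<^sup>2)"
        by (simp only: g_def power_mult_distrib mult.assoc mult.left_commute[of 2])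
      then show "(ennreal (g x y z))\<^sup>2 \<le> ennreal (2 * L\<^sup>2) * ennreal ((u (T x y z))\<^sup>2 + (norm (Du (T x y z)))\<^sup>2)"
        using L1 by (subst ennreal_mult'[symmetric]) (auto simp: g_def ennreal_power intro!: ennreal_leI)
    qed simp
    finally have main: "(\<integral>\<^sup>+z. \<integral>\<^sup>+y. \<integral>\<^sup>+x. ennreal ((u (T x y z))^4) \<partial>?M \<partial>?M \<partial>?M)
       \<le> ?I\<^sup>2"
      by (simp add: v_def ennreal_power)
    let ?H = "\<integral>\<^sup>+x\<in>supercell A c. ennreal ((u x)\<^sup>2 + (norm (Du x))\<^sup>2) \<partial>lborel"
    have R: "ennreal \<bar>det A\<bar> * ?I
        = ennreal (2 * L\<^sup>2) * ?H"
    proof (subst transfer[symmetric])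
      show "(\<integral>\<^sup>+x\<in>supercell A c. (ennreal (2 * L\<^sup>2) * ennreal ((u x)\<^sup>2 + (norm (Du x))\<^sup>2)) \<partial>lborel) = ennreal (2 * L\<^sup>2) * ?H"
        unfolding mult.assoc by (rule nn_integral_cmult) measurable
    qed measurable
    have u4: "(\<lambda>x. ennreal ((u x)^4)) \<in> borel_measurable borel" by measurable
    have "(\<integral>\<^sup>+x\<in>supercell A c. ennreal ((u x)^4) \<partial>lborel) \<le> ennreal \<bar>det A\<bar> * ?I\<^sup>2"
      unfolding transfer[OF u4] by (rule mult_left_mono[OF main zero_le])
    also have "\<dots> = ennreal (1 / \<bar>det A\<bar>) * (ennreal \<bar>det A\<bar> * ?I)\<^sup>2"
    proof -
      have "ennreal (1 / \<bar>det A\<bar>) * (ennreal \<bar>det A\<bar> * ?I)\<^sup>2 = (ennreal (1 / \<bar>det A\<bar>) * ennreal \<bar>det A\<bar>) * ennreal \<bar>det A\<bar> * ?I\<^sup>2"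
        by (simp add: power2_eq_square mult_ac)
      also have "ennreal (1 / \<bar>det A\<bar>) * ennreal \<bar>det A\<bar> = 1"
        using d by (simp add: ennreal_mult'[symmetric])
      finally show ?thesis by simp
    qed
    also have "\<dots> = ennreal K * ?H\<^sup>2"
      unfolding R K_def using L1 d
      by (simp add: power_mult_distrib ennreal_power mult.assoc[symmetric] ennreal_mult'[symmetric] ennreal_mult''[symmetric])
    finally show ?thesis .
  qed
  ultimately show thesis using that by blast
qed

section \<open>The exchange-correlation energy\<close>

text \<open>The increment of the density may be positive, zero or negative, hence a version for
  endpoints in either order.\<close>

lemma mean_value_between:
  fixes f f' :: "real \<Rightarrow> real"
  assumes der: "\<And>z. \<lbrakk>min x y \<le> z; z \<le> max x y\<rbrakk> \<Longrightarrow> (f has_real_derivative f' z) (at z)"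
  obtains z where "min x y \<le> z" "z \<le> max x y" "f y - f x = (y - x) * f' z"
proof -
  consider "x < y" | "x = y" | "y < x" by linarith
  then show thesis
  proof cases
    case 1
    then obtain z where "z > x" "z < y" "f y - f x = (y - x) * f' z"
      using MVT2[of x y f f'] der by auto
    then show ?thesis using that[of z] 1 by auto
  next
    case 2
    then show ?thesis using that[of x] by auto
  next
    case 3
    then obtain z where "z > y" "z < x" "f x - f y = (x - y) * f' z"
      using MVT2[of y x f f'] der by auto
    then show ?thesis using that[of z] 3 by (auto simp: algebra_simps)
  qed
qed

text \<open>For \<open>\<rho> = 2 * \<Sum>\<psi>\<^sup>2\<close>, \<open>s = 4 * \<Sum>\<psi> * e\<close> and \<open>d = 2 * \<Sum>e\<^sup>2\<close> this is the second-order remainder of \<open>F \<circ> density\<close> in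
  direction \<open>e\<close>, and \<open>s\<^sup>2 \<le> 4 * \<rho> * d\<close> is the Cauchy-Schwarz inequality. Since \<open>F''\<close> blows up at \<open>0\<close>, Taylor
  expansion is only used for \<open>\<rho> > 16 * d\<close>, where the segment from \<open>\<rho>\<close> to \<open>\<rho> + s + d\<close> stays comparable to \<open>\<rho>\<close>;
  otherwise every term is already of order \<open>d\<close>.\<close>

lemma density_functional_remainder:
  fixes F F1 F2 :: "real \<Rightarrow> real"
  assumes d1: "\<And>\<rho>. \<rho> > 0 \<Longrightarrow> (F has_real_derivative F1 \<rho>) (at \<rho>)"
    and d2: "\<And>\<rho>. \<rho> > 0 \<Longrightarrow> (F1 has_real_derivative F2 \<rho>) (at \<rho>)"
    and b0: "\<And>\<rho>. \<rho> \<ge> 0 \<Longrightarrow> \<bar>F \<rho>\<bar> \<le> K * \<rho> * (1 + \<rho>)"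
    and b1: "\<And>\<rho>. \<rho> > 0 \<Longrightarrow> \<bar>F1 \<rho>\<bar> \<le> K * (1 + \<rho>)"
    and b2: "\<And>\<rho>. \<rho> > 0 \<Longrightarrow> \<bar>F2 \<rho>\<bar> \<le> K * (1 + \<rho>) / \<rho>"
    and \<rho>: "\<rho> \<ge> 0" and d: "d \<ge> 0" and s: "s\<^sup>2 \<le> 4 * \<rho> * d"
  shows "\<bar>F (\<rho> + s + d) - F \<rho> - F1 \<rho> * s\<bar> \<le> 101 * K * (1 + \<rho> + d) * d"
proof -
  have K: "K \<ge> 0" using b1[of 1] by simp
  have "4 * \<rho> * d \<le> (\<rho> + d)\<^sup>2" using sum_squares_bound[of \<rho> d] by (simp add: power2_sum)
  then have "\<bar>s\<bar>\<^sup>2 \<le> (\<rho> + d)\<^sup>2" using s by simp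
  then have sb: "\<bar>s\<bar> \<le> \<rho> + d" by (rule power2_le_imp_le) (use \<rho> d in simp)
  show ?thesis
  proof (cases "\<rho> \<le> 16 * d")
    case True
    let ?L = "K * (1 + \<rho> + d)"
    have L: "?L \<ge> 0" using K \<rho> d by simp
    have "\<bar>F (\<rho> + s + d)\<bar> \<le> K * (\<rho> + s + d) * (1 + (\<rho> + s + d))" using sb by (intro b0) auto
    also have "\<dots> \<le> K * (34 * d) * (2 * (1 + \<rho> + d))"
      using sb True K \<rho> d by (intro mult_mono) auto
    also have "\<dots> = 68 * (?L * d)" by simp
    finally have 1: "\<bar>F (\<rho> + s + d)\<bar> \<le> 68 * (?L * d)" .
    have "\<bar>F \<rho>\<bar> \<le> K * \<rho> * (1 + \<rho>)" using \<rho> by (rule b0)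
    also have "\<dots> \<le> K * (16 * d) * (1 + \<rho> + d)"
      using True K \<rho> d by (intro mult_mono) auto
    also have "\<dots> = 16 * (?L * d)" by simp
    finally have 2: "\<bar>F \<rho>\<bar> \<le> 16 * (?L * d)" .
    have 3: "\<bar>F1 \<rho> * s\<bar> \<le> 17 * (?L * d)"
    \<comment> \<open>At zero density \<open>b1\<close> says nothing, but there the bound on
      \<open>s\<^sup>2\<close> forces \<open>s = 0\<close>.\<close>
    proof (cases "\<rho> = 0")
      case True
      then show ?thesis using s L d by simp
    next
      case False
      then have "\<bar>F1 \<rho>\<bar> * \<bar>s\<bar> \<le> (K * (1 + \<rho>)) * (17 * d)"
        using sb True \<rho> K by (intro mult_mono b1) auto
      also have "\<dots> \<le> ?L * (17 * d)" using K d by (intro mult_right_mono mult_left_mono) auto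
      finally show ?thesis by (simp add: abs_mult mult_ac)
    qed
    \<comment> \<open>The constant 101 is 68 + 16 + 17; the case of large density gets by with 36 +
      1.\<close>
    show ?thesis using 1 2 3 by linarith
  next
    case False
    then have \<rho>0: "\<rho> > 0" using d by simp
    \<comment> \<open>The threshold 16 is made for this step: it gives
      \<open>\<bar>s\<bar> \<le> \<rho> / 2\<close>, which keeps all intermediate points between
      \<open>\<rho> / 2\<close> and \<open>2 * \<rho>\<close>.\<close>
    have "4 * \<rho> * d \<le> 4 * \<rho> * (\<rho> / 16)" using False \<rho> by (intro mult_left_mono) auto
    then have "\<bar>s\<bar>\<^sup>2 \<le> (\<rho> / 2)\<^sup>2" using s by (simp add: power2_eq_square)
    then have s2: "\<bar>s\<bar> \<le> \<rho> / 2" by (rule power2_le_imp_le) (use \<rho> in simp)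
    define t where "t = s + d"
    obtain z where z: "min \<rho> (\<rho> + t) \<le> z" "z \<le> max \<rho> (\<rho> + t)" "F (\<rho> + t) - F \<rho> = (\<rho> + t - \<rho>) * F1 z"
      by (rule mean_value_between[of \<rho> "\<rho> + t" F F1]) (use s2 False d \<rho>0 in \<open>auto simp: t_def intro!: d1\<close>)
    have z2: "\<rho> / 2 \<le> z" "z \<le> 2 * \<rho>" using z(1,2) s2 False d by (auto simp: t_def)
    obtain y where y: "min \<rho> z \<le> y" "y \<le> max \<rho> z" "F1 z - F1 \<rho> = (z - \<rho>) * F2 y"
      by (rule mean_value_between[of \<rho> z F1 F2]) (use z2 \<rho>0 in \<open>auto intro!: d2\<close>)
    have y2: "\<rho> / 2 \<le> y" "y \<le> 2 * \<rho>" using y(1,2) z2 \<rho>0 by auto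
    have "F (\<rho> + t) - F \<rho> - F1 \<rho> * t = t * (F1 z - F1 \<rho>)"
      using z(3) by (simp add: algebra_simps)
    also have "\<dots> = t * (z - \<rho>) * F2 y"
      using y(3) by simp
    also have "\<bar>\<dots>\<bar> \<le> \<bar>t\<bar> * \<bar>t\<bar> * (K * (1 + 2 * \<rho>) / (\<rho> / 2))"
    proof -
      have "\<bar>F2 y\<bar> \<le> K * (1 + y) / y" using y2 \<rho>0 by (intro b2) auto
      also have "\<dots> \<le> K * (1 + 2 * \<rho>) / (\<rho> / 2)"
        using y2 \<rho>0 K by (intro frac_le mult_left_mono) auto
      finally have "\<bar>F2 y\<bar> \<le> K * (1 + 2 * \<rho>) / (\<rho> / 2)" .
      moreover have "\<bar>z - \<rho>\<bar> \<le> \<bar>t\<bar>" using z(1,2) by (auto simp: min_def max_def split: if_splits)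
      ultimately show ?thesis unfolding abs_mult by (intro mult_mono) auto
    qed
    \<comment> \<open>The square of \<open>t\<close> is at most
      \<open>2 * s\<^sup>2 + 2 * d\<^sup>2\<close>; the first part is at most
      \<open>8 * \<rho> * d\<close>, the second at most \<open>\<rho> * d / 8\<close>.\<close>
    also have "\<dots> \<le> (9 * \<rho> * d) * (4 * K * (1 + \<rho>) / \<rho>)"
    proof (rule mult_mono)
      have "t\<^sup>2 \<le> 2 * s\<^sup>2 + 2 * d\<^sup>2"
        using sum_squares_bound[of s d] by (simp add: t_def power2_sum)
      also have "d\<^sup>2 \<le> \<rho> / 16 * d"
        unfolding power2_eq_square using False d by (intro mult_right_mono) auto
      also have "2 * s\<^sup>2 + 2 * (\<rho> / 16 * d) \<le> 9 * \<rho> * d"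
      proof -
        have "0 \<le> \<rho> * d" using \<rho> d by simp
        then show ?thesis using s by simp
      qed
      finally show "\<bar>t\<bar> * \<bar>t\<bar> \<le> 9 * \<rho> * d" by (simp add: power2_eq_square)
      have "K * (1 + 2 * \<rho>) * 2 \<le> 4 * K * (1 + \<rho>)"
        using K \<rho>0 by (simp add: algebra_simps)
      then have "K * (1 + 2 * \<rho>) * 2 / \<rho> \<le> 4 * K * (1 + \<rho>) / \<rho>"
        using \<rho>0 by (intro divide_right_mono) auto
      then show "K * (1 + 2 * \<rho>) / (\<rho> / 2) \<le> 4 * K * (1 + \<rho>) / \<rho>" by simp
    qed (use K \<rho>0 d in auto)
    also have "\<dots> = 36 * (K * (1 + \<rho>) * d)" using \<rho>0 by simp
    finally have 1: "\<bar>F (\<rho> + t) - F \<rho> - F1 \<rho> * t\<bar> \<le> 36 * (K * (1 + \<rho>) * d)" .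
    have 2: "\<bar>F1 \<rho> * d\<bar> \<le> K * (1 + \<rho>) * d"
      using b1[OF \<rho>0] d by (simp add: abs_mult mult_right_mono)
    have "K * (1 + \<rho>) * d \<le> K * (1 + \<rho> + d) * d" using K d by (intro mult_right_mono mult_left_mono) auto
    moreover have "F (\<rho> + s + d) - F \<rho> - F1 \<rho> * s = (F (\<rho> + t) - F \<rho> - F1 \<rho> * t) + F1 \<rho> * d"
      by (simp add: t_def algebra_simps)
    moreover have "0 \<le> K * (1 + \<rho> + d) * d" using K \<rho> d by simp
    ultimately show ?thesis using 1 2 by linarith
  qed
qed

text \<open>In the variable \<open>t = ln \<rho>\<close> the derivatives of \<open>F \<rho> = \<rho> * e (ln \<rho>)\<close> are \<open>e + e'\<close> and \<open>(e' + e'') / \<rho>\<close>.\<close>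

lemma derivatives_log_variable:
  fixes F F1 F2 e e1 e2 :: "real \<Rightarrow> real"
  assumes I: "open I" "I \<subseteq> {0<..}" "\<rho> \<in> I"
    and F: "\<And>\<rho>. \<rho> \<in> I \<Longrightarrow> F \<rho> = \<rho> * e (ln \<rho>)"
    and d1: "\<And>\<rho>. \<rho> > 0 \<Longrightarrow> (F has_real_derivative F1 \<rho>) (at \<rho>)"
    and d2: "\<And>\<rho>. \<rho> > 0 \<Longrightarrow> (F1 has_real_derivative F2 \<rho>) (at \<rho>)"
    and e1: "\<And>t. (e has_real_derivative e1 t) (at t)"
    and e2: "\<And>t. (e1 has_real_derivative e2 t) (at t)"
  shows "F1 \<rho> = e (ln \<rho>) + e1 (ln \<rho>)" "F2 \<rho> = (e1 (ln \<rho>) + e2 (ln \<rho>)) / \<rho>"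
proof -
  have F1: "F1 x = e (ln x) + e1 (ln x)" if x: "x \<in> I" for x
  proof -
    have x0: "x > 0" using x I by auto
    have "((\<lambda>x. x * e (ln x)) has_real_derivative 1 * e (ln x) + e1 (ln x) * (1 / x) * x) (at x)"
      by (intro DERIV_mult DERIV_ident DERIV_chain2[OF e1] DERIV_ln_divide x0)
    then have "(F has_real_derivative 1 * e (ln x) + e1 (ln x) * (1 / x) * x) (at x)"
      by (rule has_field_derivative_transform_within_open[OF _ I(1) x]) (simp add: F)
    from DERIV_unique[OF d1[OF x0] this] x0 show ?thesis by simp
  qed
  show "F1 \<rho> = e (ln \<rho>) + e1 (ln \<rho>)" using I by (intro F1)
  have \<rho>0: "\<rho> > 0" using I by auto
  have "((\<lambda>x. e (ln x) + e1 (ln x)) has_real_derivative e1 (ln \<rho>) * (1 / \<rho>) + e2 (ln \<rho>) * (1 / \<rho>)) (at \<rho>)"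
    by (intro DERIV_add DERIV_chain2[OF e1] DERIV_chain2[OF e2] DERIV_ln_divide \<rho>0)
  then have "(F1 has_real_derivative e1 (ln \<rho>) * (1 / \<rho>) + e2 (ln \<rho>) * (1 / \<rho>)) (at \<rho>)"
    by (rule has_field_derivative_transform_within_open[OF _ I(1,3)]) (simp add: F1)
  from DERIV_unique[OF d2[OF \<rho>0] this] show "F2 \<rho> = (e1 (ln \<rho>) + e2 (ln \<rho>)) / \<rho>"
    by (simp add: add_divide_distrib)
qed

text \<open>Meant for the density where \<open>r\<^sub>s = 1\<close>. No open interval around it
  lies within one branch of the parametrization, so bounds are carried there by continuity.\<close>

lemma abs_le_at_point:
  fixes G B :: "real \<Rightarrow> real"
  assumes "isCont G a" "isCont B a" "a > 0" "\<And>x. \<lbrakk>x > 0; x \<noteq> a\<rbrakk> \<Longrightarrow> \<bar>G x\<bar> \<le> B x"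
  shows "\<bar>G a\<bar> \<le> B a"
proof (rule tendsto_le)
  show "((\<lambda>x. \<bar>G x\<bar>) \<longlongrightarrow> \<bar>G a\<bar>) (at a)" "(B \<longlongrightarrow> B a) (at a)"
    using assms(1,2) by (auto intro!: tendsto_intros simp: isCont_def)
  show "eventually (\<lambda>x. \<bar>G x\<bar> \<le> B x) (at a)"
    unfolding eventually_at using assms(3,4)
    by (intro exI[of _ a]) (auto simp: dist_real_def)
qed simp

section \<open>The exchange and correlation energies per particle in the logarithmic
  variable\<close>

lemma exp_third_le:
  fixes \<rho> :: real
  assumes "\<rho> > 0" shows "exp (ln \<rho> / 3) \<le> 1 + \<rho>"
proof (cases "\<rho> \<ge> 1")
  case True
  then have "exp (ln \<rho> / 3) \<le> exp (ln \<rho>)" by (subst exp_le_cancel_iff) simp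
  then show ?thesis using assms by simp
next
  case False
  then have "exp (ln \<rho> / 3) \<le> exp 0" using assms by (subst exp_le_cancel_iff) simp
  then show ?thesis using assms unfolding exp_zero by linarith
qed

text \<open>The logarithm of the Wigner-Seitz radius as a function of \<open>t = ln \<rho>\<close>; the threshold \<open>r\<^sub>s = 1\<close> is its zero.\<close>

definition log_ws :: "real \<Rightarrow> real" where "log_ws t = (ln (3 / (4 * pi)) - t) / 3"

lemma log_ws_DERIV: "(log_ws has_real_derivative - (1 / 3)) (at t)"
  unfolding log_ws_def[abs_def] by (auto intro!: derivative_eq_intros)

lemma wigner_seitz_eq: "\<rho> > 0 \<Longrightarrow> wigner_seitz \<rho> = exp (log_ws (ln \<rho>))"
  by (simp add: wigner_seitz_def powr_def log_ws_def ln_div ln_mult algebra_simps diff_divide_distrib)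

text \<open>\<open>eps_x\<close> in the variable \<open>t = ln \<rho>\<close>. Differentiation stays
  in the family.\<close>

definition e_exch :: "real \<Rightarrow> real \<Rightarrow> real" where
  "e_exch c t = - c * exp (t / 3)"

lemma e_exch_DERIV: "(e_exch c has_real_derivative e_exch (c / 3) t) (at t)"
  unfolding e_exch_def[abs_def] by (auto intro!: derivative_eq_intros)

text \<open>The branch \<open>r\<^sub>s \<ge> 1\<close> of \<open>eps_c\<close>, with the square
  root of \<open>r\<^sub>s\<close> written as an exponential.\<close>

definition e_low :: "real \<Rightarrow> real \<Rightarrow> real \<Rightarrow> real \<Rightarrow> real" where
  "e_low \<gamma> \<beta>1 \<beta>2 t = \<gamma> / (1 + \<beta>1 * exp (log_ws t / 2) + \<beta>2 * exp (log_ws t))"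

text \<open>The branch \<open>r\<^sub>s < 1\<close> of \<open>eps_c\<close>, where
  \<open>log_ws t\<close> is \<open>ln r\<^sub>s\<close>. With its four coefficients as parameters
  the family is closed under differentiation, so one growth bound also covers the
  derivatives.\<close>

definition e_high :: "real \<Rightarrow> real \<Rightarrow> real \<Rightarrow> real \<Rightarrow> real \<Rightarrow> real" where
  "e_high A B C D t = A * log_ws t + B + (C * log_ws t + D) * exp (log_ws t)"

lemma e_high_DERIV: "(e_high A B C D has_real_derivative e_high 0 (- A / 3) (- C / 3) (- (C + D) / 3) t) (at t)"
  unfolding e_high_def[abs_def]
  by (rule derivative_eq_intros log_ws_DERIV refl)+ (simp add: field_simps)

text \<open>For negative \<open>w = log_ws (ln \<rho>)\<close> both \<open>exp w\<close> and
  \<open>\<bar>w * exp w\<bar>\<close> are at most 1. What can grow is \<open>\<bar>w\<bar>\<close>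
  itself, and \<open>ln \<rho> \<le> \<rho> - 1\<close> keeps it linear in \<rho>.\<close>

lemma e_high_bound:
  assumes "\<rho> > 0" and w: "log_ws (ln \<rho>) < 0"
  shows "\<bar>e_high A B C D (ln \<rho>)\<bar> \<le> (\<bar>A\<bar> * (1 + \<bar>ln (3 / (4 * pi))\<bar>) + \<bar>B\<bar> + \<bar>C\<bar> + \<bar>D\<bar>) * (1 + \<rho>)"
proof -
  let ?w = "log_ws (ln \<rho>)" and ?k = "ln (3 / (4 * pi)) :: real"
  have "ln \<rho> \<le> \<rho> - 1" using assms by (simp add: ln_le_minus_one)
  moreover have "?w = (?k - ln \<rho>) / 3" by (simp only: log_ws_def)
  moreover have "\<bar>w\<bar> \<le> \<rho> + \<bar>k\<bar>" if "l \<le> \<rho> - 1" "w = (k - l) / 3" "w < 0" for l w k :: real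
    using that \<open>\<rho> > 0\<close> by (simp add: abs_if)
  ultimately have "\<bar>?w\<bar> \<le> \<rho> + \<bar>?k\<bar>" using w by blast
  also have "\<dots> \<le> (1 + \<bar>?k\<bar>) * (1 + \<rho>)" using \<open>\<rho> > 0\<close> by (simp add: algebra_simps)
  finally have 1: "\<bar>A * ?w\<bar> \<le> \<bar>A\<bar> * ((1 + \<bar>?k\<bar>) * (1 + \<rho>))"
    unfolding abs_mult by (intro mult_left_mono) auto
  have "- ?w \<le> exp (- ?w)" using exp_ge_add_one_self[of "- ?w"] by linarith
  then have "- ?w * exp ?w \<le> exp (- ?w) * exp ?w" by (intro mult_right_mono) auto
  then have "\<bar>?w * exp ?w\<bar> \<le> 1" using w by (simp add: abs_mult exp_minus)
  then have 2: "\<bar>C * (?w * exp ?w)\<bar> \<le> \<bar>C\<bar> * 1" unfolding abs_mult[of C] by (intro mult_left_mono) auto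
  have 3: "\<bar>D * exp ?w\<bar> \<le> \<bar>D\<bar> * 1" unfolding abs_mult[of D] using w by (intro mult_left_mono) auto
  have "\<bar>e_high A B C D (ln \<rho>)\<bar> = \<bar>A * ?w + B + C * (?w * exp ?w) + D * exp ?w\<bar>"
    by (simp add: e_high_def algebra_simps)
  also have "\<dots> \<le> \<bar>A\<bar> * ((1 + \<bar>?k\<bar>) * (1 + \<rho>)) + (\<bar>B\<bar> + \<bar>C\<bar> + \<bar>D\<bar>)"
    using 1 2 3 by linarith
  also have "\<dots> \<le> \<bar>A\<bar> * ((1 + \<bar>?k\<bar>) * (1 + \<rho>)) + (\<bar>B\<bar> + \<bar>C\<bar> + \<bar>D\<bar>) * (1 + \<rho>)"
    using \<open>\<rho> > 0\<close> by (intro add_left_mono) (simp add: mult_le_cancel_left1)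
  finally show ?thesis by (simp add: algebra_simps)
qed

text \<open>Differentiating the denominator \<open>N\<close> multiplies its positive exponential
  terms by constants of modulus below one, so \<open>N1\<close> and \<open>N2\<close> are dominated
  by \<open>N\<close>, and \<open>q = N1 / N\<close> by 1. The factor 3 counts the three products in
  the second derivative.\<close>

lemma e_low_derivatives:
  assumes \<beta>: "\<beta>1 > 0" "\<beta>2 > 0"
  obtains e1 e2 where "\<And>t. (e_low \<gamma> \<beta>1 \<beta>2 has_real_derivative e1 t) (at t)"
    "\<And>t. (e1 has_real_derivative e2 t) (at t)"
    "\<And>t. \<bar>e_low \<gamma> \<beta>1 \<beta>2 t\<bar> \<le> \<bar>\<gamma>\<bar>" "\<And>t. \<bar>e1 t\<bar> \<le> \<bar>\<gamma>\<bar>" "\<And>t. \<bar>e2 t\<bar> \<le> 3 * \<bar>\<gamma>\<bar>"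
proof -
  define Q where "Q a c t = a * exp (log_ws t / 2) + c * exp (log_ws t)" for a c t
  have dQ: "(Q a c has_real_derivative Q (- a / 6) (- c / 3) t) (at t)" for a c t
  proof -
    have 1: "((\<lambda>t. exp (log_ws t / 2)) has_real_derivative exp (log_ws t / 2) * (- (1 / 3) / 2)) (at t)"
      by (intro DERIV_chain2[OF DERIV_exp] DERIV_cdivide log_ws_DERIV)
    have 2: "((\<lambda>t. exp (log_ws t)) has_real_derivative exp (log_ws t) * - (1 / 3)) (at t)"
      by (intro DERIV_chain2[OF DERIV_exp] log_ws_DERIV)
    show ?thesis
      unfolding Q_def[abs_def] using DERIV_add[OF DERIV_cmult[OF 1, of a] DERIV_cmult[OF 2, of c]] by simp
  qed
  define N where "N t = 1 + Q \<beta>1 \<beta>2 t" for t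
  define N1 where "N1 = Q (- \<beta>1 / 6) (- \<beta>2 / 3)"
  define N2 where "N2 = Q (\<beta>1 / 36) (\<beta>2 / 9)"
  have dN: "(N has_real_derivative N1 t) (at t)" for t
    unfolding N_def[abs_def] N1_def using DERIV_add[OF DERIV_const dQ] by simp
  have dN1: "(N1 has_real_derivative N2 t) (at t)" for t
    using dQ[of "- \<beta>1 / 6" "- \<beta>2 / 3"] by (simp add: N1_def N2_def)
  have N1: "N t \<ge> 1" "\<bar>N1 t\<bar> \<le> N t" "\<bar>N2 t\<bar> \<le> N t" for t
  proof -
    have p: "\<beta>1 * exp (log_ws t / 2) > 0" "\<beta>2 * exp (log_ws t) > 0" using \<beta> by auto
    show "N t \<ge> 1" "\<bar>N1 t\<bar> \<le> N t" "\<bar>N2 t\<bar> \<le> N t" using p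
      by (simp_all add: N_def N1_def N2_def Q_def)
  qed
  have N0: "N t > 0" for t using N1(1)[of t] by linarith
  have e: "e_low \<gamma> \<beta>1 \<beta>2 = (\<lambda>t. \<gamma> * inverse (N t))"
    by (rule ext) (simp only: e_low_def N_def Q_def divide_inverse add.assoc)
  define q where "q t = N1 t / N t" for t
  have inv: "((\<lambda>t. inverse (N t)) has_real_derivative - (q t * inverse (N t))) (at t)" for t
    using DERIV_inverse_fun[OF dN, of t] N0[of t] by (simp add: q_def divide_inverse power2_eq_square mult_ac)
  have dq: "(q has_real_derivative (N2 t / N t - q t * q t)) (at t)" for t
    unfolding q_def[abs_def] using DERIV_divide[OF dN1 dN, of t] N0[of t]
    by (simp add: q_def diff_divide_distrib power2_eq_square)
  have inv_b: "0 < inverse (N t)" "inverse (N t) \<le> 1" "\<bar>q t\<bar> \<le> 1" "\<bar>N2 t / N t\<bar> \<le> 1" for t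
    using N0[of t] N1[of t] by (auto simp: q_def abs_divide divide_le_eq_1 inverse_le_1_iff)
  show thesis
  proof
    show "(e_low \<gamma> \<beta>1 \<beta>2 has_real_derivative \<gamma> * - (q t * inverse (N t))) (at t)" for t
      unfolding e by (intro DERIV_cmult inv)
    show "((\<lambda>t. \<gamma> * - (q t * inverse (N t))) has_real_derivative
        \<gamma> * - ((N2 t / N t - q t * q t) * inverse (N t) + - (q t * inverse (N t)) * q t)) (at t)" for t
      by (intro DERIV_cmult DERIV_minus DERIV_mult inv dq)
    have m: "\<bar>\<gamma> * x\<bar> \<le> \<bar>\<gamma>\<bar> * c" if "\<bar>x\<bar> \<le> c" for x c
      unfolding abs_mult using that by (intro mult_left_mono) auto
    have p: "\<bar>x * y\<bar> \<le> 1" if "\<bar>x\<bar> \<le> 1" "\<bar>y\<bar> \<le> 1" for x y :: real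
      unfolding abs_mult using that by (intro mult_le_one) auto
    have ib: "\<bar>inverse (N t)\<bar> \<le> 1" for t using inv_b[of t] by simp
    show "\<bar>e_low \<gamma> \<beta>1 \<beta>2 t\<bar> \<le> \<bar>\<gamma>\<bar>" for t
      unfolding e using m[OF ib] by simp
    show "\<bar>\<gamma> * - (q t * inverse (N t))\<bar> \<le> \<bar>\<gamma>\<bar>" for t
      using m[of "- (q t * inverse (N t))" 1] p[OF inv_b(3) ib] by (simp only: abs_minus mult_1_right)
    show "\<bar>\<gamma> * - ((N2 t / N t - q t * q t) * inverse (N t) + - (q t * inverse (N t)) * q t)\<bar> \<le> 3 * \<bar>\<gamma>\<bar>" for t
    proof -
      have "\<bar>N2 t / N t * inverse (N t)\<bar> \<le> 1" "\<bar>q t * q t * inverse (N t)\<bar> \<le> 1" "\<bar>q t * inverse (N t) * q t\<bar> \<le> 1"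
        by (intro p inv_b ib)+
      then have "\<bar>- ((N2 t / N t - q t * q t) * inverse (N t) + - (q t * inverse (N t)) * q t)\<bar> \<le> 3"
        unfolding left_diff_distrib mult_minus_left by linarith
      from m[OF this] show ?thesis by (simp only: mult.commute)
    qed
  qed
qed

lemma xc_energy_zero: "xc_energy \<gamma> \<beta>1 \<beta>2 A B C D 0 = 0"
  by (simp add: xc_energy_def)

text \<open>On either side of the density \<open>a\<close> with \<open>r\<^sub>s = 1\<close> one
  branch formula holds on an open set and can be differentiated. At \<open>a\<close> the bounds
  follow by continuity of the first two derivatives, which \<open>Ck_on 2\<close> supplies.\<close>

lemma xc_energy_bounds:
  assumes \<beta>: "\<beta>1 > 0" "\<beta>2 > 0" and F: "F = xc_energy \<gamma> \<beta>1 \<beta>2 A B C D" and C2: "Ck_on 2 {0<..} F"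
  shows "\<exists>F2 K. (\<forall>\<rho>>0. (F has_real_derivative deriv F \<rho>) (at \<rho>) \<and> (deriv F has_real_derivative F2 \<rho>) (at \<rho>) \<and>
      \<bar>deriv F \<rho>\<bar> \<le> K * (1 + \<rho>) \<and> \<bar>F2 \<rho>\<bar> \<le> K * (1 + \<rho>) / \<rho>) \<and> (\<forall>\<rho>\<ge>0. \<bar>F \<rho>\<bar> \<le> K * \<rho> * (1 + \<rho>))"
proof -
  have der: "(f has_real_derivative frechet_derivative f (at x) 1) (at x)"
    if "f differentiable_on {0<..}" "x > 0" for f :: "real \<Rightarrow> real" and x
  proof -
    have "f differentiable (at x)" using that by (simp add: differentiable_on_eq_differentiable_at)
    then have d: "(f has_derivative frechet_derivative f (at x)) (at x)" by (simp add: frechet_derivative_works)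
    have "frechet_derivative f (at x) h = frechet_derivative f (at x) 1 * h" for h
      using linear_scale[OF has_derivative_linear[OF d], of h 1] by simp
    then show ?thesis using d by (metis ext has_field_derivative_def)
  qed
  define F1 where "F1 x = frechet_derivative F (at x) 1" for x
  define F2 where "F2 x = frechet_derivative F1 (at x) 1" for x
  have C2': "F differentiable_on {0<..}" "F1 differentiable_on {0<..}" "continuous_on {0<..} F2"
    using C2 by (simp_all add: numeral_2_eq_2 F1_def[abs_def] F2_def[abs_def])
  have d1: "(F has_real_derivative F1 \<rho>) (at \<rho>)" if "\<rho> > 0" for \<rho>
    unfolding F1_def using der[OF C2'(1) that] .
  have d2: "(F1 has_real_derivative F2 \<rho>) (at \<rho>)" if "\<rho> > 0" for \<rho>
    unfolding F2_def using der[OF C2'(2) that] .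
  define cx where "cx = (3/4) * (3 / pi) powr (1/3)"
  have cx: "cx > 0" by (simp add: cx_def)
  obtain l1 l2 where l: "\<And>t. (e_low \<gamma> \<beta>1 \<beta>2 has_real_derivative l1 t) (at t)"
    "\<And>t. (l1 has_real_derivative l2 t) (at t)"
    "\<And>t. \<bar>e_low \<gamma> \<beta>1 \<beta>2 t\<bar> \<le> \<bar>\<gamma>\<bar>" "\<And>t. \<bar>l1 t\<bar> \<le> \<bar>\<gamma>\<bar>" "\<And>t. \<bar>l2 t\<bar> \<le> 3 * \<bar>\<gamma>\<bar>"
    using e_low_derivatives[OF \<beta>] by blast
  define a where "a = (3 / (4 * pi) :: real)"
  have a: "a > 0" by (simp add: a_def)
  define h0 where "h0 = e_high A B C D"
  define h1 where "h1 = e_high 0 (- A / 3) (- C / 3) (- (C + D) / 3)"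
  define h2 where "h2 = e_high 0 0 (C / 9) ((2 * C + D) / 9)"
  have h: "(h0 has_real_derivative h1 t) (at t)" "(h1 has_real_derivative h2 t) (at t)" for t
  proof -
    have "e_high 0 (- 0 / 3) (- (- C / 3) / 3) (- (- C / 3 + - (C + D) / 3) / 3) = h2"
      by (rule ext) (simp add: e_high_def h2_def field_simps)
    then show "(h0 has_real_derivative h1 t) (at t)" "(h1 has_real_derivative h2 t) (at t)"
      using e_high_DERIV[of A B C D t] e_high_DERIV[of 0 "- A / 3" "- C / 3" "- (C + D) / 3" t]
      by (simp_all only: h0_def h1_def)
  qed
  obtain H where H: "\<And>\<rho>. \<lbrakk>\<rho> > 0; log_ws (ln \<rho>) < 0\<rbrakk> \<Longrightarrow> \<bar>h0 (ln \<rho>)\<bar> \<le> H * (1 + \<rho>)"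
    "\<And>\<rho>. \<lbrakk>\<rho> > 0; log_ws (ln \<rho>) < 0\<rbrakk> \<Longrightarrow> \<bar>h1 (ln \<rho>)\<bar> \<le> H * (1 + \<rho>)"
    "\<And>\<rho>. \<lbrakk>\<rho> > 0; log_ws (ln \<rho>) < 0\<rbrakk> \<Longrightarrow> \<bar>h2 (ln \<rho>)\<bar> \<le> H * (1 + \<rho>)" "H \<ge> 0"
  proof -
    define b where "b A B C D = \<bar>A\<bar> * (1 + \<bar>ln (3 / (4 * pi))\<bar>) + \<bar>B\<bar> + \<bar>C\<bar> + \<bar>D\<bar>" for A B C D :: real
    have b: "b A B C D \<ge> 0" for A B C D by (simp add: b_def)
    define H where "H = b A B C D + b 0 (- A / 3) (- C / 3) (- (C + D) / 3) + b 0 0 (C / 9) ((2 * C + D) / 9)"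
    have *: "\<bar>e_high A' B' C' D' (ln \<rho>)\<bar> \<le> H * (1 + \<rho>)"
      if "\<rho> > 0" "log_ws (ln \<rho>) < 0" "b A' B' C' D' \<le> H" for A' B' C' D' \<rho>
    proof -
      have "\<bar>e_high A' B' C' D' (ln \<rho>)\<bar> \<le> b A' B' C' D' * (1 + \<rho>)"
        unfolding b_def using that by (intro e_high_bound)
      also have "\<dots> \<le> H * (1 + \<rho>)" using that by (intro mult_right_mono) auto
      finally show ?thesis .
    qed
    show thesis
      by (rule that[of H]; (unfold h0_def h1_def h2_def)?; (rule *)?)
        (use b[of A B C D] b[of 0 "- A / 3" "- C / 3" "- (C + D) / 3"] b[of 0 0 "C / 9" "(2 * C + D) / 9"] in \<open>auto simp: H_def\<close>)
  qed
  define c where "c = 3 * \<bar>\<gamma>\<bar>"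
  \<comment> \<open>The factor 2 arises because \<open>F1 \<rho>\<close> and
    \<open>\<rho> * F2 \<rho>\<close> are sums of two terms, each with an exchange part and a part
    from one correlation branch.\<close>
  define K where "K = 2 * (cx + c + H)"
  have eps_x: "eps_x \<rho> = e_exch cx (ln \<rho>)" if "\<rho> > 0" for \<rho>
    using that by (simp add: eps_x_def e_exch_def cx_def powr_def)
  have F_low: "F \<rho> = \<rho> * (e_exch cx (ln \<rho>) + e_low \<gamma> \<beta>1 \<beta>2 (ln \<rho>))" if "\<rho> > 0" "log_ws (ln \<rho>) \<ge> 0" for \<rho>
  proof -
    have sq: "sqrt (exp w) = exp (w / 2)" for w :: real
      by (rule real_sqrt_unique) (simp_all add: power2_eq_square exp_add[symmetric])
    show ?thesis using that
      by (simp add: F xc_energy_def eps_x eps_c_def wigner_seitz_eq e_low_def sq Let_def)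
  qed
  have F_high: "F \<rho> = \<rho> * (e_exch cx (ln \<rho>) + h0 (ln \<rho>))" if "\<rho> > 0" "log_ws (ln \<rho>) < 0" for \<rho>
    using that
    by (simp add: F xc_energy_def eps_x eps_c_def wigner_seitz_eq h0_def e_high_def Let_def algebra_simps)
  have log_ws: "log_ws (ln \<rho>) < 0 \<longleftrightarrow> \<rho> > a" "log_ws (ln \<rho>) > 0 \<longleftrightarrow> \<rho> < a" if "\<rho> > 0" for \<rho>
    using that a by (auto simp: log_ws_def a_def[symmetric])
  have ex: "\<bar>e_exch c' (ln \<rho>)\<bar> \<le> cx * (1 + \<rho>)" if "\<rho> > 0" "0 \<le> c'" "c' \<le> cx" for \<rho> c'
  proof -
    have "\<bar>e_exch c' (ln \<rho>)\<bar> = c' * exp (ln \<rho> / 3)" using that by (simp add: e_exch_def abs_mult)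
    also have "\<dots> \<le> cx * (1 + \<rho>)" using that by (intro mult_mono exp_third_le) auto
    finally show ?thesis .
  qed
  have gl: "\<bar>e_low \<gamma> \<beta>1 \<beta>2 t\<bar> \<le> c * (1 + \<rho>)" "\<bar>l1 t\<bar> \<le> c * (1 + \<rho>)" "\<bar>l2 t\<bar> \<le> c * (1 + \<rho>)" if "\<rho> > 0" for t \<rho>
  proof -
    have "c * 1 \<le> c * (1 + \<rho>)" using that by (intro mult_left_mono) (auto simp: c_def)
    moreover have "\<bar>\<gamma>\<bar> \<le> c" by (simp add: c_def)
    ultimately show "\<bar>e_low \<gamma> \<beta>1 \<beta>2 t\<bar> \<le> c * (1 + \<rho>)" "\<bar>l1 t\<bar> \<le> c * (1 + \<rho>)" "\<bar>l2 t\<bar> \<le> c * (1 + \<rho>)"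
      using l(3)[of t] l(4)[of t] l(5)[of t] unfolding c_def[symmetric] by simp_all
  qed
  have Hn: "0 \<le> H * (1 + \<rho>)" "0 \<le> c * (1 + \<rho>)" "0 \<le> cx * (1 + \<rho>)" if "\<rho> > 0" for \<rho>
    using H(4) cx that by (simp_all add: c_def)
  have K_eq: "K * (1 + \<rho>) = 2 * (cx * (1 + \<rho>)) + 2 * (c * (1 + \<rho>)) + 2 * (H * (1 + \<rho>))" for \<rho>
    by (simp add: K_def algebra_simps)
  have tri: "\<bar>x + y\<bar> \<le> p + q" if "\<bar>x\<bar> \<le> p" "\<bar>y\<bar> \<le> q" for x y p q :: real
    using that by linarith
  have K_low: "cx * (1 + \<rho>) + c * (1 + \<rho>) + (cx * (1 + \<rho>) + c * (1 + \<rho>)) \<le> K * (1 + \<rho>)"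
    and K_high: "cx * (1 + \<rho>) + H * (1 + \<rho>) + (cx * (1 + \<rho>) + H * (1 + \<rho>)) \<le> K * (1 + \<rho>)"
    and K_low1: "cx * (1 + \<rho>) + c * (1 + \<rho>) \<le> K * (1 + \<rho>)"
    and K_high1: "cx * (1 + \<rho>) + H * (1 + \<rho>) \<le> K * (1 + \<rho>)" if "\<rho> > 0" for \<rho>
    using K_eq[of \<rho>] Hn[OF that] by linarith+
  have cx3: "0 \<le> cx / 3" "cx / 3 \<le> cx" "0 \<le> cx / 3 / 3" "cx / 3 / 3 \<le> cx" using cx by auto
  have main: "\<bar>F1 \<rho>\<bar> \<le> K * (1 + \<rho>) \<and> \<bar>F2 \<rho>\<bar> \<le> K * (1 + \<rho>) / \<rho>" if \<rho>: "\<rho> > 0" "\<rho> \<noteq> a" for \<rho>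
  proof -
    note ex3 = ex[OF \<rho>(1) less_imp_le[OF cx] order_refl] ex[OF \<rho>(1) cx3(1,2)] ex[OF \<rho>(1) cx3(3,4)]
    \<comment> \<open>These are the energy per particle and its first two derivatives with respect
      to \<open>ln \<rho>\<close>, taken from the branch valid near \<rho>.\<close>
    obtain E0 E1 E2 where E: "F1 \<rho> = E0 + E1" "F2 \<rho> = (E1 + E2) / \<rho>"
      "\<bar>E0\<bar> + \<bar>E1\<bar> \<le> K * (1 + \<rho>)" "\<bar>E1\<bar> + \<bar>E2\<bar> \<le> K * (1 + \<rho>)"
    proof (cases "\<rho> < a")
      case True
      have I: "open {0<..<a}" "{0<..<a} \<subseteq> {0<..}" "\<rho> \<in> {0<..<a}" using True \<rho> by auto
      have F': "F r = r * (e_exch cx (ln r) + e_low \<gamma> \<beta>1 \<beta>2 (ln r))" if "r \<in> {0<..<a}" for r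
        using that log_ws(2)[of r] by (intro F_low) auto
      note D = derivatives_log_variable[where F=F and ?F1.0=F1 and ?F2.0=F2 and I="{0<..<a}" and \<rho>=\<rho>
          and e="\<lambda>t. e_exch cx t + e_low \<gamma> \<beta>1 \<beta>2 t" and ?e1.0="\<lambda>t. e_exch (cx/3) t + l1 t"
          and ?e2.0="\<lambda>t. e_exch (cx/3/3) t + l2 t", OF I F' d1 d2
          DERIV_add[OF e_exch_DERIV l(1)] DERIV_add[OF e_exch_DERIV l(2)]]
      note b = tri[OF ex3(1) gl(1)[OF \<rho>(1), of "ln \<rho>"]] tri[OF ex3(2) gl(2)[OF \<rho>(1), of "ln \<rho>"]]
        tri[OF ex3(3) gl(3)[OF \<rho>(1), of "ln \<rho>"]]
      show thesis
        by (rule that[OF D order_trans[OF add_mono[OF b(1,2)] K_low[OF \<rho>(1)]] order_trans[OF add_mono[OF b(2,3)] K_low[OF \<rho>(1)]]])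
    next
      case False
      then have \<rho>a: "\<rho> > a" using \<rho> by simp
      have I: "open {a<..}" "{a<..} \<subseteq> {0<..}" "\<rho> \<in> {a<..}" using \<rho>a a by auto
      have F': "F r = r * (e_exch cx (ln r) + h0 (ln r))" if "r \<in> {a<..}" for r
        using that log_ws(1)[of r] a by (intro F_high) auto
      note D = derivatives_log_variable[where F=F and ?F1.0=F1 and ?F2.0=F2 and I="{a<..}" and \<rho>=\<rho>
          and e="\<lambda>t. e_exch cx t + h0 t" and ?e1.0="\<lambda>t. e_exch (cx/3) t + h1 t"
          and ?e2.0="\<lambda>t. e_exch (cx/3/3) t + h2 t", OF I F' d1 d2
          DERIV_add[OF e_exch_DERIV h(1)] DERIV_add[OF e_exch_DERIV h(2)]]
      have w: "log_ws (ln \<rho>) < 0" using log_ws \<rho> \<rho>a by simp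
      note b = tri[OF ex3(1) H(1)[OF \<rho>(1) w]] tri[OF ex3(2) H(2)[OF \<rho>(1) w]] tri[OF ex3(3) H(3)[OF \<rho>(1) w]]
      show thesis
        by (rule that[OF D order_trans[OF add_mono[OF b(1,2)] K_high[OF \<rho>(1)]] order_trans[OF add_mono[OF b(2,3)] K_high[OF \<rho>(1)]]])
    qed
    have "\<bar>E1 + E2\<bar> / \<rho> \<le> K * (1 + \<rho>) / \<rho>" using E(4) \<rho> by (intro divide_right_mono) auto
    then show ?thesis using E \<rho> by (auto simp: abs_divide)
  qed
  have F1a: "\<bar>F1 a\<bar> \<le> K * (1 + a)"
    by (rule abs_le_at_point[where B="\<lambda>\<rho>. K * (1 + \<rho>)"])
      (use a main d2 in \<open>auto intro!: continuous_intros DERIV_isCont\<close>)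
  have F2a: "\<bar>F2 a\<bar> \<le> K * (1 + a) / a"
  proof (rule abs_le_at_point[where B="\<lambda>\<rho>. K * (1 + \<rho>) / \<rho>"])
    show "isCont F2 a" using C2'(3) a by (simp add: continuous_on_eq_continuous_at)
  qed (use a main in \<open>auto intro!: continuous_intros\<close>)
  have dF: "deriv F \<rho> = F1 \<rho>" if "\<rho> > 0" for \<rho> using d1[OF that] by (rule DERIV_imp_deriv)
  show ?thesis
  proof (intro exI[of _ F2] exI[of _ K] conjI allI impI)
    show "(F has_real_derivative deriv F \<rho>) (at \<rho>)" if "\<rho> > 0" for \<rho> using d1[OF that] dF[OF that] by simp
    show "(deriv F has_real_derivative F2 \<rho>) (at \<rho>)" if "\<rho> > 0" for \<rho>
      by (rule has_field_derivative_transform_within_open[OF d2[OF that], of "{0<..}"]) (use that dF in auto)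
    show "\<bar>deriv F \<rho>\<bar> \<le> K * (1 + \<rho>)" if "\<rho> > 0" for \<rho> using main[OF that] F1a dF[OF that] by (cases "\<rho> = a") auto
    show "\<bar>F2 \<rho>\<bar> \<le> K * (1 + \<rho>) / \<rho>" if "\<rho> > 0" for \<rho> using main[OF that] F2a by (cases "\<rho> = a") auto
    show "\<bar>F \<rho>\<bar> \<le> K * \<rho> * (1 + \<rho>)" if "\<rho> \<ge> 0" for \<rho>
    proof (cases "\<rho> = 0")
      case True
      then show ?thesis by (simp add: F xc_energy_zero)
    next
      case False
      then have \<rho>: "\<rho> > 0" using that by simp
      note ex1 = ex[OF \<rho> less_imp_le[OF cx] order_refl]
      obtain E where E: "F \<rho> = \<rho> * E" "\<bar>E\<bar> \<le> K * (1 + \<rho>)"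
      proof (cases "log_ws (ln \<rho>) \<ge> 0")
        case True
        show thesis
          by (rule that[OF F_low[OF \<rho> True] order_trans[OF tri[OF ex1 gl(1)[OF \<rho>]] K_low1[OF \<rho>]]])
      next
        case False
        then have w: "log_ws (ln \<rho>) < 0" by simp
        show thesis
          by (rule that[OF F_high[OF \<rho> w] order_trans[OF tri[OF ex1 H(1)[OF \<rho> w]] K_high1[OF \<rho>]]])
      qed
      have "\<bar>F \<rho>\<bar> = \<rho> * \<bar>E\<bar>" using E \<rho> by (simp add: abs_mult)
      also have "\<dots> \<le> \<rho> * (K * (1 + \<rho>))" using E \<rho> by (intro mult_left_mono) auto
      finally show ?thesis by (simp add: mult_ac)
    qed
  qed
qed

section \<open>Embedding into \<open>L\<^sup>4\<close>\<close>

lemma smooth_on_diff: "\<lbrakk>smooth_on UNIV f; smooth_on UNIV g\<rbrakk> \<Longrightarrow> smooth_on UNIV (\<lambda>x. f x - g x)"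
  by (simp add: smooth_on_def Ck_on_diff)

lemma test_functions_diff:
  assumes "\<eta> \<in> test_functions \<Omega>" "\<zeta> \<in> test_functions \<Omega>"
  shows "(\<lambda>x. \<eta> x - \<zeta> x) \<in> test_functions \<Omega>"
proof -
  have sub: "closure {x. \<eta> x - \<zeta> x \<noteq> 0} \<subseteq> closure {x. \<eta> x \<noteq> 0} \<union> closure {x. \<zeta> x \<noteq> 0}"
    unfolding closure_Un[symmetric] by (rule closure_mono) auto
  have cpt: "compact (closure {x. \<eta> x \<noteq> 0} \<union> closure {x. \<zeta> x \<noteq> 0})"
    using assms by (auto simp: test_functions_def)
  have "compact (closure {x. \<eta> x - \<zeta> x \<noteq> 0})"
    using bounded_subset[OF compact_imp_bounded[OF cpt] sub] by (simp add: compact_eq_bounded_closed)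
  then show ?thesis
    using assms sub by (auto simp: test_functions_def smooth_on_diff)
qed

lemma smooth_periodic_diff:
  "\<lbrakk>\<eta> \<in> smooth_periodic A; \<zeta> \<in> smooth_periodic A\<rbrakk> \<Longrightarrow> (\<lambda>x. \<eta> x - \<zeta> x) \<in> smooth_periodic A"
  by (simp add: smooth_periodic_def smooth_on_diff)

context bounded_domain
begin

lemma smooth_H1_norm_nn_integral:
  assumes "smooth_on UNIV \<eta>"
  shows "(\<integral>\<^sup>+x. ennreal ((\<eta> x)\<^sup>2 + (norm (gradient \<eta> x))\<^sup>2) \<partial>M) = ennreal ((H1_norm \<Omega> \<eta>)\<^sup>2)"
proof -
  note d = smooth_gradient[OF assms]
  have c: "continuous_on UNIV \<eta>"
    by (rule has_derivative_continuous_on) (rule d(1))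
  note sq = continuous_square_integrable[OF c] continuous_square_integrable[OF d(2)]
  have semi: "H1_seminorm \<Omega> \<eta> = L2_norm \<Omega> (gradient \<eta>)"
    unfolding H1_seminorm_def
    by (intro L2_norm_cong_AE smooth_H1[OF assms] H1_wgrad(2) sq)
  have "(\<integral>\<^sup>+x. ennreal ((\<eta> x)\<^sup>2 + (norm (gradient \<eta> x))\<^sup>2) \<partial>M) = ennreal (\<integral>x. (\<eta> x)\<^sup>2 + (norm (gradient \<eta> x))\<^sup>2 \<partial>M)"
    using sq by (intro nn_integral_eq_integral) (auto simp: square_integrable_iff)
  also have "(\<integral>x. (\<eta> x)\<^sup>2 + (norm (gradient \<eta> x))\<^sup>2 \<partial>M) = (H1_norm \<Omega> \<eta>)\<^sup>2"
    using sq by (simp add: H1_norm_sq semi L2_norm_sq square_integrable_iff)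
  finally show ?thesis .
qed

text \<open>Approximants in the H1 norm converge in L2, hence almost everywhere along a subsequence.
  Fatou's lemma then transfers the bound without any convergence in L4.\<close>

lemma H1_closure_L4_bound:
  assumes S: "\<And>\<eta>. \<eta> \<in> S \<Longrightarrow> smooth_on UNIV \<eta>" and "K \<ge> 0"
    and emb: "\<And>\<eta>. \<eta> \<in> S \<Longrightarrow> (\<integral>\<^sup>+x. ennreal ((\<eta> x)^4) \<partial>M) \<le> ennreal K * (\<integral>\<^sup>+x. ennreal ((\<eta> x)\<^sup>2 + (norm (gradient \<eta> x))\<^sup>2) \<partial>M)\<^sup>2"
    and u: "u \<in> H1_closure \<Omega> S"
  shows "(\<integral>\<^sup>+x. ennreal ((u x)^4) \<partial>M) \<le> ennreal (K * (H1_norm \<Omega> u)^4)"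
proof -
  have uH: "u \<in> H1 \<Omega>" using u by (simp add: H1_closure_def)
  have "\<exists>\<eta>\<in>S. H1_norm \<Omega> (\<lambda>x. u x - \<eta> x) < inverse (real (Suc n))" for n
    using u by (simp add: H1_closure_def)
  then obtain \<eta> where \<eta>: "\<And>n. \<eta> n \<in> S" "\<And>n. H1_norm \<Omega> (\<lambda>x. u x - \<eta> n x) < inverse (real (Suc n))"
    by metis
  have \<eta>H: "\<eta> n \<in> H1 \<Omega>" for n using smooth_H1(1)[OF S[OF \<eta>(1)]] .
  note sqd = H1_wgrad(1)[OF H1_diff(1)[OF uH \<eta>H]]
  have [measurable]: "\<eta> n \<in> borel_measurable M" "u \<in> borel_measurable M" for n
    using H1_wgrad(1)[OF \<eta>H] H1_wgrad(1)[OF uH] by (auto dest: square_integrable_measurable)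
  have "(\<lambda>n. \<integral>x. norm ((u x - \<eta> n x)\<^sup>2) \<partial>M) \<longlonglongrightarrow> 0"
  proof (rule tendsto_sandwich[OF _ _ tendsto_const])
    show "(\<lambda>n. (inverse (real (Suc n)))\<^sup>2) \<longlonglongrightarrow> 0"
      using tendsto_power[OF LIMSEQ_inverse_real_of_nat, of 2] by simp
    show "\<forall>\<^sub>F n in sequentially. (\<integral>x. norm ((u x - \<eta> n x)\<^sup>2) \<partial>M) \<le> (inverse (real (Suc n)))\<^sup>2"
    proof (intro always_eventually allI)
      fix n
      have "(\<integral>x. norm ((u x - \<eta> n x)\<^sup>2) \<partial>M) = (L2_norm \<Omega> (\<lambda>x. u x - \<eta> n x))\<^sup>2"
        by (simp add: L2_norm_sq)
      also have "\<dots> \<le> (inverse (real (Suc n)))\<^sup>2"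
        using L2_norm_le_H1_norm[of "\<lambda>x. u x - \<eta> n x"] \<eta>(2)[of n]
        by (intro power_mono L2_norm_nonneg) linarith
      finally show "(\<integral>x. norm ((u x - \<eta> n x)\<^sup>2) \<partial>M) \<le> (inverse (real (Suc n)))\<^sup>2" .
    qed
  qed simp
  moreover have "integrable M (\<lambda>x. (u x - \<eta> n x)\<^sup>2)" for n
    using sqd[of n] by (simp add: square_integrable_iff)
  ultimately obtain r where r: "strict_mono r" "AE x in M. (\<lambda>n. (u x - \<eta> (r n) x)\<^sup>2) \<longlonglongrightarrow> 0"
    using tendsto_L1_AE_subseq[of M "\<lambda>n x. (u x - \<eta> n x)\<^sup>2"] by auto
  have conv: "AE x in M. ennreal ((u x)^4) = liminf (\<lambda>n. ennreal ((\<eta> (r n) x)^4))"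
    using r(2)
  proof eventually_elim
    case (elim x)
    have "(\<lambda>n. sqrt ((u x - \<eta> (r n) x)\<^sup>2)) \<longlonglongrightarrow> sqrt 0"
      by (intro tendsto_real_sqrt elim)
    then have "(\<lambda>n. u x - \<eta> (r n) x) \<longlonglongrightarrow> 0"
      by (simp add: tendsto_rabs_zero_iff)
    from tendsto_diff[OF tendsto_const this, of "u x"] have "(\<lambda>n. \<eta> (r n) x) \<longlonglongrightarrow> u x" by simp
    then have "(\<lambda>n. ennreal ((\<eta> (r n) x)^4)) \<longlonglongrightarrow> ennreal ((u x)^4)"
      by (intro tendsto_ennrealI tendsto_power)
    from lim_imp_Liminf[OF trivial_limit_sequentially this] show ?case by (rule sym)
  qed
  have bound: "(\<integral>\<^sup>+x. ennreal ((\<eta> n x)^4) \<partial>M) \<le> ennreal (K * (H1_norm \<Omega> u + inverse (real (Suc n)))^4)" for n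
  proof -
    have "(\<integral>\<^sup>+x. ennreal ((\<eta> n x)^4) \<partial>M) \<le> ennreal K * (ennreal ((H1_norm \<Omega> (\<eta> n))\<^sup>2))\<^sup>2"
      using emb[OF \<eta>(1)] by (simp only: smooth_H1_norm_nn_integral[OF S[OF \<eta>(1)]])
    also have "\<dots> = ennreal (K * (H1_norm \<Omega> (\<eta> n))^4)"
      using \<open>K \<ge> 0\<close> by (simp add: ennreal_mult ennreal_power power_mult[symmetric])
    also have "\<dots> \<le> ennreal (K * (H1_norm \<Omega> u + inverse (real (Suc n)))^4)"
    proof (intro ennreal_leI mult_left_mono power_mono H1_norm_nonneg \<open>K \<ge> 0\<close>)
      have "H1_norm \<Omega> (\<lambda>x. u x - (u x - \<eta> n x)) \<le> H1_norm \<Omega> u + H1_norm \<Omega> (\<lambda>x. u x - \<eta> n x)"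
        by (intro H1_norm_diff H1_diff uH \<eta>H)
      then show "H1_norm \<Omega> (\<eta> n) \<le> H1_norm \<Omega> u + inverse (real (Suc n))"
        using \<eta>(2)[of n] by simp
    qed
    finally show ?thesis .
  qed
  have "(\<integral>\<^sup>+x. ennreal ((u x)^4) \<partial>M) = (\<integral>\<^sup>+x. liminf (\<lambda>n. ennreal ((\<eta> (r n) x)^4)) \<partial>M)"
    by (rule nn_integral_cong_AE[OF conv])
  also have "\<dots> \<le> liminf (\<lambda>n. \<integral>\<^sup>+x. ennreal ((\<eta> (r n) x)^4) \<partial>M)"
    by (rule nn_integral_liminf) measurable
  also have "\<dots> \<le> liminf (\<lambda>n. ennreal (K * (H1_norm \<Omega> u + inverse (real (Suc (r n))))^4))"
    by (intro Liminf_mono always_eventually allI bound)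
  also have "\<dots> = ennreal (K * (H1_norm \<Omega> u + 0)^4)"
  proof (rule lim_imp_Liminf)
    have "(\<lambda>n. inverse (real (Suc (r n)))) \<longlonglongrightarrow> 0"
      using LIMSEQ_subseq_LIMSEQ[OF LIMSEQ_inverse_real_of_nat r(1)] by (simp add: o_def)
    then show "(\<lambda>n. ennreal (K * (H1_norm \<Omega> u + inverse (real (Suc (r n))))^4)) \<longlonglongrightarrow> ennreal (K * (H1_norm \<Omega> u + 0)^4)"
      by (intro tendsto_ennrealI tendsto_intros)
  qed simp
  finally show ?thesis by simp
qed

end

text \<open>Collects what the error analysis takes from \<open>X\<close>, in a form common to both
  boundary conditions. \<open>K\<close> is the fourth power of a constant for the embedding into
  L4.\<close>

locale H1_L4_subspace = bounded_domain \<Omega> for \<Omega> :: "'a::euclidean_space set" +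
  fixes X :: "('a \<Rightarrow> real) set" and K :: real
  assumes X_H1: "X \<subseteq> H1 \<Omega>"
    and X_diff: "\<lbrakk>u \<in> X; v \<in> X\<rbrakk> \<Longrightarrow> (\<lambda>x. u x - v x) \<in> X"
    and K_pos: "K > 0"
    and L4_bound: "u \<in> X \<Longrightarrow> (\<integral>\<^sup>+x. ennreal ((u x)^4) \<partial>M) \<le> ennreal (K * (H1_norm \<Omega> u)^4)"

text \<open>Both cases are instances of one situation: smooth generators that vanish with their
  gradients on the part of a cell outside \<Omega>. For test functions the cell is a large cube; in
  the periodic case it is \<Omega> and that part is empty.\<close>

lemma wavefunction_space_H1_L4:
  fixes \<Omega> :: "(real^3) set"
  assumes "open \<Omega>" "bounded \<Omega>" "wavefunction_space \<Omega> X"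
  obtains K where "H1_L4_subspace \<Omega> X K"
proof -
  interpret bounded_domain \<Omega> by unfold_locales (fact assms)+
  note result = that
  have main: thesis
    if S: "\<And>\<eta>. \<eta> \<in> S \<Longrightarrow> smooth_on UNIV \<eta>" "\<And>\<eta> \<zeta>. \<lbrakk>\<eta> \<in> S; \<zeta> \<in> S\<rbrakk> \<Longrightarrow> (\<lambda>x. \<eta> x - \<zeta> x) \<in> S"
      and X: "X = H1_closure \<Omega> S" and A: "invertible A"
      and cell: "\<And>\<eta> x. \<lbrakk>\<eta> \<in> S; x \<in> supercell A c - \<Omega>\<rbrakk> \<Longrightarrow> \<eta> x = 0 \<and> gradient \<eta> x = 0" "\<Omega> \<subseteq> supercell A c"
    for S A c
  proof -
    obtain K where K: "K > 0"
      "\<And>u (Du :: real^3 \<Rightarrow> real^3). \<lbrakk>\<And>x. (u has_derivative (\<lambda>h. Du x \<bullet> h)) (at x); continuous_on UNIV Du\<rbrakk> \<Longrightarrow>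
      (\<integral>\<^sup>+x\<in>supercell A c. ennreal ((u x)^4) \<partial>lborel)
        \<le> ennreal K * (\<integral>\<^sup>+x\<in>supercell A c. ennreal ((u x)\<^sup>2 + (norm (Du x))\<^sup>2) \<partial>lborel)\<^sup>2"
      using Ladyzhenskaya_cell[OF A, of c] by blast
    have emb: "(\<integral>\<^sup>+x. ennreal ((\<eta> x)^4) \<partial>M) \<le> ennreal K * (\<integral>\<^sup>+x. ennreal ((\<eta> x)\<^sup>2 + (norm (gradient \<eta> x))\<^sup>2) \<partial>M)\<^sup>2"
      if \<eta>: "\<eta> \<in> S" for \<eta>
    proof -
      have 1: "(\<integral>\<^sup>+x. ennreal ((\<eta> x)^4) \<partial>M) = (\<integral>\<^sup>+x\<in>supercell A c. ennreal ((\<eta> x)^4) \<partial>lborel)"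
        unfolding nn_integral_restrict_space[of \<Omega> lborel, simplified]
        using cell \<eta> by (intro nn_integral_cong) (auto split: split_indicator)
      have 2: "(\<integral>\<^sup>+x. ennreal ((\<eta> x)\<^sup>2 + (norm (gradient \<eta> x))\<^sup>2) \<partial>M) = (\<integral>\<^sup>+x\<in>supercell A c. ennreal ((\<eta> x)\<^sup>2 + (norm (gradient \<eta> x))\<^sup>2) \<partial>lborel)"
        unfolding nn_integral_restrict_space[of \<Omega> lborel, simplified]
        using cell \<eta> by (intro nn_integral_cong) (auto split: split_indicator)
      show ?thesis
        unfolding 1 2 by (rule K(2)[OF smooth_gradient[OF S(1)[OF \<eta>]]])
    qed
    have SH: "S \<subseteq> H1 \<Omega>" using S(1) smooth_H1(1) by blast
    have "H1_L4_subspace \<Omega> X K"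
    proof
      show "X \<subseteq> H1 \<Omega>" by (auto simp: X H1_closure_def)
      show "(\<lambda>x. u x - v x) \<in> X" if "u \<in> X" "v \<in> X" for u v
        using that unfolding X by (intro H1_closure_diff S(2) SH)
      show "K > 0" by (fact K(1))
      show "(\<integral>\<^sup>+x. ennreal ((u x)^4) \<partial>M) \<le> ennreal (K * (H1_norm \<Omega> u)^4)" if "u \<in> X" for u
        using that K(1) unfolding X by (intro H1_closure_L4_bound[OF S(1) _ emb]) auto
    qed
    then show thesis by (rule result)
  qed
  consider "X = H1_0 \<Omega>" | A c where "invertible A" "\<Omega> = supercell A c" "X = H1_per A \<Omega>"
    using assms(3) by (auto simp: wavefunction_space_def)
  then show thesis
  proof cases
    case 1
    obtain R where R: "R > 0" "\<And>x. x \<in> \<Omega> \<Longrightarrow> norm x < R"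
      using bounded_domain bounded_pos_less by blast
    \<comment> \<open>The cube of side \<open>2 * R\<close> centred at the origin, presented as a
      supercell.\<close>
    let ?A = "mat (2 * R) :: real^3^3"
    let ?c = "(\<chi> i. - R) :: real^3"
    have Av: "?A *v t = (2 * R) *\<^sub>R t" for t
      by (simp add: vec_eq_iff matrix_vector_mult_def mat_def if_distrib[where f="\<lambda>a. a * _"] cong: if_cong)
    have "invertible ?A"
    proof -
      have "det ?A = (\<Prod>i\<in>UNIV. ?A $ i $ i)"
        by (rule det_diagonal) (simp add: mat_def)
      also have "\<dots> \<noteq> 0" using R(1) by (simp add: mat_def)
      finally show ?thesis by (simp add: invertible_det_nz)
    qed
    moreover have "\<Omega> \<subseteq> supercell ?A ?c"
    proof
      fix x assume x: "x \<in> \<Omega>"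
      let ?t = "(1 / (2 * R)) *\<^sub>R (x - ?c)"
      have "x = ?c + ?A *v ?t" using R(1) by (simp add: Av)
      moreover have "0 < ?t $ i \<and> ?t $ i < 1" for i
      proof -
        have "\<bar>x $ i\<bar> < R" using component_le_norm_cart[of x i] R(2)[OF x] by linarith
        then show ?thesis using R(1) by (auto simp: field_simps)
      qed
      ultimately show "x \<in> supercell ?A ?c" unfolding supercell_def by blast
    qed
    ultimately show thesis
      using 1 by (intro main[of "test_functions \<Omega>" ?A ?c])
        (auto simp: H1_0_def test_functions_diff test_function_outside, auto simp: test_functions_def)
  next
    case 2
    then show thesis
      by (intro main[of "smooth_periodic A" A c]) (auto simp: H1_per_def smooth_periodic_diff, auto simp: smooth_periodic_def)
  qed
qed

section \<open>The energy error\<close>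

context bounded_domain
begin

lemma square_integrable_sum:
  assumes "finite I" "\<And>i. i \<in> I \<Longrightarrow> square_integrable \<Omega> (f i)"
  shows "square_integrable \<Omega> (\<lambda>x. \<Sum>i\<in>I. f i x)"
  using assms
proof (induction I rule: finite_induct)
  case empty
  then show ?case by (simp add: continuous_square_integrable)
next
  case (insert i I)
  then show ?case by (simp add: square_integrable_add)
qed

lemma square_integrable_cmult:
  fixes f :: "'a \<Rightarrow> real"
  assumes "square_integrable \<Omega> f" shows "square_integrable \<Omega> (\<lambda>x. c * f x)"
  using square_integrable_scaleR[OF assms, of c] by simp

lemma square_integrable_integrable:
  fixes f :: "'a \<Rightarrow> real"
  assumes "square_integrable \<Omega> f" shows "integrable M f"
  using mult_integrable[OF assms continuous_square_integrable[of "\<lambda>_. 1"]] by simp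

lemma square_integrable_dominated:
  fixes f g :: "'a \<Rightarrow> real"
  assumes "square_integrable \<Omega> g" "f \<in> borel_measurable M" "\<And>x. x \<in> \<Omega> \<Longrightarrow> \<bar>f x\<bar> \<le> g x"
  shows "square_integrable \<Omega> f"
proof -
  have "integrable M (\<lambda>x. (norm (f x))\<^sup>2)"
  proof (rule Bochner_Integration.integrable_bound)
    show "integrable M (\<lambda>x. (norm (g x))\<^sup>2)" using assms(1) by (simp add: square_integrable_iff)
    show "AE x in M. norm ((norm (f x))\<^sup>2) \<le> norm ((norm (g x))\<^sup>2)"
    proof (intro AE_I2)
      fix x assume "x \<in> space M"
      then have "\<bar>f x\<bar>\<^sup>2 \<le> (g x)\<^sup>2" using assms(3) by (intro power_mono) auto
      then show "norm ((norm (f x))\<^sup>2) \<le> norm ((norm (g x))\<^sup>2)" by simp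
    qed
  qed (use assms(2) in measurable)
  then show ?thesis using assms(2) by (simp add: square_integrable_iff)
qed

lemma abs_integral_mult_le:
  fixes f g :: "'a \<Rightarrow> real"
  assumes f: "square_integrable \<Omega> f" and g: "square_integrable \<Omega> g"
  shows "\<bar>\<integral>x. f x * g x \<partial>M\<bar> \<le> L2_norm \<Omega> f * L2_norm \<Omega> g"
proof -
  have "\<bar>\<integral>x. f x * g x \<partial>M\<bar> \<le> (\<integral>x. norm (f x) * norm (g x) \<partial>M)"
    using integral_norm_bound[of M "\<lambda>x. f x * g x"] by (simp add: abs_mult)
  also have "\<dots> \<le> L2_norm \<Omega> f * L2_norm \<Omega> g" by (rule Cauchy_Schwarz_L2[OF f g])
  finally show ?thesis .
qed

lemma Dirichlet_energy_expansion:
  assumes u: "u \<in> H1 \<Omega>" and v: "v \<in> H1 \<Omega>"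
  shows "(\<integral>x. (norm (wgrad \<Omega> v x))\<^sup>2 \<partial>M) = (\<integral>x. (norm (wgrad \<Omega> u x))\<^sup>2 \<partial>M)
    + 2 * (\<integral>x. wgrad \<Omega> u x \<bullet> wgrad \<Omega> (\<lambda>x. v x - u x) x \<partial>M) + (H1_seminorm \<Omega> (\<lambda>x. v x - u x))\<^sup>2"
proof -
  let ?e = "\<lambda>x. v x - u x"
  note U = H1_wgrad(2)[OF u] and V = H1_wgrad(2)[OF v] and E = H1_wgrad(2)[OF H1_diff(1)[OF v u]]
  note [measurable] = U[THEN square_integrable_measurable] V[THEN square_integrable_measurable] E[THEN square_integrable_measurable]
  have "(\<integral>x. (norm (wgrad \<Omega> v x))\<^sup>2 \<partial>M)
      = (\<integral>x. (norm (wgrad \<Omega> u x))\<^sup>2 + 2 * (wgrad \<Omega> u x \<bullet> wgrad \<Omega> ?e x) + (norm (wgrad \<Omega> ?e x))\<^sup>2 \<partial>M)"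
  proof (rule integral_cong_AE)
    show "AE x in M. (norm (wgrad \<Omega> v x))\<^sup>2 = (norm (wgrad \<Omega> u x))\<^sup>2 + 2 * (wgrad \<Omega> u x \<bullet> wgrad \<Omega> ?e x) + (norm (wgrad \<Omega> ?e x))\<^sup>2"
      using H1_diff(2)[OF v u]
    proof eventually_elim
      case (elim x)
      then have "wgrad \<Omega> v x = wgrad \<Omega> u x + wgrad \<Omega> ?e x" by simp
      then show ?case by (simp add: power2_norm_eq_inner inner_add_left inner_add_right inner_commute)
    qed
  qed measurable
  also have "\<dots> = (\<integral>x. (norm (wgrad \<Omega> u x))\<^sup>2 \<partial>M) + 2 * (\<integral>x. wgrad \<Omega> u x \<bullet> wgrad \<Omega> ?e x \<partial>M) + (\<integral>x. (norm (wgrad \<Omega> ?e x))\<^sup>2 \<partial>M)"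
    using U E inner_integrable[OF U E] by (simp add: square_integrable_iff)
  finally show ?thesis by (simp add: H1_seminorm_def L2_norm_sq)
qed

text \<open>The claim measures \<open>\<Psi> - \<Psi>h\<close>, whereas the expansion uses
  \<open>\<Psi>h - \<Psi>\<close>. As \<open>wgrad\<close> chooses separately for the two
  differences, the symmetry of the seminorm passes through equality almost everywhere.\<close>

lemma H1_norms_diff_commute:
  assumes u: "u \<in> H1 \<Omega>" and v: "v \<in> H1 \<Omega>"
  shows "L2_norm \<Omega> (\<lambda>x. u x - v x) = L2_norm \<Omega> (\<lambda>x. v x - u x)"
    "H1_seminorm \<Omega> (\<lambda>x. u x - v x) = H1_seminorm \<Omega> (\<lambda>x. v x - u x)"
    "H1_norm \<Omega> (\<lambda>x. u x - v x) = H1_norm \<Omega> (\<lambda>x. v x - u x)"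
proof -
  show 1: "L2_norm \<Omega> (\<lambda>x. u x - v x) = L2_norm \<Omega> (\<lambda>x. v x - u x)"
    by (simp add: L2_norm_def power2_commute)
  have "H1_seminorm \<Omega> (\<lambda>x. u x - v x) = L2_norm \<Omega> (\<lambda>x. (-1) *\<^sub>R wgrad \<Omega> (\<lambda>x. v x - u x) x)"
    unfolding H1_seminorm_def
  proof (rule L2_norm_cong_AE)
    show "AE x in M. wgrad \<Omega> (\<lambda>x. u x - v x) x = (-1) *\<^sub>R wgrad \<Omega> (\<lambda>x. v x - u x) x"
      using H1_diff(2)[OF u v] H1_diff(2)[OF v u] by eventually_elim simp
    show "square_integrable \<Omega> (wgrad \<Omega> (\<lambda>x. u x - v x))"
      by (rule H1_wgrad(2)[OF H1_diff(1)[OF u v]])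
    show "square_integrable \<Omega> (\<lambda>x. (-1) *\<^sub>R wgrad \<Omega> (\<lambda>x. v x - u x) x)"
      by (rule square_integrable_scaleR[OF H1_wgrad(2)[OF H1_diff(1)[OF v u]]])
  qed
  also have "\<dots> = H1_seminorm \<Omega> (\<lambda>x. v x - u x)"
    unfolding L2_norm_scaleR by (simp add: H1_seminorm_def)
  finally show 2: "H1_seminorm \<Omega> (\<lambda>x. u x - v x) = H1_seminorm \<Omega> (\<lambda>x. v x - u x)" .
  show "H1_norm \<Omega> (\<lambda>x. u x - v x) = H1_norm \<Omega> (\<lambda>x. v x - u x)"
    by (simp add: H1_norm_def 1 2)
qed

end

section \<open>Products of functions in the embedded space\<close>

context H1_L4_subspace
begin

text \<open>The square of the embedding constant: it bounds the L2 norm of a product of two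
  functions in \<open>X\<close> by the product of their H1 norms.\<close>

definition Q where "Q = sqrt K"

lemma Q_nonneg: "0 \<le> Q" using K_pos by (simp add: Q_def)

lemma X_H1_wgrad:
  assumes "u \<in> X" shows "u \<in> H1 \<Omega>" "square_integrable \<Omega> u"
  using assms X_H1 H1_wgrad(1) by auto

lemma square_square_integrable:
  assumes u: "u \<in> X"
  shows "square_integrable \<Omega> (\<lambda>x. (u x)\<^sup>2)" "L2_norm \<Omega> (\<lambda>x. (u x)\<^sup>2) \<le> Q * (H1_norm \<Omega> u)\<^sup>2"
proof -
  note [measurable] = X_H1_wgrad(2)[OF u, THEN square_integrable_measurable]
  have p4: "(norm ((u x)\<^sup>2))\<^sup>2 = (u x)^4" for x by (simp add: power_mult[symmetric])
  have "integrable M (\<lambda>x. (u x)^4)"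
  proof (rule integrableI_bounded)
    have "(\<integral>\<^sup>+x. ennreal (norm ((u x)^4)) \<partial>M) = (\<integral>\<^sup>+x. ennreal ((u x)^4) \<partial>M)" by simp
    also have "\<dots> < \<infinity>" using L4_bound[OF u] by (simp add: le_less_trans)
    finally show "(\<integral>\<^sup>+x. ennreal (norm ((u x)^4)) \<partial>M) < \<infinity>" .
  qed measurable
  then have int: "integrable M (\<lambda>x. (u x)^4)" .
  then show "square_integrable \<Omega> (\<lambda>x. (u x)\<^sup>2)"
    unfolding square_integrable_iff p4 by simp
  have "ennreal (\<integral>x. (u x)^4 \<partial>M) \<le> ennreal (K * (H1_norm \<Omega> u)^4)"
    using L4_bound[OF u] int by (subst nn_integral_eq_integral[symmetric]) auto
  then have "(\<integral>x. (u x)^4 \<partial>M) \<le> K * (H1_norm \<Omega> u)^4"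
    using K_pos by (simp add: ennreal_le_iff)
  also have "\<dots> = (Q * (H1_norm \<Omega> u)\<^sup>2)\<^sup>2"
    using K_pos by (simp add: Q_def power_mult_distrib power_mult[symmetric])
  finally have "(L2_norm \<Omega> (\<lambda>x. (u x)\<^sup>2))\<^sup>2 \<le> (Q * (H1_norm \<Omega> u)\<^sup>2)\<^sup>2"
    by (simp only: L2_norm_sq p4)
  then show "L2_norm \<Omega> (\<lambda>x. (u x)\<^sup>2) \<le> Q * (H1_norm \<Omega> u)\<^sup>2"
    by (rule power2_le_imp_le) (simp add: Q_nonneg)
qed

lemma mult_square_integrable:
  assumes u: "u \<in> X" and v: "v \<in> X"
  shows "square_integrable \<Omega> (\<lambda>x. u x * v x)" "L2_norm \<Omega> (\<lambda>x. u x * v x) \<le> Q * H1_norm \<Omega> u * H1_norm \<Omega> v"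
proof -
  note [measurable] = X_H1_wgrad(2)[OF u, THEN square_integrable_measurable] X_H1_wgrad(2)[OF v, THEN square_integrable_measurable]
  have p: "(norm (u x * v x))\<^sup>2 = (u x)\<^sup>2 * (v x)\<^sup>2" for x by (simp add: power_mult_distrib)
  note sq = square_square_integrable(1)[OF u] square_square_integrable(1)[OF v]
  show "square_integrable \<Omega> (\<lambda>x. u x * v x)"
    unfolding square_integrable_iff p using mult_integrable[OF sq] by simp
  have "(L2_norm \<Omega> (\<lambda>x. u x * v x))\<^sup>2 = (\<integral>x. (u x)\<^sup>2 * (v x)\<^sup>2 \<partial>M)"
    by (simp only: L2_norm_sq p)
  also have "\<dots> \<le> L2_norm \<Omega> (\<lambda>x. (u x)\<^sup>2) * L2_norm \<Omega> (\<lambda>x. (v x)\<^sup>2)"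
    using abs_integral_mult_le[OF sq] by linarith
  also have "\<dots> \<le> (Q * (H1_norm \<Omega> u)\<^sup>2) * (Q * (H1_norm \<Omega> v)\<^sup>2)"
    by (intro mult_mono square_square_integrable u v) (simp_all add: L2_norm_nonneg Q_nonneg)
  also have "\<dots> = (Q * H1_norm \<Omega> u * H1_norm \<Omega> v)\<^sup>2"
    by (simp add: power2_eq_square)
  finally show "L2_norm \<Omega> (\<lambda>x. u x * v x) \<le> Q * H1_norm \<Omega> u * H1_norm \<Omega> v"
    by (rule power2_le_imp_le) (simp add: Q_nonneg H1_norm_nonneg)
qed

text \<open>Hoelder with exponents 2, 4, 4. The factor \<open>w\<close> is charged in L2 alone; an
  orbital error in its place yields the L2 norm in the mixed term of the claim.\<close>

lemma trilinear_bound: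
  assumes u: "u \<in> X" and v: "v \<in> X" and w: "square_integrable \<Omega> w"
  shows "integrable M (\<lambda>x. w x * (u x * v x))"
    "\<bar>\<integral>x. w x * (u x * v x) \<partial>M\<bar> \<le> L2_norm \<Omega> w * (Q * H1_norm \<Omega> u * H1_norm \<Omega> v)"
proof -
  note sq = mult_square_integrable[OF u v]
  show "integrable M (\<lambda>x. w x * (u x * v x))" by (rule mult_integrable[OF w sq(1)])
  show "\<bar>\<integral>x. w x * (u x * v x) \<partial>M\<bar> \<le> L2_norm \<Omega> w * (Q * H1_norm \<Omega> u * H1_norm \<Omega> v)"
    using abs_integral_mult_le[OF w sq(1)] mult_left_mono[OF sq(2) L2_norm_nonneg[of w]] by linarith
qed

lemma density_square_integrable:
  assumes "\<And>i. i \<in> {1..N} \<Longrightarrow> \<Psi> i \<in> X"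
  shows "square_integrable \<Omega> (density N \<Psi>)"
  unfolding density_def[abs_def]
  by (intro square_integrable_cmult square_integrable_sum square_square_integrable assms) simp

lemma density_product_bound:
  assumes "\<And>i. i \<in> {1..N} \<Longrightarrow> \<Psi> i \<in> X" "\<And>i. i \<in> {1..N} \<Longrightarrow> e i \<in> X"
  shows "\<bar>\<integral>x. density N \<Psi> x * density N e x \<partial>M\<bar>
    \<le> 4 * Q\<^sup>2 * (\<Sum>i=1..N. (H1_norm \<Omega> (\<Psi> i))\<^sup>2) * (\<Sum>i=1..N. (H1_norm \<Omega> (e i))\<^sup>2)"
proof -
  have L: "L2_norm \<Omega> (density N u) \<le> 2 * Q * (\<Sum>i=1..N. (H1_norm \<Omega> (u i))\<^sup>2)"
    if u: "\<And>i. i \<in> {1..N} \<Longrightarrow> u i \<in> X" for u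
  proof -
    have "L2_norm \<Omega> (\<lambda>x. \<Sum>i\<in>I. (u i x)\<^sup>2) \<le> (\<Sum>i\<in>I. Q * (H1_norm \<Omega> (u i))\<^sup>2)"
      if "finite I" "I \<subseteq> {1..N}" for I
      using that
    proof (induction I rule: finite_induct)
      case empty
      then show ?case by (simp add: L2_norm_def set_integral_eq)
    next
      case (insert i I)
      then have sq: "square_integrable \<Omega> (\<lambda>x. (u i x)\<^sup>2)" "square_integrable \<Omega> (\<lambda>x. \<Sum>i\<in>I. (u i x)\<^sup>2)"
        using u by (auto intro!: square_integrable_sum square_square_integrable)
      have "L2_norm \<Omega> (\<lambda>x. (u i x)\<^sup>2) \<le> Q * (H1_norm \<Omega> (u i))\<^sup>2"
        using insert u by (intro square_square_integrable) auto
      then show ?case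
        using L2_norm_triangle[OF sq] insert by simp
    qed
    from this[of "{1..N}"] have "L2_norm \<Omega> (\<lambda>x. \<Sum>i=1..N. (u i x)\<^sup>2) \<le> Q * (\<Sum>i=1..N. (H1_norm \<Omega> (u i))\<^sup>2)"
      by (simp add: sum_distrib_left)
    then show ?thesis
      using L2_norm_scaleR[of 2 "\<lambda>x. \<Sum>i=1..N. (u i x)\<^sup>2"] by (simp add: density_def[abs_def])
  qed
  have "\<bar>\<integral>x. density N \<Psi> x * density N e x \<partial>M\<bar> \<le> L2_norm \<Omega> (density N \<Psi>) * L2_norm \<Omega> (density N e)"
    by (intro abs_integral_mult_le density_square_integrable assms)
  also have "\<dots> \<le> (2 * Q * (\<Sum>i=1..N. (H1_norm \<Omega> (\<Psi> i))\<^sup>2)) * (2 * Q * (\<Sum>i=1..N. (H1_norm \<Omega> (e i))\<^sup>2))"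
    by (intro mult_mono L assms) (simp_all add: L2_norm_nonneg Q_nonneg sum_nonneg)
  finally show ?thesis by (simp add: power2_eq_square mult_ac)
qed

end

section \<open>Increments of the density and expansion of the energy\<close>

lemma KS_density_nonneg: "0 \<le> density N \<Psi> x"
  by (simp add: density_def sum_nonneg)

lemma density_add:
  assumes "\<And>i. i \<in> {1..N} \<Longrightarrow> \<Psi>h i x = \<Psi> i x + e i x"
  shows "density N \<Psi>h x = density N \<Psi> x + 4 * (\<Sum>i=1..N. \<Psi> i x * e i x) + density N e x"
proof -
  have "(\<Sum>i=1..N. (\<Psi>h i x)\<^sup>2) = (\<Sum>i=1..N. (\<Psi> i x)\<^sup>2 + 2 * (\<Psi> i x * e i x) + (e i x)\<^sup>2)"
    by (intro sum.cong refl) (simp add: assms power2_sum)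
  then show ?thesis by (simp add: density_def sum.distrib sum_distrib_left[symmetric])
qed

lemma density_cross_bound:
  "(4 * (\<Sum>i=1..N. \<Psi> i x * e i x))\<^sup>2 \<le> 4 * density N \<Psi> x * density N e x"
  using Cauchy_Schwarz_ineq_sum[of "\<lambda>i. \<Psi> i x" "\<lambda>i. e i x" "{1..N}"]
  by (simp add: density_def power_mult_distrib)

text \<open>Isolates the properties of \<open>F\<close> from the parametrization. \<open>F1\<close>
  stands for \<open>deriv F\<close> with a controlled value at 0, so that it is measurable and obeys
  the growth bound down to zero density.\<close>

locale KS_model = H1_L4_subspace \<Omega> X K for \<Omega> :: "'a::euclidean_space set" and X K +
  fixes N :: nat and F F1 :: "real \<Rightarrow> real" and b :: "'a \<Rightarrow> real" and Kf Cr :: real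
  assumes F_meas: "F \<in> borel_measurable borel" and F1_meas: "F1 \<in> borel_measurable borel"
    and F_bound: "\<rho> \<ge> 0 \<Longrightarrow> \<bar>F \<rho>\<bar> \<le> Kf * \<rho> * (1 + \<rho>)"
    and F1_bound: "\<rho> \<ge> 0 \<Longrightarrow> \<bar>F1 \<rho>\<bar> \<le> Kf * (1 + \<rho>)"
    and F1_deriv: "\<rho> > 0 \<Longrightarrow> F1 \<rho> = deriv F \<rho>"
    and F_remainder: "\<lbrakk>\<rho> \<ge> 0; d \<ge> 0; s\<^sup>2 \<le> 4 * \<rho> * d\<rbrakk> \<Longrightarrow>
      \<bar>F (\<rho> + s + d) - F \<rho> - F1 \<rho> * s\<bar> \<le> Cr * (1 + \<rho> + d) * d"
    and Cr_nonneg: "Cr \<ge> 0"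
    and b_square_integrable: "square_integrable \<Omega> b"
begin

lemma F_density_integrable:
  assumes "square_integrable \<Omega> (density N \<Psi>)"
  shows "integrable M (\<lambda>x. F (density N \<Psi> x))"
proof (rule Bochner_Integration.integrable_bound)
  note m = square_integrable_measurable[OF assms]
  show "integrable M (\<lambda>x. Kf * (density N \<Psi> x + density N \<Psi> x * density N \<Psi> x))"
    using square_integrable_integrable[OF assms] mult_integrable[OF assms assms] by simp
  show "(\<lambda>x. F (density N \<Psi> x)) \<in> borel_measurable M"
    by (rule measurable_compose[OF m F_meas])
  show "AE x in M. norm (F (density N \<Psi> x)) \<le> norm (Kf * (density N \<Psi> x + density N \<Psi> x * density N \<Psi> x))"
  proof (intro AE_I2)
    fix x
    have "\<bar>F (density N \<Psi> x)\<bar> \<le> Kf * density N \<Psi> x * (1 + density N \<Psi> x)"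
      by (rule F_bound[OF KS_density_nonneg])
    also have "\<dots> = Kf * (density N \<Psi> x + density N \<Psi> x * density N \<Psi> x)" by (simp add: algebra_simps)
    finally show "norm (F (density N \<Psi> x)) \<le> norm (Kf * (density N \<Psi> x + density N \<Psi> x * density N \<Psi> x))" by simp
  qed
qed

lemma F1_density_square_integrable:
  assumes "square_integrable \<Omega> (density N \<Psi>)"
  shows "square_integrable \<Omega> (\<lambda>x. F1 (density N \<Psi> x))"
proof (rule square_integrable_dominated)
  show "square_integrable \<Omega> (\<lambda>x. Kf * (1 + density N \<Psi> x))"
    by (intro square_integrable_cmult square_integrable_add assms continuous_square_integrable) simp
  show "(\<lambda>x. F1 (density N \<Psi> x)) \<in> borel_measurable M"
    by (rule measurable_compose[OF square_integrable_measurable[OF assms] F1_meas])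
qed (rule F1_bound[OF KS_density_nonneg])

text \<open>Where the density vanishes every orbital vanishes too, so both sides are 0 whatever the
  value of \<open>deriv F\<close> at 0.\<close>

lemma deriv_F_density:
  assumes "i \<in> {1..N}"
  shows "deriv F (density N \<Psi> x) * \<Psi> i x * v = F1 (density N \<Psi> x) * (\<Psi> i x * v)"
proof (cases "density N \<Psi> x = 0")
  case True
  then have "(\<Sum>i=1..N. (\<Psi> i x)\<^sup>2) = 0" by (simp add: density_def)
  then have "\<Psi> i x = 0" using assms by (subst (asm) sum_nonneg_eq_0_iff) auto
  then show ?thesis by simp
next
  case False
  then have "density N \<Psi> x > 0" using KS_density_nonneg[of N \<Psi> x] by simp
  then show ?thesis by (simp add: F1_deriv)
qed

text \<open>No finite-element space occurs in this context, so the constants obtained in it are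
  uniform in \<open>Xh\<close>.\<close>

context
  fixes \<Psi> \<Psi>h :: "nat \<Rightarrow> 'a \<Rightarrow> real" and \<phi> \<phi>h :: "'a \<Rightarrow> real" and \<epsilon> :: "nat \<Rightarrow> real"
    and e :: "nat \<Rightarrow> 'a \<Rightarrow> real" and f :: "'a \<Rightarrow> real"
  assumes sol: "KS_solution \<Omega> X N F b \<Psi> \<phi> \<epsilon>"
    and \<Psi>h: "\<And>i. i \<in> {1..N} \<Longrightarrow> \<Psi>h i \<in> X" and \<phi>h: "\<phi>h \<in> X"
    and normalized: "\<And>i. i \<in> {1..N} \<Longrightarrow> (LINT x:\<Omega>|lborel. \<Psi>h i x * \<Psi>h i x) = 1"
  defines "e \<equiv> \<lambda>i x. \<Psi>h i x - \<Psi> i x" and "f \<equiv> \<lambda>x. \<phi>h x - \<phi> x"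
begin

text \<open>The first variation of the density in direction \<open>e\<close>.\<close>

definition cross where "cross x = 4 * (\<Sum>i=1..N. \<Psi> i x * e i x)"

text \<open>Linearised in \<open>cross\<close> alone: the part \<open>density N e\<close> of the
  increment is already quadratic and stays in the remainder.\<close>

definition xc_remainder where
  "xc_remainder x = F (density N \<Psi>h x) - F (density N \<Psi> x) - F1 (density N \<Psi> x) * cross x"

lemma \<Psi>: "i \<in> {1..N} \<Longrightarrow> \<Psi> i \<in> X" and \<phi>: "\<phi> \<in> X"
  using sol by (auto simp: KS_solution_def)

lemma e: "i \<in> {1..N} \<Longrightarrow> e i \<in> X" and f: "f \<in> X"
  unfolding e_def f_def by (auto intro!: X_diff \<Psi>h \<phi>h \<Psi> \<phi>)

lemma density_h: "density N \<Psi>h x = density N \<Psi> x + cross x + density N e x"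
  unfolding cross_def by (rule density_add) (simp add: e_def)

lemma cross_square_integrable: "square_integrable \<Omega> cross"
  unfolding cross_def[abs_def]
  by (intro square_integrable_cmult square_integrable_sum mult_square_integrable \<Psi> e) simp

lemmas density_sq = density_square_integrable[of N \<Psi>, OF \<Psi>] density_square_integrable[of N e, OF e]
  density_square_integrable[of N \<Psi>h, OF \<Psi>h]

lemma integral_mult_cross:
  assumes w: "square_integrable \<Omega> w"
  shows "(\<integral>x. w x * cross x \<partial>M) = 4 * (\<Sum>i=1..N. \<integral>x. w x * (\<Psi> i x * e i x) \<partial>M)"
proof -
  have "(\<integral>x. w x * cross x \<partial>M) = (\<integral>x. 4 * (\<Sum>i=1..N. w x * (\<Psi> i x * e i x)) \<partial>M)"
    unfolding cross_def by (simp add: sum_distrib_left mult_ac)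
  also have "\<dots> = 4 * (\<Sum>i=1..N. \<integral>x. w x * (\<Psi> i x * e i x) \<partial>M)"
    using trilinear_bound(1)[OF \<Psi> e w] by simp
  finally show ?thesis .
qed

lemma integral_mult_density_e:
  assumes w: "square_integrable \<Omega> w"
  shows "(\<integral>x. w x * density N e x \<partial>M) = 2 * (\<Sum>i=1..N. \<integral>x. w x * (e i x * e i x) \<partial>M)"
proof -
  have "(\<integral>x. w x * density N e x \<partial>M) = (\<integral>x. 2 * (\<Sum>i=1..N. w x * (e i x * e i x)) \<partial>M)"
    unfolding density_def by (simp add: sum_distrib_left mult_ac power2_eq_square)
  also have "\<dots> = 2 * (\<Sum>i=1..N. \<integral>x. w x * (e i x * e i x) \<partial>M)"
    using trilinear_bound(1)[OF e e w] by simp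
  finally show ?thesis .
qed

lemma xc_remainder_integrable: "integrable M xc_remainder"
  unfolding xc_remainder_def[abs_def]
  by (intro Bochner_Integration.integrable_diff F_density_integrable density_sq mult_integrable
      F1_density_square_integrable cross_square_integrable)

text \<open>The first-order terms combine to the Kohn-Sham residual in the directions \<open>e i\<close> and \<open>f\<close>, leaving
  only \<open>\<epsilon> i\<close> times \<open>\<integral> \<Psi> i * e i\<close>, which the normalisation turns into a quadratic term.\<close>

lemma energy_difference:
  "KS_energy \<Omega> N F b \<Psi>h \<phi>h - KS_energy \<Omega> N F b \<Psi> \<phi> =
    (\<Sum>i=1..N. (H1_seminorm \<Omega> (e i))\<^sup>2) - 2 * (\<Sum>i=1..N. \<epsilon> i * (L2_norm \<Omega> (e i))\<^sup>2)
    + (\<integral>x. xc_remainder x \<partial>M) - 1 / (8 * pi) * (H1_seminorm \<Omega> f)\<^sup>2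
    + (\<integral>x. \<phi> x * density N e x \<partial>M) + ((\<integral>x. f x * cross x \<partial>M) + (\<integral>x. f x * density N e x \<partial>M))"
proof -
  note \<phi>_sq = X_H1_wgrad(2)[OF \<phi>] and f_sq = X_H1_wgrad(2)[OF f]
  define G where "G i = (\<integral>x. wgrad \<Omega> (\<Psi> i) x \<bullet> wgrad \<Omega> (e i) x \<partial>M)" for i
  define A where "A i = (\<integral>x. F1 (density N \<Psi> x) * (\<Psi> i x * e i x) \<partial>M)" for i
  define B where "B i = (\<integral>x. \<phi> x * (\<Psi> i x * e i x) \<partial>M)" for i
  define G\<phi> where "G\<phi> = (\<integral>x. wgrad \<Omega> \<phi> x \<bullet> wgrad \<Omega> f x \<partial>M)"
  \<comment> \<open>Four times the orbital equation tested with \<open>e i\<close>, with its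
    right-hand side rewritten by the normalisation. These weights are the ones with which the three
    terms occur in the expanded energy.\<close>
  have ks: "2 * G i + 4 * A i + 4 * B i = - 2 * (\<epsilon> i * (L2_norm \<Omega> (e i))\<^sup>2)" if i: "i \<in> {1..N}" for i
  proof -
    note sq = X_H1_wgrad(2)[OF \<Psi>[OF i]] X_H1_wgrad(2)[OF e[OF i]]
    have "1/2 * G i + (\<integral>x. deriv F (density N \<Psi> x) * \<Psi> i x * e i x \<partial>M) + (\<integral>x. \<phi> x * \<Psi> i x * e i x \<partial>M)
        = \<epsilon> i * (\<integral>x. \<Psi> i x * e i x \<partial>M)"
      using sol i e[OF i] unfolding KS_solution_def set_integral_eq G_def by blast
    moreover have "(\<integral>x. deriv F (density N \<Psi> x) * \<Psi> i x * e i x \<partial>M) = A i"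
      unfolding A_def deriv_F_density[OF i] ..
    moreover have "(\<integral>x. \<phi> x * \<Psi> i x * e i x \<partial>M) = B i"
      unfolding B_def by (simp add: mult.assoc)
    moreover have "(\<integral>x. \<Psi> i x * e i x \<partial>M) = - (L2_norm \<Omega> (e i))\<^sup>2 / 2"
    proof -
      have "1 = (\<integral>x. \<Psi> i x * \<Psi> i x + 2 * (\<Psi> i x * e i x) + e i x * e i x \<partial>M)"
        using normalized[OF i] unfolding set_integral_eq by (simp add: e_def algebra_simps)
      also have "\<dots> = (\<integral>x. \<Psi> i x * \<Psi> i x \<partial>M) + 2 * (\<integral>x. \<Psi> i x * e i x \<partial>M) + (\<integral>x. e i x * e i x \<partial>M)"
        using mult_integrable[OF sq(1,1)] mult_integrable[OF sq] mult_integrable[OF sq(2,2)] by simp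
      also have "(\<integral>x. \<Psi> i x * \<Psi> i x \<partial>M) = 1"
        using sol i unfolding KS_solution_def set_integral_eq by auto
      also have "(\<integral>x. e i x * e i x \<partial>M) = (L2_norm \<Omega> (e i))\<^sup>2"
        unfolding L2_norm_sq by (simp add: power2_eq_square)
      finally show ?thesis by simp
    qed
    ultimately have "1/2 * G i + A i + B i = \<epsilon> i * (- (L2_norm \<Omega> (e i))\<^sup>2 / 2)"
      by simp
    then show ?thesis by simp
  qed
  have poisson: "1 / (4 * pi) * G\<phi> = (\<integral>x. (density N \<Psi> x + b x) * f x \<partial>M)"
    using sol f unfolding KS_solution_def set_integral_eq G\<phi>_def by blast
  have kin: "(\<integral>x. (norm (wgrad \<Omega> (\<Psi>h i) x))\<^sup>2 \<partial>M) = (\<integral>x. (norm (wgrad \<Omega> (\<Psi> i) x))\<^sup>2 \<partial>M) + 2 * G i + (H1_seminorm \<Omega> (e i))\<^sup>2"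
    if i: "i \<in> {1..N}" for i
    unfolding G_def e_def by (intro Dirichlet_energy_expansion X_H1_wgrad \<Psi> \<Psi>h i)
  have kin\<phi>: "(\<integral>x. (norm (wgrad \<Omega> \<phi>h x))\<^sup>2 \<partial>M) = (\<integral>x. (norm (wgrad \<Omega> \<phi> x))\<^sup>2 \<partial>M) + 2 * G\<phi> + (H1_seminorm \<Omega> f)\<^sup>2"
    unfolding G\<phi>_def f_def by (intro Dirichlet_energy_expansion X_H1_wgrad \<phi> \<phi>h)
  have xc: "(\<integral>x. F (density N \<Psi>h x) \<partial>M) = (\<integral>x. F (density N \<Psi> x) \<partial>M) + (\<integral>x. xc_remainder x \<partial>M) + 4 * (\<Sum>i=1..N. A i)"
  proof -
    note F1_sq = F1_density_square_integrable[OF density_sq(1)]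
    have "(\<integral>x. xc_remainder x \<partial>M) = (\<integral>x. F (density N \<Psi>h x) \<partial>M) - (\<integral>x. F (density N \<Psi> x) \<partial>M) - (\<integral>x. F1 (density N \<Psi> x) * cross x \<partial>M)"
      unfolding xc_remainder_def
      using F_density_integrable[OF density_sq(1)] F_density_integrable[OF density_sq(3)]
        mult_integrable[OF F1_sq cross_square_integrable]
      by simp
    moreover have "(\<integral>x. F1 (density N \<Psi> x) * cross x \<partial>M) = 4 * (\<Sum>i=1..N. A i)"
      unfolding A_def by (rule integral_mult_cross[OF F1_sq])
    ultimately show ?thesis by linarith
  qed
  have pot: "(\<integral>x. (density N \<Psi>h x + b x) * \<phi>h x \<partial>M) = (\<integral>x. (density N \<Psi> x + b x) * \<phi> x \<partial>M)
      + (\<integral>x. (density N \<Psi> x + b x) * f x \<partial>M) + 4 * (\<Sum>i=1..N. B i) + (\<integral>x. \<phi> x * density N e x \<partial>M)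
      + ((\<integral>x. f x * cross x \<partial>M) + (\<integral>x. f x * density N e x \<partial>M))"
  proof -
    note \<rho>b_sq = square_integrable_add[OF density_sq(1) b_square_integrable]
    have "(\<integral>x. (density N \<Psi>h x + b x) * \<phi>h x \<partial>M) = (\<integral>x. (density N \<Psi> x + b x) * \<phi> x + (density N \<Psi> x + b x) * f x
        + \<phi> x * cross x + \<phi> x * density N e x + (f x * cross x + f x * density N e x) \<partial>M)"
      unfolding density_h f_def by (intro Bochner_Integration.integral_cong refl) (simp add: algebra_simps)
    also have "\<dots> = (\<integral>x. (density N \<Psi> x + b x) * \<phi> x \<partial>M) + (\<integral>x. (density N \<Psi> x + b x) * f x \<partial>M)
        + (\<integral>x. \<phi> x * cross x \<partial>M) + (\<integral>x. \<phi> x * density N e x \<partial>M) + ((\<integral>x. f x * cross x \<partial>M) + (\<integral>x. f x * density N e x \<partial>M))"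
      using mult_integrable[OF \<rho>b_sq \<phi>_sq] mult_integrable[OF \<rho>b_sq f_sq] mult_integrable[OF \<phi>_sq cross_square_integrable]
        mult_integrable[OF \<phi>_sq density_sq(2)] mult_integrable[OF f_sq cross_square_integrable] mult_integrable[OF f_sq density_sq(2)]
      by (simp only: Bochner_Integration.integral_add Bochner_Integration.integrable_add)
    moreover have "(\<integral>x. \<phi> x * cross x \<partial>M) = 4 * (\<Sum>i=1..N. B i)"
      unfolding B_def by (rule integral_mult_cross[OF \<phi>_sq])
    ultimately show ?thesis by linarith
  qed
  have kin_sum: "(\<Sum>i=1..N. 1/2 * (\<integral>x. (norm (wgrad \<Omega> (\<Psi>h i) x))\<^sup>2 \<partial>M))
      = (\<Sum>i=1..N. 1/2 * (\<integral>x. (norm (wgrad \<Omega> (\<Psi> i) x))\<^sup>2 \<partial>M)) + (\<Sum>i=1..N. G i) + 1/2 * (\<Sum>i=1..N. (H1_seminorm \<Omega> (e i))\<^sup>2)"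
    unfolding sum_distrib_left sum.distrib[symmetric] by (intro sum.cong refl) (simp add: kin)
  have ks_sum: "2 * (\<Sum>i=1..N. G i) + 4 * (\<Sum>i=1..N. A i) + 4 * (\<Sum>i=1..N. B i) = - 2 * (\<Sum>i=1..N. \<epsilon> i * (L2_norm \<Omega> (e i))\<^sup>2)"
    unfolding sum_distrib_left sum.distrib[symmetric] by (intro sum.cong refl ks)
  \<comment> \<open>The cross term of the field energy is thus the left-hand side of the Poisson
    equation tested with \<open>f\<close>, and cancels the term of the potential energy that is
    linear in \<open>f\<close>.\<close>
  have "1 / (8 * pi) * (2 * G\<phi>) = 1 / (4 * pi) * G\<phi>" by simp
  then have pi_term: "1 / (8 * pi) * (\<integral>x. (norm (wgrad \<Omega> \<phi>h x))\<^sup>2 \<partial>M) = 1 / (8 * pi) * (\<integral>x. (norm (wgrad \<Omega> \<phi> x))\<^sup>2 \<partial>M)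
      + (\<integral>x. (density N \<Psi> x + b x) * f x \<partial>M) + 1 / (8 * pi) * (H1_seminorm \<Omega> f)\<^sup>2"
    unfolding kin\<phi> poisson[symmetric] by (simp only: distrib_left)
  show ?thesis
    unfolding KS_energy_def set_integral_eq integral_mult_right_zero
    using kin_sum ks_sum pi_term xc pot by linarith
qed

lemma xc_remainder_bound:
  assumes small: "(\<Sum>i=1..N. (H1_norm \<Omega> (e i))\<^sup>2) \<le> 1"
  shows "\<bar>\<integral>x. xc_remainder x \<partial>M\<bar>
    \<le> Cr * (2 + 4 * Q\<^sup>2 * ((\<Sum>i=1..N. (H1_norm \<Omega> (\<Psi> i))\<^sup>2) + 1)) * (\<Sum>i=1..N. (H1_norm \<Omega> (e i))\<^sup>2)"
proof -
  let ?S = "\<Sum>i=1..N. (H1_norm \<Omega> (e i))\<^sup>2" and ?P = "\<Sum>i=1..N. (H1_norm \<Omega> (\<Psi> i))\<^sup>2"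
  have S0: "0 \<le> ?S" by (simp add: sum_nonneg)
  have int: "integrable M (density N e)" "integrable M (\<lambda>x. density N \<Psi> x * density N e x)"
    "integrable M (\<lambda>x. density N e x * density N e x)"
    using square_integrable_integrable[OF density_sq(2)] mult_integrable[OF density_sq(1,2)]
      mult_integrable[OF density_sq(2,2)] by simp_all
  have "\<bar>\<integral>x. xc_remainder x \<partial>M\<bar> \<le> (\<integral>x. \<bar>xc_remainder x\<bar> \<partial>M)"
    by (rule integral_abs_bound)
  also have "\<dots> \<le> (\<integral>x. Cr * (density N e x + density N \<Psi> x * density N e x + density N e x * density N e x) \<partial>M)"
  proof (rule integral_mono)
    show "integrable M (\<lambda>x. \<bar>xc_remainder x\<bar>)" by (intro integrable_abs xc_remainder_integrable)
    show "integrable M (\<lambda>x. Cr * (density N e x + density N \<Psi> x * density N e x + density N e x * density N e x))"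
      using int by simp
    fix x
    have "\<bar>xc_remainder x\<bar> \<le> Cr * (1 + density N \<Psi> x + density N e x) * density N e x"
      unfolding xc_remainder_def density_h
      by (rule F_remainder[OF KS_density_nonneg KS_density_nonneg]) (unfold cross_def, rule density_cross_bound)
    then show "\<bar>xc_remainder x\<bar> \<le> Cr * (density N e x + density N \<Psi> x * density N e x + density N e x * density N e x)"
      by (simp add: algebra_simps)
  qed
  also have "\<dots> = Cr * ((\<integral>x. density N e x \<partial>M) + (\<integral>x. density N \<Psi> x * density N e x \<partial>M) + (\<integral>x. density N e x * density N e x \<partial>M))"
    using int by simp
  also have "\<dots> \<le> Cr * (2 * ?S + 4 * Q\<^sup>2 * ?P * ?S + 4 * Q\<^sup>2 * 1 * ?S)"
  proof (intro mult_left_mono add_mono Cr_nonneg)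
    have "(\<integral>x. density N e x \<partial>M) = 2 * (\<Sum>i=1..N. (L2_norm \<Omega> (e i))\<^sup>2)"
      using integral_mult_density_e[of "\<lambda>_. 1"]
      unfolding L2_norm_sq by (simp add: continuous_square_integrable power2_eq_square)
    also have "\<dots> \<le> 2 * ?S"
      by (intro mult_left_mono sum_mono power_mono L2_norm_le_H1_norm L2_norm_nonneg) simp
    finally show "(\<integral>x. density N e x \<partial>M) \<le> 2 * ?S" .
    show "(\<integral>x. density N \<Psi> x * density N e x \<partial>M) \<le> 4 * Q\<^sup>2 * ?P * ?S"
      using density_product_bound[of N \<Psi> e, OF \<Psi> e] by linarith
    have "(\<integral>x. density N e x * density N e x \<partial>M) \<le> 4 * Q\<^sup>2 * ?S * ?S"
      using density_product_bound[of N e e, OF e e] by linarith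
    \<comment> \<open>Smallness of the orbital errors turns this quartic term into a quadratic
      one.\<close>
    also have "\<dots> \<le> 4 * Q\<^sup>2 * 1 * ?S"
      using small S0 by (intro mult_right_mono mult_left_mono) auto
    finally show "(\<integral>x. density N e x * density N e x \<partial>M) \<le> 4 * Q\<^sup>2 * 1 * ?S" .
  qed
  finally show ?thesis by (simp add: algebra_simps)
qed

text \<open>The terms of \<open>energy_difference\<close> are bounded one by one. All coefficients
  depend on the continuous solution, on \<open>Q\<close> and on \<open>Cr\<close>, but not on the
  discrete solution.\<close>

lemma energy_error_bound:
  assumes small: "(\<Sum>i=1..N. (H1_norm \<Omega> (e i))\<^sup>2) \<le> 1"
  defines "P \<equiv> \<Sum>i=1..N. (H1_norm \<Omega> (\<Psi> i))\<^sup>2" and "p \<equiv> \<Sum>i=1..N. H1_norm \<Omega> (\<Psi> i)"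
    and "c \<equiv> \<Sum>i=1..N. \<bar>\<epsilon> i\<bar>"
  shows "\<bar>KS_energy \<Omega> N F b \<Psi>h \<phi>h - KS_energy \<Omega> N F b \<Psi> \<phi>\<bar> \<le>
    (1 + 2 * c + Cr * (2 + 4 * Q\<^sup>2 * (P + 1)) + 2 * Q * H1_norm \<Omega> \<phi>) * (\<Sum>i=1..N. (H1_norm \<Omega> (e i))\<^sup>2)
    + (H1_seminorm \<Omega> f)\<^sup>2 + Q * (4 * p + 2) * (\<Sum>i=1..N. L2_norm \<Omega> (e i) * H1_norm \<Omega> f)"
proof -
  let ?S = "\<Sum>i=1..N. (H1_norm \<Omega> (e i))\<^sup>2" and ?T = "\<Sum>i=1..N. L2_norm \<Omega> (e i) * H1_norm \<Omega> f"
  have L2H1: "(L2_norm \<Omega> (e i))\<^sup>2 \<le> (H1_norm \<Omega> (e i))\<^sup>2" for i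
    by (intro power_mono L2_norm_le_H1_norm L2_norm_nonneg)
  have t1: "\<bar>\<Sum>i=1..N. (H1_seminorm \<Omega> (e i))\<^sup>2\<bar> \<le> ?S"
  proof -
    have "(\<Sum>i=1..N. (H1_seminorm \<Omega> (e i))\<^sup>2) \<le> ?S" by (intro sum_mono) (simp add: H1_norm_sq)
    then show ?thesis by (simp add: sum_nonneg)
  qed
  have t2: "\<bar>\<Sum>i=1..N. \<epsilon> i * (L2_norm \<Omega> (e i))\<^sup>2\<bar> \<le> c * ?S"
  proof -
    have "\<bar>\<Sum>i=1..N. \<epsilon> i * (L2_norm \<Omega> (e i))\<^sup>2\<bar> \<le> (\<Sum>i=1..N. \<bar>\<epsilon> i\<bar> * (H1_norm \<Omega> (e i))\<^sup>2)"
      by (rule order_trans[OF sum_abs]) (auto simp: abs_mult intro!: sum_mono mult_left_mono L2H1)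
    also have "\<dots> \<le> (\<Sum>i=1..N. c * (H1_norm \<Omega> (e i))\<^sup>2)"
      unfolding c_def by (intro sum_mono mult_right_mono member_le_sum) auto
    finally show ?thesis by (simp add: sum_distrib_left)
  qed
  have t3: "\<bar>\<integral>x. xc_remainder x \<partial>M\<bar> \<le> Cr * (2 + 4 * Q\<^sup>2 * (P + 1)) * ?S"
    unfolding P_def by (rule xc_remainder_bound[OF small])
  have t4: "\<bar>1 / (8 * pi) * (H1_seminorm \<Omega> f)\<^sup>2\<bar> \<le> (H1_seminorm \<Omega> f)\<^sup>2"
  proof -
    have "1 / (8 * pi) \<le> 1" using pi_gt3 by simp
    then have "1 / (8 * pi) * (H1_seminorm \<Omega> f)\<^sup>2 \<le> 1 * (H1_seminorm \<Omega> f)\<^sup>2" by (rule mult_right_mono) simp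
    then show ?thesis by (simp add: abs_mult)
  qed
  have t5: "\<bar>\<integral>x. \<phi> x * density N e x \<partial>M\<bar> \<le> 2 * Q * H1_norm \<Omega> \<phi> * ?S"
  proof -
    have b: "\<bar>\<integral>x. \<phi> x * (e i x * e i x) \<partial>M\<bar> \<le> Q * H1_norm \<Omega> \<phi> * (H1_norm \<Omega> (e i))\<^sup>2" if i: "i \<in> {1..N}" for i
    proof -
      have "\<bar>\<integral>x. \<phi> x * (e i x * e i x) \<partial>M\<bar> \<le> L2_norm \<Omega> \<phi> * (Q * H1_norm \<Omega> (e i) * H1_norm \<Omega> (e i))"
        by (intro trilinear_bound e i X_H1_wgrad \<phi>)
      also have "\<dots> \<le> H1_norm \<Omega> \<phi> * (Q * H1_norm \<Omega> (e i) * H1_norm \<Omega> (e i))"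
        by (intro mult_right_mono L2_norm_le_H1_norm mult_nonneg_nonneg Q_nonneg H1_norm_nonneg)
      finally show ?thesis by (simp add: power2_eq_square mult_ac)
    qed
    have "\<bar>\<integral>x. \<phi> x * density N e x \<partial>M\<bar> = 2 * \<bar>\<Sum>i=1..N. \<integral>x. \<phi> x * (e i x * e i x) \<partial>M\<bar>"
      unfolding integral_mult_density_e[OF X_H1_wgrad(2)[OF \<phi>]] by (simp add: abs_mult)
    also have "\<dots> \<le> 2 * (\<Sum>i=1..N. Q * H1_norm \<Omega> \<phi> * (H1_norm \<Omega> (e i))\<^sup>2)"
      by (intro mult_left_mono order_trans[OF sum_abs] sum_mono b) auto
    finally show ?thesis by (simp add: sum_distrib_left mult_ac)
  qed
  have tri: "\<bar>\<integral>x. f x * (u x * e i x) \<partial>M\<bar> \<le> Q * H1_norm \<Omega> u * (L2_norm \<Omega> (e i) * H1_norm \<Omega> f)"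
    if i: "i \<in> {1..N}" and u: "u \<in> X" for i u
  proof -
    have "\<bar>\<integral>x. e i x * (u x * f x) \<partial>M\<bar> \<le> L2_norm \<Omega> (e i) * (Q * H1_norm \<Omega> u * H1_norm \<Omega> f)"
      by (intro trilinear_bound u f X_H1_wgrad e i)
    then show ?thesis by (simp add: mult_ac)
  qed
  have LT: "0 \<le> L2_norm \<Omega> (e i) * H1_norm \<Omega> f" for i by (simp add: L2_norm_nonneg H1_norm_nonneg)
  have t6: "\<bar>\<integral>x. f x * cross x \<partial>M\<bar> \<le> 4 * (Q * p * ?T)"
  proof -
    have b: "\<bar>\<integral>x. f x * (\<Psi> i x * e i x) \<partial>M\<bar> \<le> Q * p * (L2_norm \<Omega> (e i) * H1_norm \<Omega> f)" if i: "i \<in> {1..N}" for i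
    proof (rule order_trans[OF tri[OF i \<Psi>[OF i]]])
      have "H1_norm \<Omega> (\<Psi> i) \<le> p" unfolding p_def using i by (intro member_le_sum) (auto simp: H1_norm_nonneg)
      then show "Q * H1_norm \<Omega> (\<Psi> i) * (L2_norm \<Omega> (e i) * H1_norm \<Omega> f) \<le> Q * p * (L2_norm \<Omega> (e i) * H1_norm \<Omega> f)"
        by (intro mult_right_mono mult_left_mono Q_nonneg LT)
    qed
    have "\<bar>\<integral>x. f x * cross x \<partial>M\<bar> = 4 * \<bar>\<Sum>i=1..N. \<integral>x. f x * (\<Psi> i x * e i x) \<partial>M\<bar>"
      unfolding integral_mult_cross[OF X_H1_wgrad(2)[OF f]] by (simp add: abs_mult)
    also have "\<dots> \<le> 4 * (\<Sum>i=1..N. Q * p * (L2_norm \<Omega> (e i) * H1_norm \<Omega> f))"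
      by (intro mult_left_mono order_trans[OF sum_abs] sum_mono b) auto
    finally show ?thesis by (simp add: sum_distrib_left)
  qed
  have t7: "\<bar>\<integral>x. f x * density N e x \<partial>M\<bar> \<le> 2 * (Q * ?T)"
  proof -
    have b: "\<bar>\<integral>x. f x * (e i x * e i x) \<partial>M\<bar> \<le> Q * (L2_norm \<Omega> (e i) * H1_norm \<Omega> f)" if i: "i \<in> {1..N}" for i
    proof (rule order_trans[OF tri[OF i e[OF i]]])
      \<comment> \<open>One of the two factors \<open>e i\<close> is bounded by 1 in the H1 norm,
        which makes this cubic term one of mixed type.\<close>
      have "(H1_norm \<Omega> (e i))\<^sup>2 \<le> ?S" using i by (intro member_le_sum) auto
      then have "(H1_norm \<Omega> (e i))\<^sup>2 \<le> 1\<^sup>2" using small by simp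
      then have "H1_norm \<Omega> (e i) \<le> 1" by (rule power2_le_imp_le) simp
      then have "Q * H1_norm \<Omega> (e i) \<le> Q * 1" by (intro mult_left_mono Q_nonneg)
      then show "Q * H1_norm \<Omega> (e i) * (L2_norm \<Omega> (e i) * H1_norm \<Omega> f) \<le> Q * (L2_norm \<Omega> (e i) * H1_norm \<Omega> f)"
        by (intro mult_right_mono LT) simp
    qed
    have "\<bar>\<integral>x. f x * density N e x \<partial>M\<bar> = 2 * \<bar>\<Sum>i=1..N. \<integral>x. f x * (e i x * e i x) \<partial>M\<bar>"
      unfolding integral_mult_density_e[OF X_H1_wgrad(2)[OF f]] by (simp add: abs_mult)
    also have "\<dots> \<le> 2 * (\<Sum>i=1..N. Q * (L2_norm \<Omega> (e i) * H1_norm \<Omega> f))"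
      by (intro mult_left_mono order_trans[OF sum_abs] sum_mono b) auto
    finally show ?thesis by (simp add: sum_distrib_left)
  qed
  have "\<bar>KS_energy \<Omega> N F b \<Psi>h \<phi>h - KS_energy \<Omega> N F b \<Psi> \<phi>\<bar>
     \<le> ?S + 2 * (c * ?S) + Cr * (2 + 4 * Q\<^sup>2 * (P + 1)) * ?S + (H1_seminorm \<Omega> f)\<^sup>2
       + 2 * Q * H1_norm \<Omega> \<phi> * ?S + (4 * (Q * p * ?T) + 2 * (Q * ?T))"
  proof -
    have "\<bar>a1 - 2 * a2 + a3 - a4 + a5 + (a6 + a7)\<bar> \<le> b1 + 2 * b2 + b3 + b4 + b5 + (b6 + b7)"
      if "\<bar>a1\<bar> \<le> b1" "\<bar>a2\<bar> \<le> b2" "\<bar>a3\<bar> \<le> b3" "\<bar>a4\<bar> \<le> b4" "\<bar>a5\<bar> \<le> b5" "\<bar>a6\<bar> \<le> b6" "\<bar>a7\<bar> \<le> b7"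
      for a1 a2 a3 a4 a5 a6 a7 b1 b2 b3 b4 b5 b6 b7 :: real
      using that unfolding abs_le_iff by linarith
    from this[OF t1 t2 t3 t4 t5 t6 t7] show ?thesis unfolding energy_difference .
  qed
  also have "\<dots> = (1 + 2 * c + Cr * (2 + 4 * Q\<^sup>2 * (P + 1)) + 2 * Q * H1_norm \<Omega> \<phi>) * ?S
    + (H1_seminorm \<Omega> f)\<^sup>2 + Q * (4 * p + 2) * ?T"
    by (simp add: algebra_simps)
  finally show ?thesis .
qed

end
end

lemma xc_energy_measurable: "xc_energy \<gamma> \<beta>1 \<beta>2 A B C D \<in> borel_measurable borel"
  unfolding xc_energy_def[abs_def] eps_x_def eps_c_def wigner_seitz_def Let_def by measurable

theorem proposition3p2:
  fixes \<Omega> :: "(real^3) set" and X :: "(real^3 \<Rightarrow> real) set"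
    and b :: "real^3 \<Rightarrow> real" and F :: "real \<Rightarrow> real" and N :: nat
    and \<gamma> \<beta>1 \<beta>2 Ac Bc Cc Dc :: real
    and \<Psi> :: "nat \<Rightarrow> real^3 \<Rightarrow> real" and \<phi> :: "real^3 \<Rightarrow> real" and \<epsilon> :: "nat \<Rightarrow> real"
  assumes "open \<Omega>" and "connected \<Omega>" and "bounded \<Omega>" and "\<Omega> \<noteq> {}"
    and "wavefunction_space \<Omega> X"
    and "smooth_on \<Omega> b" and "bounded (b ` \<Omega>)"
    and "\<beta>1 > 0" and "\<beta>2 > 0"
    and "F = xc_energy \<gamma> \<beta>1 \<beta>2 Ac Bc Cc Dc"
    and "Ck_on 2 {0<..} F"
    and "N \<ge> 1"
    and "KS_solution \<Omega> X N F b \<Psi> \<phi> \<epsilon>"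
  shows "\<exists>C>0. \<exists>U. H1_product_neighborhood \<Omega> N \<Psi> \<phi> U \<and>
    (\<forall>Xh \<Psi>h \<phi>h \<epsilon>h.
       finite_dim_subspace Xh X \<and> KS_solution \<Omega> Xh N F b \<Psi>h \<phi>h \<epsilon>h \<and> (\<Psi>h, \<phi>h) \<in> U \<longrightarrow>
       \<bar>KS_energy \<Omega> N F b \<Psi>h \<phi>h - KS_energy \<Omega> N F b \<Psi> \<phi>\<bar>
         \<le> C * ((\<Sum>i=1..N. (H1_norm \<Omega> (\<lambda>x. \<Psi> i x - \<Psi>h i x))\<^sup>2)
              + (H1_seminorm \<Omega> (\<lambda>x. \<phi> x - \<phi>h x))\<^sup>2
              + (\<Sum>i=1..N. L2_norm \<Omega> (\<lambda>x. \<Psi> i x - \<Psi>h i x) * H1_norm \<Omega> (\<lambda>x. \<phi> x - \<phi>h x))))"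
proof -
  note F = \<open>F = xc_energy \<gamma> \<beta>1 \<beta>2 Ac Bc Cc Dc\<close> and sol = \<open>KS_solution \<Omega> X N F b \<Psi> \<phi> \<epsilon>\<close>
  obtain K where "H1_L4_subspace \<Omega> X K"
    using wavefunction_space_H1_L4[OF \<open>open \<Omega>\<close> \<open>bounded \<Omega>\<close> \<open>wavefunction_space \<Omega> X\<close>] .
  then interpret H1_L4_subspace \<Omega> X K .
  obtain F2 Kf where xc_pos: "\<forall>\<rho>>0. (F has_real_derivative deriv F \<rho>) (at \<rho>) \<and> (deriv F has_real_derivative F2 \<rho>) (at \<rho>) \<and>
      \<bar>deriv F \<rho>\<bar> \<le> Kf * (1 + \<rho>) \<and> \<bar>F2 \<rho>\<bar> \<le> Kf * (1 + \<rho>) / \<rho>"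
    and xc_nonneg: "\<forall>\<rho>\<ge>0. \<bar>F \<rho>\<bar> \<le> Kf * \<rho> * (1 + \<rho>)"
    using xc_energy_bounds[OF \<open>\<beta>1 > 0\<close> \<open>\<beta>2 > 0\<close> F \<open>Ck_on 2 {0<..} F\<close>] by (elim exE conjE)
  have xc: "(F has_real_derivative deriv F \<rho>) (at \<rho>)" "(deriv F has_real_derivative F2 \<rho>) (at \<rho>)"
      "\<bar>deriv F \<rho>\<bar> \<le> Kf * (1 + \<rho>)" "\<bar>F2 \<rho>\<bar> \<le> Kf * (1 + \<rho>) / \<rho>" if "\<rho> > 0" for \<rho>
    using xc_pos that by simp_all
  have Kf: "Kf \<ge> 0" using xc(3)[of 1] by simp
  define F1 where "F1 \<rho> = (if \<rho> \<in> {0<..} then deriv F \<rho> else 0)" for \<rho>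
  interpret KS_model \<Omega> X K N F F1 b Kf "101 * Kf"
  proof
    show "F \<in> borel_measurable borel" unfolding F by (rule xc_energy_measurable)
    have "continuous_on {0<..} (deriv F)"
      using xc(2) by (auto intro!: continuous_at_imp_continuous_on DERIV_isCont)
    then show "F1 \<in> borel_measurable borel"
      unfolding F1_def[abs_def] by (intro borel_measurable_continuous_on_if) (auto intro: continuous_on_const)
    show "\<bar>F \<rho>\<bar> \<le> Kf * \<rho> * (1 + \<rho>)" if "\<rho> \<ge> 0" for \<rho> using xc_nonneg that by simp
    show "\<bar>F1 \<rho>\<bar> \<le> Kf * (1 + \<rho>)" if "\<rho> \<ge> 0" for \<rho>
      using xc(3)[of \<rho>] Kf that by (simp add: F1_def)
    show "F1 \<rho> = deriv F \<rho>" if "\<rho> > 0" for \<rho> using that by (simp add: F1_def)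
    show "\<bar>F (\<rho> + s + d) - F \<rho> - F1 \<rho> * s\<bar> \<le> 101 * Kf * (1 + \<rho> + d) * d"
      if "\<rho> \<ge> 0" "d \<ge> 0" "s\<^sup>2 \<le> 4 * \<rho> * d" for \<rho> s d
    proof (rule density_functional_remainder[where ?F2.0=F2])
      show "(F has_real_derivative F1 \<rho>) (at \<rho>)" if "\<rho> > 0" for \<rho> using xc(1)[OF that] that by (simp add: F1_def)
      show "(F1 has_real_derivative F2 \<rho>) (at \<rho>)" if "\<rho> > 0" for \<rho>
        by (rule has_field_derivative_transform_within_open[OF xc(2)[OF that], of "{0<..}"])
          (use that in \<open>auto simp: F1_def\<close>)
      show "\<bar>F1 \<rho>\<bar> \<le> Kf * (1 + \<rho>)" if "\<rho> > 0" for \<rho> using xc(3)[OF that] that by (simp add: F1_def)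
    qed (use that xc(4) xc_nonneg in auto)
    show "0 \<le> 101 * Kf" using Kf by simp
    have "Ck_on 0 \<Omega> b" using \<open>smooth_on \<Omega> b\<close> unfolding smooth_on_def by blast
    then have "continuous_on \<Omega> b" by simp
    then have "(\<lambda>x. indicator \<Omega> x *\<^sub>R b x) \<in> borel_measurable borel"
      by (intro borel_measurable_continuous_on_indicator) simp_all
    then have "b \<in> borel_measurable M" by (simp add: borel_measurable_restrict_space_iff)
    moreover obtain B where "\<And>x. x \<in> \<Omega> \<Longrightarrow> norm (b x) \<le> B"
      using \<open>bounded (b ` \<Omega>)\<close> unfolding bounded_iff by blast
    ultimately show "square_integrable \<Omega> b" by (rule square_integrable_bounded)
  qed
  define a where "a = 1 + 2 * (\<Sum>i=1..N. \<bar>\<epsilon> i\<bar>)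
    + 101 * Kf * (2 + 4 * Q\<^sup>2 * ((\<Sum>i=1..N. (H1_norm \<Omega> (\<Psi> i))\<^sup>2) + 1)) + 2 * Q * H1_norm \<Omega> \<phi>"
  define a' where "a' = Q * (4 * (\<Sum>i=1..N. H1_norm \<Omega> (\<Psi> i)) + 2)"
  \<comment> \<open>Large enough for all three coefficients: \<open>a\<close> of the squared orbital
    errors, 1 of the squared seminorm, and \<open>a'\<close> of the mixed term.\<close>
  define C where "C = a + a' + 1"
  have a: "a \<ge> 0" "a' \<ge> 0"
    unfolding a_def a'_def using Kf
    by (auto intro!: add_nonneg_nonneg mult_nonneg_nonneg sum_nonneg Q_nonneg H1_norm_nonneg)
  \<comment> \<open>Radius 1 is chosen because the estimate asks that the squared orbital errors sum
    to at most 1.\<close>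
  define U where "U = {(\<Psi>', \<phi>'). sqrt ((\<Sum>i=1..N. (H1_norm \<Omega> (\<lambda>x. \<Psi>' i x - \<Psi> i x))\<^sup>2) + (H1_norm \<Omega> (\<lambda>x. \<phi>' x - \<phi> x))\<^sup>2) < 1}"
  have "H1_product_neighborhood \<Omega> N \<Psi> \<phi> U"
    unfolding H1_product_neighborhood_def U_def by (intro exI[of _ 1]) simp
  moreover have "\<bar>KS_energy \<Omega> N F b \<Psi>h \<phi>h - KS_energy \<Omega> N F b \<Psi> \<phi>\<bar>
         \<le> C * ((\<Sum>i=1..N. (H1_norm \<Omega> (\<lambda>x. \<Psi> i x - \<Psi>h i x))\<^sup>2)
              + (H1_seminorm \<Omega> (\<lambda>x. \<phi> x - \<phi>h x))\<^sup>2
              + (\<Sum>i=1..N. L2_norm \<Omega> (\<lambda>x. \<Psi> i x - \<Psi>h i x) * H1_norm \<Omega> (\<lambda>x. \<phi> x - \<phi>h x)))"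
    (is "_ \<le> C * (?S + ?f + ?T)")
    if Xh: "finite_dim_subspace Xh X" and solh: "KS_solution \<Omega> Xh N F b \<Psi>h \<phi>h \<epsilon>h" and U: "(\<Psi>h, \<phi>h) \<in> U"
    for Xh \<Psi>h \<phi>h \<epsilon>h
  proof -
    have X: "\<Psi>h i \<in> X" "\<Psi> i \<in> X" if "i \<in> {1..N}" for i
      using Xh solh sol that unfolding finite_dim_subspace_def KS_solution_def by blast+
    have X\<phi>: "\<phi>h \<in> X" "\<phi> \<in> X"
      using Xh solh sol unfolding finite_dim_subspace_def KS_solution_def by blast+
    have norm1: "(LINT x:\<Omega>|lborel. \<Psi>h i x * \<Psi>h i x) = 1" if "i \<in> {1..N}" for i
      using solh that unfolding KS_solution_def by auto
    note sym = H1_norms_diff_commute[OF X_H1_wgrad(1)[OF X(2)] X_H1_wgrad(1)[OF X(1)]]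
      and sym\<phi> = H1_norms_diff_commute[OF X_H1_wgrad(1)[OF X\<phi>(2)] X_H1_wgrad(1)[OF X\<phi>(1)]]
    have S: "?S = (\<Sum>i=1..N. (H1_norm \<Omega> (\<lambda>x. \<Psi>h i x - \<Psi> i x))\<^sup>2)"
      by (intro sum.cong refl) (simp only: sym)
    have T: "?T = (\<Sum>i=1..N. L2_norm \<Omega> (\<lambda>x. \<Psi>h i x - \<Psi> i x) * H1_norm \<Omega> (\<lambda>x. \<phi>h x - \<phi> x))"
      by (intro sum.cong refl) (simp only: sym sym\<phi>)
    have "sqrt (?S + (H1_norm \<Omega> (\<lambda>x. \<phi>h x - \<phi> x))\<^sup>2) < 1"
      using U unfolding S U_def by simp
    then have "?S + (H1_norm \<Omega> (\<lambda>x. \<phi>h x - \<phi> x))\<^sup>2 < 1" by simp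
    then have small: "(\<Sum>i=1..N. (H1_norm \<Omega> (\<lambda>x. \<Psi>h i x - \<Psi> i x))\<^sup>2) \<le> 1"
      unfolding S[symmetric] using zero_le_power2[of "H1_norm \<Omega> (\<lambda>x. \<phi>h x - \<phi> x)"] by linarith
    have "\<bar>KS_energy \<Omega> N F b \<Psi>h \<phi>h - KS_energy \<Omega> N F b \<Psi> \<phi>\<bar> \<le> a * ?S + ?f + a' * ?T"
      unfolding S T sym\<phi>(2) a_def a'_def
      by (rule energy_error_bound[OF sol X(1) X\<phi>(1) norm1 small])
    also have "\<dots> \<le> C * ?S + C * ?f + C * ?T"
    proof (intro add_mono)
      have "0 \<le> ?S" "0 \<le> ?T"
        by (auto intro!: sum_nonneg mult_nonneg_nonneg L2_norm_nonneg H1_norm_nonneg)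
      then show "a * ?S \<le> C * ?S" "a' * ?T \<le> C * ?T"
        using a by (auto intro!: mult_right_mono simp: C_def)
      have "1 * ?f \<le> C * ?f" using a by (intro mult_right_mono) (auto simp: C_def)
      then show "?f \<le> C * ?f" by simp
    qed
    finally show ?thesis by (simp only: distrib_left)
  qed
  moreover have "C > 0" using a by (simp add: C_def)
  ultimately show ?thesis by blast
qed

end
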